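(* Let $F$ be a self-affine carpet (as defined in the context), the attractor of $\{S_i\}_{i\in\mathcal I}$. If $F$ is of horizontal type, then \[ \dim_{\mathrm A}F=\dim_{\mathrm B}\pi_1(F)+\max_{i\in\mathcal I}\dim_{\mathrm B}\mathrm{Slice}_{1,i}(F); \] if $F$ is of vertical type, then \[ \dim_{\mathrm A}F=\dim_{\mathrm B}\pi_2(F)+\max_{i\in\mathcal I}\dim_{\mathrm B}\mathrm{Slice}_{2,i}(F); \] and if $F$ is of mixed type, then \[ \dim_{\mathrm A}F=\max_{i\in\mathcal I}\max_{j=1,2}\big(\dim_{\mathrm B}\pi_j(F)+\dim_{\mathrm B}\mathrm{Slice}_{j,i}(F)\big). \]
   Context: Self-affine carpets. Two classes of finite iterated function systems (IFS) on $[0,1]^2$ are considered. Extended Lalley–Gatzouras class: divide $[0,1]^2$ into columns by a finite positive number of vertical lines; divide each column independently into rectangles by horizontal slices; select a subset of the resulting rectangles, subject only to the requirement that each selected rectangle has base length greater than or equal to its height. Barański class: divide $[0,1]^2$ into a grid of rectangles by a finite number of full vertical lines and full horizontal lines (at least one in each direction); select any subset of the resulting rectangles. In both cases, for each selected rectangle include in the IFS the orientation-preserving map $S_i(x,y)=(c_ix,d_iy)+(a_i,b_i)$ taking $[0,1]^2$ onto that rectangle; thus $c_i,d_i\in(0,1)$ are its base length and height. The index set is $\mathcal I$, finite with $|\mathcal I|\geq2$. The attractor is the unique non-empty compact $F$ with $F=\bigcup_{i\in\mathcal I}S_i(F)$. $F$ is called a self-affine carpet if it is the attractor of an IFS in one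 of these two classes with at least one map that is not a similarity (i.e. $c_i\neq d_i$ for some $i$). $F$ is of horizontal type if $c_i\geq d_i$ for all $i$; of vertical type if $c_i\leq d_i$ for all $i$; of mixed type otherwise. $\pi_1,\pi_2$ are the orthogonal projections of the plane onto the horizontal and vertical axes respectively. $\mathrm{Slice}_{1,i}(F)$ is the intersection of $F$ with the vertical line through the fixed point of $S_i$; $\mathrm{Slice}_{2,i}(F)$ is the intersection of $F$ with the horizontal line through the fixed point of $S_i$. $\dim_{\mathrm B}$ is box dimension. Assouad dimension: with $N_r(E)$ the smallest number of open sets of diameter at most $r$ needed to cover $E$ and $B(x,R)$ the closed ball, \[ \dim_{\mathrm A}F=\inf\Big\{\alpha:\ \exists\, C,\rho>0 \text{ such that for all } 0<r<R\leq\rho,\ \sup_{x\in F}N_r(B(x,R)\cap F)\leq C (R/r)^{\alpha}\Big\}. \] *)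

theory Defs
  imports "HOL-Analysis.Analysis"
begin

text \<open>
  The library \<^term>\<open>diameter\<close> is meaningless on unbounded sets, hence the explicit
  boundedness.  The number itself is only meaningful for totally bounded sets,
  i.e. bounded sets in the Euclidean setting.
\<close>

definition covering_number :: "real \<Rightarrow> 'a::euclidean_space set \<Rightarrow> nat" where
  "covering_number r E =
     (LEAST n. \<exists>\<U>. finite \<U> \<and> card \<U> = n
        \<and> (\<forall>U\<in>\<U>. open U \<and> bounded U \<and> diameter U \<le> r) \<and> E \<subseteq> \<Union>\<U>)"

definition has_box_dim :: "'a::euclidean_space set \<Rightarrow> real \<Rightarrow> bool" where
  "has_box_dim E s \<longleftrightarrow>
     ((\<lambda>r. ln (real (covering_number r E)) / - ln r) \<longlongrightarrow> s) (at_right 0)"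

definition box_dim_exists :: "'a::euclidean_space set \<Rightarrow> bool" where
  "box_dim_exists E \<longleftrightarrow> (\<exists>s. has_box_dim E s)"

definition box_dim :: "'a::euclidean_space set \<Rightarrow> real" where
  "box_dim E = (THE s. has_box_dim E s)"

definition assouad_dim :: "'a::euclidean_space set \<Rightarrow> real" where
  "assouad_dim F = Inf {\<alpha>. \<exists>C \<rho>. C > 0 \<and> \<rho> > 0 \<and>
     (\<forall>r R. 0 < r \<and> r < R \<and> R \<le> \<rho> \<longrightarrow>
       (\<forall>x\<in>F. real (covering_number r (cball x R \<inter> F)) \<le> C * (R / r) powr \<alpha>))}"

definition diag_affine ::
    "real \<Rightarrow> real \<Rightarrow> real \<Rightarrow> real \<Rightarrow> real \<times> real \<Rightarrow> real \<times> real" where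
  "diag_affine c d a b = (\<lambda>(x, y). (c * x + a, d * y + b))"

definition fixed_point :: "('a \<Rightarrow> 'a) \<Rightarrow> 'a" where
  "fixed_point f = (THE p. f p = p)"

definition is_attractor :: "'i set \<Rightarrow> ('i \<Rightarrow> 'a \<Rightarrow> 'a) \<Rightarrow> 'a::topological_space set \<Rightarrow> bool" where
  "is_attractor I S F \<longleftrightarrow> F \<noteq> {} \<and> compact F \<and> F = (\<Union>i\<in>I. S i ` F)"

text \<open>Division of the unit interval into n intervals by n - 1 distinct interior points.\<close>

definition subdivision :: "nat \<Rightarrow> (nat \<Rightarrow> real) \<Rightarrow> bool" where
  "subdivision n t \<longleftrightarrow> t 0 = 0 \<and> t n = 1 \<and> (\<forall>k<n. t k < t (Suc k))"

text \<open>
  In both classes \<open>k i\<close> and \<open>l i\<close> are the column and row numbers of the selected rectangle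
  belonging to i; injectivity says that each selected rectangle contributes exactly one map.
  At least one dividing line means at least two columns (rows).
\<close>

definition extended_lalley_gatzouras ::
    "'i set \<Rightarrow> ('i \<Rightarrow> real) \<Rightarrow> ('i \<Rightarrow> real) \<Rightarrow> ('i \<Rightarrow> real) \<Rightarrow> ('i \<Rightarrow> real) \<Rightarrow> bool" where
  "extended_lalley_gatzouras I c d a b \<longleftrightarrow>
     (\<exists>n x m y k l. n \<ge> 2 \<and> subdivision n x \<and> (\<forall>j<n. subdivision (m j) (y j))
        \<and> inj_on (\<lambda>i. (k i, l i)) I
        \<and> (\<forall>i\<in>I. k i < n \<and> l i < m (k i)
             \<and> a i = x (k i) \<and> c i = x (Suc (k i)) - x (k i)
             \<and> b i = y (k i) (l i) \<and> d i = y (k i) (Suc (l i)) - y (k i) (l i)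
             \<and> c i \<ge> d i))"

definition baranski ::
    "'i set \<Rightarrow> ('i \<Rightarrow> real) \<Rightarrow> ('i \<Rightarrow> real) \<Rightarrow> ('i \<Rightarrow> real) \<Rightarrow> ('i \<Rightarrow> real) \<Rightarrow> bool" where
  "baranski I c d a b \<longleftrightarrow>
     (\<exists>n x m y k l. n \<ge> 2 \<and> m \<ge> 2 \<and> subdivision n x \<and> subdivision m y
        \<and> inj_on (\<lambda>i. (k i, l i)) I
        \<and> (\<forall>i\<in>I. k i < n \<and> l i < m
             \<and> a i = x (k i) \<and> c i = x (Suc (k i)) - x (k i)
             \<and> b i = y (l i) \<and> d i = y (Suc (l i)) - y (l i)))"

definition self_affine_carpet ::
    "'i set \<Rightarrow> ('i \<Rightarrow> real) \<Rightarrow> ('i \<Rightarrow> real) \<Rightarrow> ('i \<Rightarrow> real) \<Rightarrow> ('i \<Rightarrow> real)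
       \<Rightarrow> (real \<times> real) set \<Rightarrow> bool" where
  "self_affine_carpet I c d a b F \<longleftrightarrow>
     finite I \<and> card I \<ge> 2
     \<and> (extended_lalley_gatzouras I c d a b \<or> baranski I c d a b)
     \<and> (\<exists>i\<in>I. c i \<noteq> d i)
     \<and> is_attractor I (\<lambda>i. diag_affine (c i) (d i) (a i) (b i)) F"

definition horizontal_type :: "'i set \<Rightarrow> ('i \<Rightarrow> real) \<Rightarrow> ('i \<Rightarrow> real) \<Rightarrow> bool" where
  "horizontal_type I c d \<longleftrightarrow> (\<forall>i\<in>I. c i \<ge> d i)"

definition vertical_type :: "'i set \<Rightarrow> ('i \<Rightarrow> real) \<Rightarrow> ('i \<Rightarrow> real) \<Rightarrow> bool" where
  "vertical_type I c d \<longleftrightarrow> (\<forall>i\<in>I. c i \<le> d i)"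

definition mixed_type :: "'i set \<Rightarrow> ('i \<Rightarrow> real) \<Rightarrow> ('i \<Rightarrow> real) \<Rightarrow> bool" where
  "mixed_type I c d \<longleftrightarrow> \<not> horizontal_type I c d \<and> \<not> vertical_type I c d"

definition slice1 ::
    "(real \<times> real \<Rightarrow> real \<times> real) \<Rightarrow> (real \<times> real) set \<Rightarrow> (real \<times> real) set" where
  "slice1 T F = F \<inter> {p. fst p = fst (fixed_point T)}"

definition slice2 ::
    "(real \<times> real \<Rightarrow> real \<times> real) \<Rightarrow> (real \<times> real) set \<Rightarrow> (real \<times> real) set" where
  "slice2 T F = F \<inter> {p. snd p = snd (fixed_point T)}"

end

theory Submission
  imports Defs
begin

text \<open>
  Write \<open>c\<close>, \<open>d\<close> for the widths and heights of the selected rectangles. All rectangles of a column have the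
  same width, so the projection of the attractor to the horizontal axis is self-similar: one contraction
  per occupied column, non-overlapping, with box dimension the exponent \<open>s\<close> for which the column widths
  satisfy \<open>\<Sum> width\<^sup>s = 1\<close>. The vertical line through the fixed point of a map \<open>S\<^sub>i\<close> meets only the column of
  \<open>i\<close>, and the maps of that column preserve this line; hence the slice is self-similar with the heights
  of the column as ratios, and its dimension \<open>t\<^sub>i\<close> solves \<open>\<Sum> d\<^sub>j\<^sup>t = 1\<close>, summed over the column
  (\<open>fiber_system\<close>, \<open>slice_box_dim\<close>). On the line, both facts come from cutting the set into pieces of
  comparable length while preserving the Moran sum (\<open>tiling_exists\<close>).

  Lower bound (\<open>assouad_exponent_ge\<close>). Suppose that some map \<open>S\<^sub>0\<close> has \<open>d < c\<close>. The image of the unit square under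
  a high power of \<open>S\<^sub>0\<close> is a very flat rectangle. Cut it vertically along a long word that repeats the
  column of \<open>i\<close>, until the width is about the height. The resulting approximate square of the attractor
  looks, after rescaling, almost like the product of the horizontal projection and the slice of \<open>i\<close>: the
  horizontal coordinates are exactly those of the projection, and the heights of the long words of the
  column accumulate at the slice. So it contains about \<open>\<epsilon>\<^bsup>-s-t\<^esup>\<close> points that are separated at the
  relative scale \<open>\<epsilon>\<close>.

  Upper bound, when all maps have \<open>d \<le> c\<close> (\<open>assouad_exponent_horizontal\<close>). Every ball of radius \<open>R\<close>
  meets boundedly many approximate squares of side about \<open>R\<close> (\<open>assouad_exponent_of_tilings\<close>). Such a
  square consists of a flat rectangle in the construction, restricted to a strip that is given by a
  column word. To count the sets of diameter \<open>r\<close> that are needed, subdivide until the height is about \<open>r\<close>, and charge a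
  piece of width \<open>W\<close> and height \<open>h\<close> the potential \<open>(W/r)\<^sup>s (h/r)\<^sup>t\<close> with \<open>t\<close> the largest \<open>t\<^sub>i\<close>. As long as
  the column word prescribes the column, the width is fixed and \<open>\<Sum> d\<^sub>j\<^sup>t \<le> 1\<close> over that column; afterwards
  all maps occur, and \<open>\<Sum> c\<^sub>j\<^sup>s d\<^sub>j\<^sup>t \<le> 1\<close>. So the potential does not increase (\<open>strip_covering\<close>), it
  dominates the covering number of the final flat pieces, and initially it is about \<open>(R/r)\<^bsup>s+t\<^esup>\<close>.

  For carpets of mixed type, which are built on a grid, rectangles may change between flat and tall. Let
  \<open>s'\<close> be the dimension of the vertical projection and \<open>\<alpha>\<close> the claimed value. Then the sum of
  \<open>(W/r)\<^sup>s (h/r)\<^bsup>\<alpha>-s\<^esup>\<close> and \<open>(h/r)\<^bsup>s'\<^esup> (W/r)\<^bsup>\<alpha>-s'\<^esup>\<close> serves as potential: the new term does not increase inside a column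
  since different rectangles of a column lie in different rows (\<open>column_weight_rows_le_1\<close>). Whichever of
  width and height first becomes about \<open>r\<close>, one of the two terms dominates the covering number
  (\<open>strip_regular_grid\<close>). The vertical type is the horizontal type with the coordinates exchanged.
\<close>


section \<open>Covering numbers\<close>

definition covers :: "real \<Rightarrow> 'a::euclidean_space set \<Rightarrow> 'a set set \<Rightarrow> bool" where
  "covers r E \<U> \<longleftrightarrow> finite \<U> \<and> (\<forall>U\<in>\<U>. open U \<and> bounded U \<and> diameter U \<le> r) \<and> E \<subseteq> \<Union>\<U>"

lemma covering_number_le_card:
  assumes "covers r E \<U>" shows "covering_number r E \<le> card \<U>"
  unfolding covering_number_def by (rule Least_le) (use assms in \<open>auto simp: covers_def\<close>)

lemma diameter_ball_le: "0 \<le> s \<Longrightarrow> diameter (ball x s) \<le> 2 * s" for x :: "'a::euclidean_space"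
  by (cases "s > 0") (auto simp: diameter_ball)

lemma optimal_cover:
  fixes E :: "'a::euclidean_space set"
  assumes "bounded E" "r > 0"
  obtains \<U> where "covers r E \<U>" "card \<U> = covering_number r E"
proof -
  have "compact (closure E)" using assms by (simp add: compact_closure)
  moreover have "closure E \<subseteq> (\<Union>x\<in>closure E. ball x (r/2))" using assms by auto
  ultimately obtain D where D: "D \<subseteq> closure E" "finite D" "closure E \<subseteq> (\<Union>x\<in>D. ball x (r/2))"
    using compactE_image[of "closure E" "closure E" "\<lambda>x. ball x (r/2)"] by (metis open_ball)
  have "covers r E ((\<lambda>x. ball x (r/2)) ` D)"
    using D closure_subset[of E] diameter_ball_le[of "r/2"] \<open>r > 0\<close>
    unfolding covers_def by (auto 0 3)
  then have "\<exists>n \<U>. finite \<U> \<and> card \<U> = n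
        \<and> (\<forall>U\<in>\<U>. open U \<and> bounded U \<and> diameter U \<le> r) \<and> E \<subseteq> \<Union>\<U>"
    unfolding covers_def by blast
  from LeastI_ex[OF this] show ?thesis
    using that unfolding covering_number_def covers_def by blast
qed

lemma covering_number_mono:
  fixes E :: "'a::euclidean_space set"
  assumes "E \<subseteq> E'" "bounded E'" "r > 0" "r \<le> r'"
  shows "covering_number r' E \<le> covering_number r E'"
proof -
  obtain \<U> where "covers r E' \<U>" "card \<U> = covering_number r E'"
    using optimal_cover assms by blast
  moreover from this have "covers r' E \<U>" using assms unfolding covers_def by force
  ultimately show ?thesis using covering_number_le_card by metis
qed

lemma covering_number_UN:
  fixes E :: "'b \<Rightarrow> 'a::euclidean_space set"
  assumes "finite J" "\<And>j. j \<in> J \<Longrightarrow> bounded (E j)" "r > 0"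
  shows "covering_number r (\<Union>j\<in>J. E j) \<le> (\<Sum>j\<in>J. covering_number r (E j))"
proof -
  have "\<forall>j\<in>J. \<exists>\<U>. covers r (E j) \<U> \<and> card \<U> = covering_number r (E j)"
    using optimal_cover assms by metis
  then obtain \<U> where U: "\<And>j. j \<in> J \<Longrightarrow> covers r (E j) (\<U> j) \<and> card (\<U> j) = covering_number r (E j)"
    by metis
  have "covers r (\<Union>j\<in>J. E j) (\<Union>j\<in>J. \<U> j)"
    using U \<open>finite J\<close> unfolding covers_def by fastforce
  then have "covering_number r (\<Union>j\<in>J. E j) \<le> card (\<Union>j\<in>J. \<U> j)" by (rule covering_number_le_card)
  also have "\<dots> \<le> (\<Sum>j\<in>J. card (\<U> j))" by (rule card_UN_le[OF \<open>finite J\<close>])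
  finally show ?thesis using U by simp
qed

lemma covering_number_le_1:
  fixes E :: "'a::euclidean_space set"
  assumes "E \<subseteq> ball x (r/2)" "r > 0"
  shows "covering_number r E \<le> 1"
proof -
  have "covers r E {ball x (r/2)}" 
    using assms diameter_ball_le[of "r/2" x] by (auto simp: covers_def)
  from covering_number_le_card[OF this] show ?thesis by simp
qed

text \<open>
  Openness of the map keeps the covers open and the Lipschitz bound keeps their diameters below \<open>r\<close>.
  This covers coordinate projections as well as the exchange of coordinates.
\<close>

lemma covering_number_image_le:
  fixes f :: "'a::euclidean_space \<Rightarrow> 'b::euclidean_space"
  assumes "\<And>U. open U \<Longrightarrow> open (f ` U)" "\<And>x y. dist (f x) (f y) \<le> dist x y"
    and "bounded E" "r > 0"
  shows "covering_number r (f ` E) \<le> covering_number r E"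
proof -
  obtain \<U> where U: "covers r E \<U>" "card \<U> = covering_number r E"
    using optimal_cover assms by blast
  have bd: "bounded (f ` V)" if "bounded V" for V
    using that assms(2) unfolding bounded_def by (metis (no_types, lifting) imageE order_trans)
  have dm: "diameter (f ` V) \<le> r" if V: "bounded V" "diameter V \<le> r" for V
  proof (rule diameter_le)
    show "f ` V \<noteq> {} \<or> 0 \<le> r" using assms by simp
    fix x y assume "x \<in> f ` V" "y \<in> f ` V"
    then obtain u v where "u \<in> V" "v \<in> V" "x = f u" "y = f v" by auto
    then show "norm (x - y) \<le> r"
      using assms(2)[of u v] diameter_bounded_bound[OF V(1), of u v] V(2) by (simp add: dist_norm)
  qed
  have "covers r (f ` E) ((`) f ` \<U>)"
    using U(1) assms(1) bd dm unfolding covers_def by blast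
  then have "covering_number r (f ` E) \<le> card ((`) f ` \<U>)" by (rule covering_number_le_card)
  also have "\<dots> \<le> card \<U>" using U(1) by (intro card_image_le) (auto simp: covers_def)
  finally show ?thesis using U by simp
qed

lemma covering_number_snd_le:
  fixes Z :: "(real \<times> real) set"
  assumes "bounded Z" "r > 0"
  shows "covering_number r (snd ` Z) \<le> covering_number r Z"
  by (rule covering_number_image_le) (auto simp: open_image_snd dist_snd_le assms)

lemma dist_swap: "dist (prod.swap x) (prod.swap y) = dist x y" for x y :: "real \<times> real"
  by (simp add: dist_prod_def add.commute)

lemma open_swap: "open U \<Longrightarrow> open (prod.swap ` U)" for U :: "(real \<times> real) set"
  unfolding open_dist
  by (metis (mono_tags, lifting) dist_swap image_iff swap_swap)

lemma bounded_swap: "bounded U \<Longrightarrow> bounded (prod.swap ` U)" for U :: "(real \<times> real) set"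
  unfolding bounded_def by (metis dist_swap imageE)

lemma covering_number_swap:
  fixes Z :: "(real \<times> real) set"
  assumes "bounded Z" "r > 0"
  shows "covering_number r (prod.swap ` Z) = covering_number r Z"
proof (rule antisym)
  show "covering_number r (prod.swap ` Z) \<le> covering_number r Z"
    by (rule covering_number_image_le) (auto simp: open_swap dist_swap assms)
  have "covering_number r (prod.swap ` prod.swap ` Z) \<le> covering_number r (prod.swap ` Z)"
    by (rule covering_number_image_le) (auto simp: open_swap dist_swap assms bounded_swap)
  then show "covering_number r Z \<le> covering_number r (prod.swap ` Z)" by (simp add: image_image)
qed

text \<open>
  A set of height at most \<open>r/4\<close> is covered by fattening a cover of its horizontal projection: the
  product of a set of diameter \<open>r/4\<close> with an interval of length \<open>r/2\<close> still has diameter below \<open>r\<close>.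
\<close>

lemma covering_number_thin:
  fixes Z :: "(real \<times> real) set"
  assumes "bounded Z" "r > 0" "snd ` Z \<subseteq> {q..q+h}" "h \<le> r/4"
  shows "covering_number r Z \<le> covering_number (r/4) (fst ` Z)"
proof -
  have "bounded (fst ` Z)" using assms bounded_fst by blast
  then obtain \<U> where U: "covers (r/4) (fst ` Z) \<U>" "card \<U> = covering_number (r/4) (fst ` Z)"
    using optimal_cover[of "fst ` Z" "r/4"] \<open>r > 0\<close> by auto
  define J where "J = {q - r/8 <..< q + r/4 + r/8}"
  have cov: "covers r Z ((\<lambda>U. U \<times> J) ` \<U>)"
    unfolding covers_def
  proof (intro conjI ballI)
    show "finite ((\<lambda>U. U \<times> J) ` \<U>)" using U by (simp add: covers_def)
    show "Z \<subseteq> \<Union> ((\<lambda>U. U \<times> J) ` \<U>)"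
    proof
      fix z assume z: "z \<in> Z"
      then have "snd z \<in> {q..q+h}" using assms(3) by blast
      then have "snd z \<in> J" using assms(2,4) by (simp add: J_def)
      moreover obtain U where "U \<in> \<U>" "fst z \<in> U" using z U(1) unfolding covers_def by blast
      ultimately show "z \<in> \<Union> ((\<lambda>U. U \<times> J) ` \<U>)" by (auto simp: mem_Times_iff)
    qed
    fix V assume "V \<in> (\<lambda>U. U \<times> J) ` \<U>"
    then obtain U where V: "V = U \<times> J" and U': "open U" "bounded U" "diameter U \<le> r/4"
      using U(1) by (auto simp: covers_def)
    show "open V" "bounded V" using U' by (auto simp: V J_def open_Times bounded_Times)
    show "diameter V \<le> r"
    proof (rule diameter_le)
      show "V \<noteq> {} \<or> 0 \<le> r" using assms by simp
      fix x y assume "x \<in> V" "y \<in> V"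
      then have *: "fst x \<in> U" "fst y \<in> U" "snd x \<in> J" "snd y \<in> J" using V by auto
      have "dist (fst x) (fst y) \<le> r/4" using diameter_bounded_bound[OF U'(2) *(1,2)] U'(3) by simp
      moreover have "\<bar>snd x - snd y\<bar> \<le> r/2" using *(3,4) unfolding J_def greaterThanLessThan_iff abs_le_iff by linarith
      moreover have "norm (x - y) \<le> \<bar>fst x - fst y\<bar> + \<bar>snd x - snd y\<bar>"
        by (metis fst_diff norm_Pair_le prod.collapse real_norm_def snd_diff)
      ultimately show "norm (x - y) \<le> r" using \<open>r > 0\<close> by (simp add: dist_real_def)
    qed
  qed
  have "covering_number r Z \<le> card ((\<lambda>U. U \<times> J) ` \<U>)" by (rule covering_number_le_card[OF cov])
  also have "\<dots> \<le> card \<U>" using U(1) by (intro card_image_le) (auto simp: covers_def)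
  finally show ?thesis using U by simp
qed

text \<open>
  No set of diameter at most \<open>r\<close> contains two points of an \<open>r\<close>-separated set. All lower bounds for
  covering numbers in the plane come from this.
\<close>

lemma card_separated_le_covering_number:
  fixes E :: "'a::euclidean_space set"
  assumes "bounded E" "r > 0" "X \<subseteq> E" "pairwise (\<lambda>x y. dist x y > r) X"
  shows "finite X \<and> card X \<le> covering_number r E"
proof -
  obtain \<U> where U: "covers r E \<U>" "card \<U> = covering_number r E"
    using optimal_cover assms by blast
  then have "\<forall>x\<in>X. \<exists>U\<in>\<U>. x \<in> U" using assms(3) unfolding covers_def by blast
  then obtain g where g: "\<And>x. x \<in> X \<Longrightarrow> g x \<in> \<U> \<and> x \<in> g x" by metis
  have "inj_on g X"
  proof (rule inj_onI)
    fix x y assume xy: "x \<in> X" "y \<in> X" "g x = g y"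
    then have "dist x y \<le> diameter (g x)" "diameter (g x) \<le> r"
      using g[of x] g[of y] U(1) unfolding covers_def
      by (auto intro!: diameter_bounded_bound)
    then have "\<not> dist x y > r" by simp
    then show "x = y" using assms(4) xy unfolding pairwise_def by blast
  qed
  moreover have "g ` X \<subseteq> \<U>" "finite \<U>" using g U by (auto simp: covers_def)
  ultimately show ?thesis using U(2) inj_on_finite card_inj_on_le by metis
qed

text \<open>
  A separated set of the largest possible cardinality is a net, so the balls of radius \<open>2r\<close> around
  its points cover. This turns lower bounds for covering numbers into separated points.
\<close>

lemma separated_subset_exists:
  fixes E :: "'a::euclidean_space set"
  assumes "bounded E" "r > 0"
  obtains X where "X \<subseteq> E" "finite X" "pairwise (\<lambda>x y. dist x y > r) X" "covering_number (4 * r) E \<le> card X"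
proof -
  define P where "P X \<longleftrightarrow> X \<subseteq> E \<and> pairwise (\<lambda>x y. dist x y > r) X" for X
  have bd: "finite X \<and> card X \<le> covering_number r E" if "P X" for X
    using card_separated_le_covering_number[OF assms] that unfolding P_def by blast
  have "P {}" by (simp add: P_def)
  then have "\<exists>X. P X \<and> (\<forall>Y. P Y \<longrightarrow> card Y \<le> card X)"
    by (rule ex_has_greatest_nat[of P "{}" card "Suc (covering_number r E)"]) (use bd less_Suc_eq_le in blast)
  then obtain X where X: "P X" "\<And>Y. P Y \<Longrightarrow> card Y \<le> card X" by blast
  have fin: "finite X" using bd X(1) by blast
  have near: "\<exists>x\<in>X. dist x e \<le> r" if "e \<in> E" for e
  proof (rule ccontr)
    assume *: "\<not> (\<exists>x\<in>X. dist x e \<le> r)"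
    then have "e \<notin> X" using \<open>r > 0\<close> by force
    moreover have "P (insert e X)" using * X(1) that
      unfolding P_def by (auto simp: pairwise_insert dist_commute not_le)
    ultimately show False using X(2)[of "insert e X"] fin by simp
  qed
  have "covers (4 * r) E ((\<lambda>x. ball x (2 * r)) ` X)"
    unfolding covers_def
  proof (intro conjI ballI)
    show "E \<subseteq> \<Union> ((\<lambda>x. ball x (2 * r)) ` X)" using near \<open>r > 0\<close> by fastforce
    fix U assume "U \<in> (\<lambda>x. ball x (2 * r)) ` X"
    then show "open U" "bounded U" "diameter U \<le> 4 * r"
      using diameter_ball_le[of "2 * r"] \<open>r > 0\<close> by auto
  qed (use fin in simp)
  then have "covering_number (4 * r) E \<le> card X"
    using covering_number_le_card card_image_le[OF fin] order_trans by blast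
  then show ?thesis using that X(1) fin unfolding P_def by blast
qed

section \<open>Box dimension from two-sided bounds\<close>

text \<open>
  The constants only contribute \<open>ln C / -ln r\<close>, which tends to 0.
\<close>

lemma has_box_dimI:
  fixes E :: "'a::euclidean_space set"
  assumes C: "C > 0" "C' > 0"
    and lower: "\<And>r. 0 < r \<Longrightarrow> r < 1 \<Longrightarrow> (1 / r) powr s / C' \<le> covering_number r E"
    and upper: "\<And>r. 0 < r \<Longrightarrow> r < 1 \<Longrightarrow> covering_number r E \<le> C * (1 / r) powr s"
  shows "has_box_dim E s"
  unfolding has_box_dim_def
proof (rule tendsto_sandwich)
  have "filterlim (\<lambda>r::real. - ln r) at_top (at_right 0)"
    using ln_at_0 by (simp add: filterlim_uminus_at_bot)
  then have *: "((\<lambda>r. K / - ln r) \<longlongrightarrow> 0) (at_right 0)" for K :: real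
    by (intro tendsto_divide_0[OF tendsto_const] filterlim_at_top_imp_at_infinity)
  show "((\<lambda>r. (- ln C') / - ln r + s) \<longlongrightarrow> s) (at_right 0)"
    using tendsto_add[OF *[of "- ln C'"] tendsto_const[of s]] by simp
  show "((\<lambda>r. ln C / - ln r + s) \<longlongrightarrow> s) (at_right 0)"
    using tendsto_add[OF *[of "ln C"] tendsto_const[of s]] by simp
  have ev: "eventually (\<lambda>r::real. 0 < r \<and> r < 1) (at_right 0)"
    unfolding eventually_at_right_field by (intro exI[of _ 1]) auto
  have pos: "0 < real (covering_number r E)" if "0 < r" "r < 1" for r
    using lower[OF that] C that by (smt (verit) divide_pos_pos powr_gt_zero)
  show "eventually (\<lambda>r. - ln C' / - ln r + s \<le> ln (real (covering_number r E)) / - ln r) (at_right 0)"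
    using ev
  proof eventually_elim
    case (elim r)
    have "ln ((1 / r) powr s / C') \<le> ln (real (covering_number r E))"
      using lower pos elim C by (subst ln_le_cancel_iff) auto
    then have "- s * ln r - ln C' \<le> ln (real (covering_number r E))"
      using elim C by (simp add: ln_div ln_powr)
    then have "(- s * ln r - ln C') / (- ln r) \<le> ln (real (covering_number r E)) / - ln r"
      using elim by (intro divide_right_mono) auto
    moreover have "ln r \<noteq> 0" using elim by simp
    then have "(- s * ln r - ln C') / (- ln r) = - ln C' / - ln r + s" by (simp add: divide_simps)
    ultimately show ?case by simp
  qed
  show "eventually (\<lambda>r. ln (real (covering_number r E)) / - ln r \<le> ln C / - ln r + s) (at_right 0)"
    using ev
  proof eventually_elim
    case (elim r)
    have "ln (real (covering_number r E)) \<le> ln (C * (1 / r) powr s)"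
      using upper pos elim C by (subst ln_le_cancel_iff) auto
    then have "ln (real (covering_number r E)) \<le> ln C - s * ln r"
      using elim C by (simp add: ln_mult ln_div ln_powr)
    then have "ln (real (covering_number r E)) / - ln r \<le> (ln C - s * ln r) / (- ln r)"
      using elim by (intro divide_right_mono) auto
    moreover have "ln r \<noteq> 0" using elim by simp
    then have "(ln C - s * ln r) / (- ln r) = ln C / - ln r + s" by (simp add: divide_simps)
    ultimately show ?case by simp
  qed
qed

lemma box_dim_eqI: "has_box_dim E s \<Longrightarrow> box_dim E = s"
  unfolding box_dim_def has_box_dim_def
  by (rule the_equality) (auto intro: tendsto_unique[OF trivial_limit_at_right_real])


section \<open>Tilings\<close>

text \<open>
  An element \<open>(P, Q)\<close> of a tiling is a piece \<open>P\<close> of the decomposed set together with a cell \<open>Q\<close>, in practice the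
  interior of the construction rectangle that contains \<open>P\<close>. Pieces may share boundary points; disjointness
  is demanded of the cells, whose volumes are then used for counting.
\<close>

definition tiling ::
    "('a set \<times> 'a set) set \<Rightarrow> 'a set \<Rightarrow> 'a set \<Rightarrow> ('a set \<Rightarrow> 'a set \<Rightarrow> bool) \<Rightarrow> bool" where
  "tiling T E B good \<longleftrightarrow> finite T \<and> E \<subseteq> (\<Union>t\<in>T. fst t) \<and> disjoint_family_on snd T
     \<and> (\<forall>t\<in>T. snd t \<subseteq> B \<and> snd t \<noteq> {} \<and> good (fst t) (snd t))"

lemma tiling_single:
  "Q \<noteq> {} \<Longrightarrow> Q \<subseteq> B \<Longrightarrow> E \<subseteq> P \<Longrightarrow> good P Q \<Longrightarrow> tiling {(P, Q)} E B good"
  by (auto simp: tiling_def disjoint_family_on_def)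

lemma tilingD:
  assumes "tiling T E B good" "t \<in> T"
  shows "snd t \<subseteq> B" "snd t \<noteq> {}" "good (fst t) (snd t)"
  using assms unfolding tiling_def by blast+

text \<open>
  One step of a recursive subdivision. The second statement keeps track of weights of tiles, such as the
  Moran sum.
\<close>

lemma tiling_UN:
  assumes fin: "finite J" and T: "\<And>j. j \<in> J \<Longrightarrow> tiling (T j) (E j) (B j) good"
    and sub: "\<And>j. j \<in> J \<Longrightarrow> B j \<subseteq> B'" and disj: "disjoint_family_on B J"
  shows "tiling (\<Union>j\<in>J. T j) (\<Union>j\<in>J. E j) B' good"
    and "(\<Sum>t\<in>(\<Union>j\<in>J. T j). f t) = (\<Sum>j\<in>J. \<Sum>t\<in>T j. f t)"
proof -
  have sep: "snd t \<inter> snd t' = {}" if "j \<in> J" "j' \<in> J" "j \<noteq> j'" "t \<in> T j" "t' \<in> T j'" for j j' t t'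
  proof -
    have "snd t \<subseteq> B j" "snd t' \<subseteq> B j'" using T that unfolding tiling_def by blast+
    moreover have "B j \<inter> B j' = {}" using disj that unfolding disjoint_family_on_def by blast
    ultimately show ?thesis by blast
  qed
  show "tiling (\<Union>j\<in>J. T j) (\<Union>j\<in>J. E j) B' good"
    unfolding tiling_def
  proof (intro conjI)
    show "finite (\<Union>j\<in>J. T j)" using fin T by (auto simp: tiling_def)
    show "(\<Union>j\<in>J. E j) \<subseteq> (\<Union>t\<in>(\<Union>j\<in>J. T j). fst t)" 
    proof (rule UN_least)
      fix j assume "j \<in> J"
      then have "E j \<subseteq> (\<Union>t\<in>T j. fst t)" using T by (simp add: tiling_def)
      then show "E j \<subseteq> (\<Union>t\<in>(\<Union>j\<in>J. T j). fst t)" using \<open>j \<in> J\<close> by blast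
    qed
    show "\<forall>t\<in>(\<Union>j\<in>J. T j). snd t \<subseteq> B' \<and> snd t \<noteq> {} \<and> good (fst t) (snd t)"
      
    proof
      fix t assume "t \<in> (\<Union>j\<in>J. T j)"
      then obtain j where "j \<in> J" "t \<in> T j" by blast
      then show "snd t \<subseteq> B' \<and> snd t \<noteq> {} \<and> good (fst t) (snd t)"
        using T[of j] sub[of j] unfolding tiling_def by blast
    qed
    show "disjoint_family_on snd (\<Union>j\<in>J. T j)"
      unfolding disjoint_family_on_def
    proof (intro ballI impI)
      fix t t' assume "t \<in> (\<Union>j\<in>J. T j)" "t' \<in> (\<Union>j\<in>J. T j)" "t \<noteq> t'"
      then obtain j j' where "j \<in> J" "j' \<in> J" "t \<in> T j" "t' \<in> T j'" by auto
      moreover from this have "disjoint_family_on snd (T j)" using T by (simp add: tiling_def)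
      ultimately show "snd t \<inter> snd t' = {}"
        using sep[of j j' t t'] \<open>t \<noteq> t'\<close> unfolding disjoint_family_on_def
        by (cases "j = j'") blast+
    qed
  qed
  have "T j \<inter> T j' = {}" if "j \<in> J" "j' \<in> J" "j \<noteq> j'" for j j'
  proof -
    have "snd t \<noteq> {}" if "t \<in> T j" for t using T[OF \<open>j \<in> J\<close>] that unfolding tiling_def by blast
    moreover have "snd t = {}" if "t \<in> T j" "t \<in> T j'" for t
      using sep[OF \<open>j \<in> J\<close> \<open>j' \<in> J\<close> \<open>j \<noteq> j'\<close> that] by simp
    ultimately show ?thesis by blast
  qed
  then show "(\<Sum>t\<in>(\<Union>j\<in>J. T j). f t) = (\<Sum>j\<in>J. \<Sum>t\<in>T j. f t)"
    using fin T by (intro sum.UNION_disjoint) (simp_all add: tiling_def)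
qed

lemma tiling_image:
  assumes "tiling T E B (\<lambda>P Q. good (f ` P) (f ` Q))" "inj f"
  shows "tiling ((\<lambda>t. (f ` fst t, f ` snd t)) ` T) (f ` E) (f ` B) good"
proof -
  have "f ` E \<subseteq> f ` (\<Union>t\<in>T. fst t)" using assms(1) unfolding tiling_def by (intro image_mono) simp
  moreover have sep: "f ` snd t \<inter> f ` snd t' = {}" if "t \<in> T" "t' \<in> T" "t \<noteq> t'" for t t'
    using that assms by (simp add: tiling_def disjoint_family_on_def flip: image_Int)
  moreover have "finite T" "\<And>t. t \<in> T \<Longrightarrow> snd t \<subseteq> B \<and> snd t \<noteq> {} \<and> good (f ` fst t) (f ` snd t)"
    using assms(1) unfolding tiling_def by blast+
  ultimately show ?thesis
    unfolding tiling_def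
  proof (intro conjI)
    show "f ` E \<subseteq> (\<Union>t\<in>(\<lambda>t. (f ` fst t, f ` snd t)) ` T. fst t)"
      using \<open>f ` E \<subseteq> f ` (\<Union>t\<in>T. fst t)\<close> by (simp add: image_UN)
    show "disjoint_family_on snd ((\<lambda>t. (f ` fst t, f ` snd t)) ` T)"
      unfolding disjoint_family_on_def
    proof (intro ballI impI)
      fix x y assume "x \<in> (\<lambda>t. (f ` fst t, f ` snd t)) ` T" "y \<in> (\<lambda>t. (f ` fst t, f ` snd t)) ` T" "x \<noteq> y"
      then obtain t t' where t: "t \<in> T" "x = (f ` fst t, f ` snd t)" "t' \<in> T" "y = (f ` fst t', f ` snd t')"
        by blast
      moreover from this \<open>x \<noteq> y\<close> have "t \<noteq> t'" by blast
      ultimately show "snd x \<inter> snd y = {}" using sep[of t t'] by simp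
    qed
  qed (auto simp: image_mono)
qed

text \<open>
  Volume counting: it bounds the number of cells of size about \<open>R\<close> near a given point.
\<close>

lemma card_le_of_disjoint_measure:
  fixes Q :: "'b \<Rightarrow> 'a::euclidean_space set"
  assumes "finite T" "disjoint_family_on Q T" "\<And>t. t \<in> T \<Longrightarrow> Q t \<in> lmeasurable"
    and "\<And>t. t \<in> T \<Longrightarrow> measure lebesgue (Q t) \<ge> m"
    and "\<And>t. t \<in> T \<Longrightarrow> Q t \<subseteq> Z" "Z \<in> lmeasurable"
  shows "real (card T) * m \<le> measure lebesgue Z"
proof -
  have "real (card T) * m \<le> (\<Sum>t\<in>T. measure lebesgue (Q t))"
    using assms(4) sum_mono[of T "\<lambda>_. m" "\<lambda>t. measure lebesgue (Q t)"] by simp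
  also have "\<dots> = measure lebesgue (\<Union>t\<in>T. Q t)"
  proof (rule measure_finite_Union[symmetric])
    show "Q ` T \<subseteq> sets lebesgue" using assms(3) fmeasurableD by blast
    show "emeasure lebesgue (Q t) \<noteq> \<infinity>" if "t \<in> T" for t
      unfolding infinity_ennreal_def by (rule fmeasurableD2[OF assms(3)[OF that]])
  qed (rule assms)+
  also have "\<dots> \<le> measure lebesgue Z"
    using assms by (intro measure_mono_fmeasurable) auto
  finally show ?thesis .
qed

section \<open>Self-similar sets on the line\<close>

text \<open>
  The sum is at least 1 at the exponent 0 and at most 1 at the exponent \<open>t\<close> with \<open>card K * m\<^sup>t = 1\<close>, where
  \<open>m\<close> is the largest ratio; the rest is continuity.
\<close>

lemma moran_exponent_exists:
  fixes e :: "'k \<Rightarrow> real"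
  assumes "finite K" "K \<noteq> {}" and e: "\<And>k. k \<in> K \<Longrightarrow> 0 < e k \<and> e k < 1"
  obtains s where "s \<ge> 0" "(\<Sum>k\<in>K. e k powr s) = 1"
proof -
  define m where "m = Max (e ` K)"
  have "m \<in> e ` K" unfolding m_def using assms by (intro Max_in) auto
  then have m: "0 < m" "m < 1" using e by auto
  have le: "e k \<le> m" if "k \<in> K" for k using that assms by (auto simp: m_def)
  define N where "N = real (card K)"
  have N: "N \<ge> 1" using assms unfolding N_def by (simp add: Suc_le_eq card_gt_0_iff)
  define t where "t = ln N / - ln m"
  have t: "t \<ge> 0" using m N unfolding t_def by (intro divide_nonneg_pos) auto
  have mt: "m powr t = 1 / N"
    using m N by (simp add: powr_def t_def exp_minus inverse_eq_divide)
  have "(\<Sum>k\<in>K. e k powr t) \<le> (\<Sum>k\<in>K. m powr t)"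
    using e le t by (intro sum_mono powr_mono2) (auto intro: less_imp_le)
  also have "\<dots> = 1" using mt N by (simp add: N_def)
  finally have 1: "(\<Sum>k\<in>K. e k powr t) \<le> 1" .
  have "(\<Sum>k\<in>K. e k powr 0) = (\<Sum>k\<in>K. 1)" using e by (intro sum.cong) force+
  then have 0: "(\<Sum>k\<in>K. e k powr 0) \<ge> 1" using N by (simp add: N_def)
  have "\<exists>s. 0 \<le> s \<and> s \<le> t \<and> (\<Sum>k\<in>K. e k powr s) = 1"
  proof (rule IVT2'[OF 1 0 t])
    show "continuous_on {0..t} (\<lambda>s. \<Sum>k\<in>K. e k powr s)"
      by (intro continuous_on_sum continuous_on_powr continuous_on_const continuous_on_id) (use e in \<open>metis less_irrefl\<close>)
  qed
  then show ?thesis using that by blast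
qed

lemma uniform_bounds:
  fixes e :: "'k \<Rightarrow> real"
  assumes "finite K" and e: "\<And>k. k \<in> K \<Longrightarrow> 0 < e k \<and> e k < 1"
  obtains \<kappa> \<delta> where "0 < \<kappa>" "\<kappa> < 1" "0 < \<delta>" "\<delta> < 1" "\<And>k. k \<in> K \<Longrightarrow> \<kappa> \<le> e k \<and> e k \<le> \<delta>"
proof -
  define A where "A = insert (1/2) (e ` K)"
  have A: "finite A" "A \<noteq> {}" using assms by (auto simp: A_def)
  have "Min A \<in> A" "Max A \<in> A" using A by auto
  then have "0 < Min A" "Min A < 1" "0 < Max A" "Max A < 1"
    using e by (auto simp: A_def)
  moreover have "Min A \<le> e k \<and> e k \<le> Max A" if "k \<in> K" for k
    using A that by (auto simp: A_def)
  ultimately show ?thesis using that by blast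
qed

lemma power_mult_le_of_lt_1:
  fixes W \<delta> r :: real
  assumes "0 < \<delta>" "\<delta> < 1" "0 < r" "0 < W"
  obtains n where "W * \<delta> ^ n \<le> r"
proof -
  obtain n where "\<delta> ^ n < r / W" using real_arch_pow_inv[of "r / W" \<delta>] assms by auto
  then show ?thesis using that[of n] assms by (simp add: field_simps)
qed

text \<open>
  If the maximum \<open>M\<close> of the set is an image of \<open>x \<le> M\<close>, then \<open>M \<le> e * M + (1 - e)\<close>, so \<open>M \<le> 1\<close>; the minimum
  is treated likewise.
\<close>

lemma self_similar_in_unit:
  fixes e h :: "'k \<Rightarrow> real"
  assumes E: "compact E" "E \<noteq> {}" and self_similar: "E \<subseteq> (\<Union>k\<in>K. (\<lambda>x. e k * x + h k) ` E)"
    and ratio: "\<And>k. k \<in> K \<Longrightarrow> 0 < e k \<and> e k < 1"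
    and inside: "\<And>k. k \<in> K \<Longrightarrow> 0 \<le> h k \<and> h k + e k \<le> 1"
  shows "E \<subseteq> {0..1}"
proof -
  obtain M where M: "M \<in> E" "\<And>x. x \<in> E \<Longrightarrow> x \<le> M" using compact_attains_sup[OF E] by blast
  obtain m where m: "m \<in> E" "\<And>x. x \<in> E \<Longrightarrow> m \<le> x" using compact_attains_inf[OF E] by blast
  have "M \<le> 1"
  proof -
    obtain k x where kx: "k \<in> K" "x \<in> E" "M = e k * x + h k" using M(1) self_similar by blast
    then have "M \<le> e k * M + (1 - e k)"
      using M(2)[OF kx(2)] ratio[OF kx(1)] inside[OF kx(1)] mult_left_mono[of x M "e k"] by linarith
    then have "(1 - e k) * M \<le> (1 - e k) * 1" by (simp add: algebra_simps)
    then show ?thesis using ratio[OF kx(1)] by (simp add: mult_le_cancel_left)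
  qed
  moreover have "m \<ge> 0"
  proof -
    obtain k x where kx: "k \<in> K" "x \<in> E" "m = e k * x + h k" using m(1) self_similar by blast
    then have "m \<ge> e k * m"
      using m(2)[OF kx(2)] ratio[OF kx(1)] inside[OF kx(1)] mult_left_mono[of m x "e k"] by linarith
    then have "(1 - e k) * m \<ge> 0" by (simp add: algebra_simps)
    then show ?thesis using ratio[OF kx(1)] by (simp add: zero_le_mult_iff)
  qed
  ultimately show ?thesis using M(2) m(2) by force
qed

text \<open>
  A self-similar set on the line whose first-level intervals do not overlap; neighbouring intervals may
  share an end point. Both the projections and the slices of a carpet are of this kind.
\<close>

locale interval_system =
  fixes K :: "'k set" and e h :: "'k \<Rightarrow> real" and E :: "real set"
  assumes K: "finite K" "K \<noteq> {}"
    and ratio: "\<And>k. k \<in> K \<Longrightarrow> 0 < e k \<and> e k < 1"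
    and inside: "\<And>k. k \<in> K \<Longrightarrow> 0 \<le> h k \<and> h k + e k \<le> 1"
    and apart: "\<And>k k'. k \<in> K \<Longrightarrow> k' \<in> K \<Longrightarrow> k \<noteq> k' \<Longrightarrow> h k + e k \<le> h k' \<or> h k' + e k' \<le> h k"
    and E: "compact E" "E \<noteq> {}" and self_similar: "E = (\<Union>k\<in>K. (\<lambda>x. e k * x + h k) ` E)"
begin

lemma ratio_bounds:
  obtains \<kappa> \<delta> where "0 < \<kappa>" "\<kappa> < 1" "0 < \<delta>" "\<delta> < 1" "\<forall>k\<in>K. \<kappa> \<le> e k \<and> e k \<le> \<delta>"
  by (rule uniform_bounds[of K e, OF K(1) ratio]) (auto intro: that)

lemma in_unit: "E \<subseteq> {0..1}"
proof (rule self_similar_in_unit[OF E])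
  show "E \<subseteq> (\<Union>k\<in>K. (\<lambda>x. e k * x + h k) ` E)" using self_similar by simp
qed (use ratio inside in auto)

text \<open>
  Subdivide every interval that is longer than \<open>r\<close>. By the Moran equation each subdivision preserves the sum of
  the \<open>s\<close>-th powers of the lengths, and no interval becomes shorter than \<open>\<kappa> * r\<close>. The number \<open>n\<close> bounds
  the levels that are still necessary.
\<close>

lemma tiling_exists:
  assumes s: "(\<Sum>k\<in>K. e k powr s) = 1"
    and \<kappa>\<delta>: "0 < \<kappa>" "0 < \<delta>" "\<forall>k\<in>K. \<kappa> \<le> e k \<and> e k \<le> \<delta>"
    and r: "r > 0"
    and W: "W * \<delta> ^ n \<le> r" "\<kappa> * r \<le> W" "(\<lambda>x. W * x + p) ` E \<subseteq> Z"
  shows "\<exists>T. tiling T ((\<lambda>x. W * x + p) ` E) {p<..<p + W}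
      (\<lambda>P Q. P \<noteq> {} \<and> P \<subseteq> Z \<and> (\<exists>u v. P \<subseteq> {u..v} \<and> Q = {u<..<v} \<and> \<kappa> * r \<le> v - u \<and> v - u \<le> r))
    \<and> (\<Sum>t\<in>T. measure lebesgue (snd t) powr s) = W powr s"
    (is "\<exists>T. tiling T _ _ ?good \<and> _")
  using W
proof (induction n arbitrary: W p)
  case base: 0
  then have r': "W \<le> r" by simp
  have pos: "W > 0" using base mult_pos_pos[OF \<kappa>\<delta>(1) r] by linarith
  have sub: "(\<lambda>x. W * x + p) ` E \<subseteq> {p..p + W}"
    using in_unit pos by (auto simp: mult_left_le) 
  have "?good ((\<lambda>x. W * x + p) ` E) {p<..<p + W}"
    using sub base r' E(2) by (intro conjI exI[of _ p] exI[of _ "p + W"]) auto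
  then show ?case
    using pos by (intro exI[of _ "{((\<lambda>x. W * x + p) ` E, {p<..<p + W})}"] conjI tiling_single) auto
next
  case (Suc n)
  have pos: "W > 0" using Suc mult_pos_pos[OF \<kappa>\<delta>(1) r] by linarith
  show ?case
  proof (cases "W \<le> r")
    case True
    have sub: "(\<lambda>x. W * x + p) ` E \<subseteq> {p..p + W}"
      using in_unit pos by (auto simp: mult_left_le) 
    have "?good ((\<lambda>x. W * x + p) ` E) {p<..<p + W}"
      using sub Suc.prems True E(2) by (intro conjI exI[of _ p] exI[of _ "p + W"]) auto
    then show ?thesis
      using pos by (intro exI[of _ "{((\<lambda>x. W * x + p) ` E, {p<..<p + W})}"] conjI tiling_single) auto
  next
    case False
    have eq: "(\<lambda>x. W * x + p) ` E = (\<Union>k\<in>K. (\<lambda>x. (W * e k) * x + (W * h k + p)) ` E)"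
      by (subst self_similar) (simp add: image_UN image_image algebra_simps)
    have "\<exists>T. tiling T ((\<lambda>x. (W * e k) * x + (W * h k + p)) ` E)
           {W * h k + p<..<W * h k + p + W * e k} ?good
          \<and> (\<Sum>t\<in>T. measure lebesgue (snd t) powr s) = (W * e k) powr s" if k: "k \<in> K" for k
    proof (rule Suc.IH)
      have "W * e k * \<delta> ^ n \<le> W * \<delta> * \<delta> ^ n"
        using \<kappa>\<delta> k pos by (intro mult_right_mono mult_left_mono) auto
      then show "W * e k * \<delta> ^ n \<le> r" using Suc.prems(1) by (simp add: mult.assoc)
      have "r * \<kappa> \<le> W * e k" using False k \<kappa>\<delta> r pos by (intro mult_mono) auto
      then show "\<kappa> * r \<le> W * e k" by (simp add: mult.commute)
      show "(\<lambda>x. (W * e k) * x + (W * h k + p)) ` E \<subseteq> Z"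
        using Suc.prems(3) k unfolding eq by blast
    qed
    then have "\<forall>k\<in>K. \<exists>T. tiling T ((\<lambda>x. (W * e k) * x + (W * h k + p)) ` E)
           {W * h k + p<..<W * h k + p + W * e k} ?good
          \<and> (\<Sum>t\<in>T. measure lebesgue (snd t) powr s) = (W * e k) powr s" ..
    from bchoice[OF this] obtain T where T: "\<And>k. k \<in> K \<Longrightarrow> tiling (T k) ((\<lambda>x. (W * e k) * x + (W * h k + p)) ` E)
           {W * h k + p<..<W * h k + p + W * e k} ?good"
        "\<And>k. k \<in> K \<Longrightarrow> (\<Sum>t\<in>T k. measure lebesgue (snd t) powr s) = (W * e k) powr s"
      by blast
    have sub: "{W * h k + p<..<W * h k + p + W * e k} \<subseteq> {p<..<p + W}" if "k \<in> K" for k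
    proof -
      have "W * h k \<ge> 0" "W * (h k + e k) \<le> W * 1"
        using inside[OF that] pos by (auto intro!: mult_left_mono)
      then show ?thesis by (auto simp: algebra_simps)
    qed
    have dis: "disjoint_family_on (\<lambda>k. {W * h k + p<..<W * h k + p + W * e k}) K"
      unfolding disjoint_family_on_def
    proof (intro ballI impI)
      fix k k' assume "k \<in> K" "k' \<in> K" "k \<noteq> k'"
      from apart[OF this] pos have "W * (h k + e k) \<le> W * h k' \<or> W * (h k' + e k') \<le> W * h k"
        by simp
      then show "{W * h k + p<..<W * h k + p + W * e k} \<inter> {W * h k' + p<..<W * h k' + p + W * e k'} = {}"
        by (auto simp: algebra_simps)
    qed
    note UN = tiling_UN[OF K(1) T(1) sub dis]
    have "(\<Sum>t\<in>(\<Union>k\<in>K. T k). measure lebesgue (snd t) powr s) = (\<Sum>k\<in>K. (W * e k) powr s)"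
      using UN(2)[of "\<lambda>t. measure lebesgue (snd t) powr s"] T(2) by simp
    also have "\<dots> = W powr s * (\<Sum>k\<in>K. e k powr s)"
      using pos ratio by (simp add: powr_mult sum_distrib_left)
    also have "\<dots> = W powr s" using s by simp
    finally show ?thesis unfolding eq by (intro exI[of _ "\<Union>k\<in>K. T k"] conjI UN(1))
  qed
qed

text \<open>
  The pieces of a tiling at scale \<open>r/2\<close> have lengths comparable with \<open>r\<close>, and their \<open>s\<close>-th powers add up to
  \<open>W\<^sup>s\<close>, so there are at most about \<open>(W/r)\<^sup>s\<close> of them. Below the scale \<open>r/2\<close> one ball suffices, and the
  lower bound \<open>\<kappa>' * r\<close> for \<open>W\<close> keeps the right-hand side away from 0.
\<close>

lemma covering_upper:
  assumes s: "s \<ge> 0" "(\<Sum>k\<in>K. e k powr s) = 1" and "\<kappa>' > 0"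
  obtains C where "C > 0"
    "\<And>W p r. r > 0 \<Longrightarrow> W \<ge> \<kappa>' * r \<Longrightarrow> covering_number r ((\<lambda>x. W * x + p) ` E) \<le> C * (W / r) powr s"
proof -
  obtain \<kappa> \<delta> where \<kappa>\<delta>: "0 < \<kappa>" "\<kappa> < 1" "0 < \<delta>" "\<delta> < 1" "\<forall>k\<in>K. \<kappa> \<le> e k \<and> e k \<le> \<delta>"
    using ratio_bounds by blast
  \<comment> \<open>The two summands serve the cases of a single ball and of a tiling.\<close>
  define C where "C = (1 / \<kappa>') powr s + (2 / \<kappa>) powr s"
  have "C > 0" using \<kappa>\<delta> \<open>\<kappa>' > 0\<close> unfolding C_def by (intro add_pos_pos) auto
  moreover have "covering_number r ((\<lambda>x. W * x + p) ` E) \<le> C * (W / r) powr s"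
    if r: "r > 0" and W: "W \<ge> \<kappa>' * r" for W p r
  proof -
    have pos: "W > 0" using W r \<open>\<kappa>' > 0\<close> by (smt (verit) mult_pos_pos)
    have ball: "{u..v} \<subseteq> ball ((u + v) / 2) (r / 2)" if "v - u \<le> r / 2" for u v :: real
    proof
      fix x assume "x \<in> {u..v}"
      then have "\<bar>(u + v) / 2 - x\<bar> < r / 2" using that r by (auto simp: abs_less_iff field_simps)
      then show "x \<in> ball ((u + v) / 2) (r / 2)" by (simp add: dist_real_def)
    qed
    have ge0: "(1 / \<kappa>') powr s * (W / r) powr s \<ge> 0" "(2 / \<kappa>) powr s * (W / r) powr s \<ge> 0"
      by auto
    show ?thesis
    proof (cases "W \<le> r / 2")
      case True
      have "(\<lambda>x. W * x + p) ` E \<subseteq> {p..p + W}" using in_unit pos by (auto simp: mult_left_le)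
      also have "\<dots> \<subseteq> ball ((p + (p + W)) / 2) (r / 2)" using True by (intro ball) simp
      finally have "covering_number r ((\<lambda>x. W * x + p) ` E) \<le> 1"
        using covering_number_le_1 r by blast
      moreover have "1 \<le> (1 / \<kappa>' * (W / r)) powr s"
        using W r \<open>\<kappa>' > 0\<close> s by (intro ge_one_powr_ge_zero) (auto simp: field_simps)
      moreover have "(1 / \<kappa>' * (W / r)) powr s = (1 / \<kappa>') powr s * (W / r) powr s"
        by (rule powr_mult)
      ultimately show ?thesis
        unfolding C_def distrib_right using ge0(2) by linarith
    next
      case False
      obtain n where n: "W * \<delta> ^ n \<le> r / 2"
        using power_mult_le_of_lt_1[of \<delta> "r / 2" W] \<kappa>\<delta> pos r by auto
      have "\<kappa> * (r / 2) \<le> 1 * (r / 2)" using \<kappa>\<delta> r by (intro mult_right_mono) auto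
      then have le: "\<kappa> * (r / 2) \<le> W" using False by simp
      have half: "r / 2 > 0" using r by simp
      from tiling_exists[OF s(2) \<kappa>\<delta>(1,3,5) half n le subset_UNIV, of p]
      obtain T where T: "tiling T ((\<lambda>x. W * x + p) ` E) {p<..<p + W} (\<lambda>P Q. P \<noteq> {} \<and> P \<subseteq> UNIV \<and>
            (\<exists>u v. P \<subseteq> {u..v} \<and> Q = {u<..<v} \<and> \<kappa> * (r / 2) \<le> v - u \<and> v - u \<le> r / 2))"
          "(\<Sum>t\<in>T. measure lebesgue (snd t) powr s) = W powr s"
        by (elim exE conjE) (rule that)
      have one: "covering_number r (fst t) \<le> 1 \<and> bounded (fst t)
          \<and> (\<kappa> * (r / 2)) powr s \<le> measure lebesgue (snd t) powr s" if t: "t \<in> T" for t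
      proof -
        obtain u v where uv: "fst t \<subseteq> {u..v}" "snd t = {u<..<v}" "\<kappa> * (r / 2) \<le> v - u" "v - u \<le> r / 2"
          using tilingD(3)[OF T(1) t] by blast
        have "0 < \<kappa> * (r / 2)" using r \<kappa>\<delta> by simp
        moreover from this have "u \<le> v" using uv(3) by linarith
        ultimately have "(\<kappa> * (r / 2)) powr s \<le> measure lebesgue (snd t) powr s"
          using uv(2,3) s(1) r \<kappa>\<delta> by (intro powr_mono2) auto
        moreover have "bounded (fst t)" using uv(1) bounded_subset bounded_closed_interval by blast
        ultimately show ?thesis using covering_number_le_1 ball[OF uv(4)] uv(1) r by blast
      qed
      have fT: "finite T" using T(1) by (simp add: tiling_def)
      have "covering_number r ((\<lambda>x. W * x + p) ` E) \<le> covering_number r (\<Union>t\<in>T. fst t)"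
        using T(1) one fT r by (intro covering_number_mono) (auto simp: tiling_def)
      also have "\<dots> \<le> (\<Sum>t\<in>T. covering_number r (fst t))"
        using one r fT by (intro covering_number_UN) auto
      also have "\<dots> \<le> (\<Sum>t\<in>T. 1)" using one by (intro sum_mono) auto
      finally have "real (covering_number r ((\<lambda>x. W * x + p) ` E)) \<le> (\<Sum>t\<in>T. 1)" by simp
      then have "(\<kappa> * (r / 2)) powr s * covering_number r ((\<lambda>x. W * x + p) ` E)
          \<le> (\<kappa> * (r / 2)) powr s * (\<Sum>t\<in>T. 1)"
        by (intro mult_left_mono) auto
      also have "\<dots> = (\<Sum>t\<in>T. (\<kappa> * (r / 2)) powr s)" by simp
      also have "\<dots> \<le> W powr s" using one unfolding T(2)[symmetric] by (intro sum_mono) auto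
      also have "W powr s = (\<kappa> * (r / 2)) powr s * ((2 / \<kappa>) powr s * (W / r) powr s)"
        using pos r \<kappa>\<delta> by (simp flip: powr_mult)
      finally have "covering_number r ((\<lambda>x. W * x + p) ` E) \<le> (2 / \<kappa>) powr s * (W / r) powr s"
        using r \<kappa>\<delta> by (subst (asm) mult_le_cancel_left_pos) auto
      then show ?thesis unfolding C_def distrib_right using ge0(1) by linarith
    qed
  qed
  ultimately show ?thesis using that by blast
qed

text \<open>
  The tiles have length at most \<open>r\<close>, so the Moran sum forces at least \<open>r\<^bsup>-s\<^esup>\<close> of them; by volume, a set of
  diameter \<open>r\<close> meets at most \<open>4 / \<kappa>\<close> tiles. Counting tiles instead of separated points avoids any trouble
  with tiles that touch.
\<close>

lemma covering_lower:
  assumes s: "s \<ge> 0" "(\<Sum>k\<in>K. e k powr s) = 1"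
  obtains C where "C > 0" "\<And>r. 0 < r \<Longrightarrow> r < 1 \<Longrightarrow> (1 / r) powr s / C \<le> covering_number r E"
proof -
  obtain \<kappa> \<delta> where \<kappa>\<delta>: "0 < \<kappa>" "\<kappa> < 1" "0 < \<delta>" "\<delta> < 1" "\<forall>k\<in>K. \<kappa> \<le> e k \<and> e k \<le> \<delta>"
    using ratio_bounds by blast
  have "(1 / r) powr s / (4 / \<kappa>) \<le> covering_number r E" if r: "0 < r" "r < 1" for r
  proof -
    obtain n where n: "1 * \<delta> ^ n \<le> r"
      using power_mult_le_of_lt_1[of \<delta> r 1] \<kappa>\<delta> r by auto
    have le: "\<kappa> * r \<le> 1" using \<kappa>\<delta> r by (simp add: mult_le_one)
    have sub: "(\<lambda>x. 1 * x + 0) ` E \<subseteq> E" by simp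
    from tiling_exists[OF s(2) \<kappa>\<delta>(1,3,5) r(1) n le sub]
    obtain T where T': "tiling T ((\<lambda>x. 1 * x + 0) ` E) {0<..<0 + 1} (\<lambda>P Q. P \<noteq> {} \<and> P \<subseteq> E \<and>
          (\<exists>u v. P \<subseteq> {u..v} \<and> Q = {u<..<v} \<and> \<kappa> * r \<le> v - u \<and> v - u \<le> r))"
        "(\<Sum>t\<in>T. measure lebesgue (snd t) powr s) = 1 powr s"
      by (elim exE conjE) (rule that)
    have T: "tiling T E {0<..<1} (\<lambda>P Q. P \<noteq> {} \<and> P \<subseteq> E \<and>
          (\<exists>u v. P \<subseteq> {u..v} \<and> Q = {u<..<v} \<and> \<kappa> * r \<le> v - u \<and> v - u \<le> r))"
        "(\<Sum>t\<in>T. measure lebesgue (snd t) powr s) = 1"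
      using T' by (simp_all only: mult_1 add_0_right add_0_left image_ident powr_one_eq_one)
    have fT: "finite T" using T(1) by (simp add: tiling_def)
    have \<kappa>r: "0 < \<kappa> * r" using r \<kappa>\<delta> by simp
    have tile: "fst t \<noteq> {} \<and> fst t \<subseteq> E \<and> (\<exists>u v. fst t \<subseteq> {u..v} \<and> snd t = {u<..<v} \<and> \<kappa> * r \<le> v - u \<and> v - u \<le> r)"
      if "t \<in> T" for t
      using tilingD(3)[OF T(1) that] by simp
    have "1 = (\<Sum>t\<in>T. measure lebesgue (snd t) powr s)" by (simp add: T(2))
    also have "\<dots> \<le> (\<Sum>t\<in>T. r powr s)"
    proof (rule sum_mono)
      fix t assume "t \<in> T"
      then obtain u v where uv: "snd t = {u<..<v}" "\<kappa> * r \<le> v - u" "v - u \<le> r" using tile by blast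
      moreover from this have "u \<le> v" using \<kappa>r by linarith
      ultimately show "measure lebesgue (snd t) powr s \<le> r powr s"
        using \<kappa>r s(1) by (intro powr_mono2) auto
    qed
    finally have card: "(1 / r) powr s \<le> card T" using r by (simp add: powr_divide field_simps)
    have "bounded E" using E(1) compact_imp_bounded by blast
    then obtain \<U> where U: "covers r E \<U>" "card \<U> = covering_number r E"
      using optimal_cover r by metis
    have fU: "finite \<U>" using U by (simp add: covers_def)
    have "T \<subseteq> (\<Union>U\<in>\<U>. {t\<in>T. fst t \<inter> U \<noteq> {}})"
    proof
      fix t assume t: "t \<in> T"
      then obtain y where "y \<in> fst t" "y \<in> E" using tile by blast
      moreover have "E \<subseteq> \<Union>\<U>" using U(1) by (simp add: covers_def)
      ultimately show "t \<in> (\<Union>U\<in>\<U>. {t\<in>T. fst t \<inter> U \<noteq> {}})" using t by blast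
    qed
    then have "card T \<le> card (\<Union>U\<in>\<U>. {t\<in>T. fst t \<inter> U \<noteq> {}})"
      using fT fU by (intro card_mono) auto
    also have "\<dots> \<le> (\<Sum>U\<in>\<U>. card {t\<in>T. fst t \<inter> U \<noteq> {}})" by (rule card_UN_le[OF fU])
    finally have "real (card T) \<le> (\<Sum>U\<in>\<U>. real (card {t\<in>T. fst t \<inter> U \<noteq> {}}))"
      by (simp flip: of_nat_sum)
    also have "\<dots> \<le> (\<Sum>U\<in>\<U>. 4 / \<kappa>)"
    proof (rule sum_mono)
      fix U assume U': "U \<in> \<U>"
      show "real (card {t\<in>T. fst t \<inter> U \<noteq> {}}) \<le> 4 / \<kappa>"
      proof (cases "U = {}")
        case False
        then obtain x where x: "x \<in> U" by blast
        have bU: "bounded U" "diameter U \<le> r" using U U' by (auto simp: covers_def)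
        have "real (card {t\<in>T. fst t \<inter> U \<noteq> {}}) * (\<kappa> * r) \<le> measure lebesgue {x - 2 * r..x + 2 * r}"
        proof (rule card_le_of_disjoint_measure[where Q=snd])
          show "disjoint_family_on snd {t\<in>T. fst t \<inter> U \<noteq> {}}"
            using T(1) unfolding tiling_def disjoint_family_on_def by blast
          fix t assume t: "t \<in> {t\<in>T. fst t \<inter> U \<noteq> {}}"
          then obtain u v where uv: "fst t \<subseteq> {u..v}" "snd t = {u<..<v}" "\<kappa> * r \<le> v - u" "v - u \<le> r"
            using tile by blast
          obtain y where y: "y \<in> fst t" "y \<in> U" using t by blast
          have "dist x y \<le> r" using diameter_bounded_bound[OF bU(1) x y(2)] bU(2) by simp
          moreover have "y \<in> {u..v}" using y uv by blast
          ultimately show "snd t \<subseteq> {x - 2 * r..x + 2 * r}"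
            using uv by (auto simp: dist_real_def abs_le_iff)
          show "snd t \<in> lmeasurable" by (simp add: uv(2))
          have "u \<le> v" using uv \<kappa>r by linarith
          then show "\<kappa> * r \<le> measure lebesgue (snd t)" using uv by simp
        qed (use fT in auto)
        also have "\<dots> = 4 * r" using r by simp
        finally show ?thesis using r \<kappa>\<delta> by (simp add: field_simps)
      qed (use \<kappa>\<delta> in simp)
    qed
    finally have "real (card T) \<le> covering_number r E * (4 / \<kappa>)" using U(2) by simp
    with card have "(1 / r) powr s \<le> covering_number r E * (4 / \<kappa>)" by simp
    then show ?thesis using \<kappa>\<delta> by (simp add: field_simps)
  qed
  then show ?thesis using that[of "4 / \<kappa>"] \<kappa>\<delta> by simp
qed

lemma box_dim:
  assumes s: "s \<ge> 0" "(\<Sum>k\<in>K. e k powr s) = 1"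
  shows "has_box_dim E s"
proof -
  obtain C where C: "C > 0" "\<And>W p r. r > 0 \<Longrightarrow> W \<ge> 1 * r \<Longrightarrow>
      covering_number r ((\<lambda>x. W * x + p) ` E) \<le> C * (W / r) powr s"
    using covering_upper[OF s, of 1] by auto
  obtain C' where C': "C' > 0" "\<And>r. 0 < r \<Longrightarrow> r < 1 \<Longrightarrow> (1 / r) powr s / C' \<le> covering_number r E"
    using covering_lower[OF s] by blast
  show ?thesis
    using C'(2) C(2)[of _ 1 0] by (intro has_box_dimI[OF C(1) C'(1)]) auto
qed

end


section \<open>Carpets organised in columns\<close>

lemma diag_affine_Pair [simp]: "diag_affine c d a b (x, y) = (c * x + a, d * y + b)"
  by (simp add: diag_affine_def)

lemma fst_diag_affine [simp]: "fst (diag_affine c d a b z) = c * fst z + a"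
  and snd_diag_affine [simp]: "snd (diag_affine c d a b z) = d * snd z + b"
  by (simp_all add: diag_affine_def split_beta)

lemma dist_le_abs_sum: "dist p q \<le> \<bar>fst p - fst q\<bar> + \<bar>snd p - snd q\<bar>" for p q :: "real \<times> real"
  using sqrt_sum_squares_le_sum_abs by (simp add: dist_prod_def dist_real_def)

lemma diag_affine_compose:
  "diag_affine W h p q (diag_affine c d a b z) = diag_affine (W * c) (h * d) (W * a + p) (h * b + q) z"
  by (simp add: diag_affine_def split_beta algebra_simps)

lemma fixed_point_diag_affine:
  assumes "c < 1" "d < 1"
  shows "fixed_point (diag_affine c d a b) = (a / (1 - c), b / (1 - d))"
  unfolding fixed_point_def
proof (rule the_equality)
  show "diag_affine c d a b (a / (1 - c), b / (1 - d)) = (a / (1 - c), b / (1 - d))"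
    using assms by (simp add: field_simps)
  fix z assume "diag_affine c d a b z = z"
  then have "c * fst z + a = fst z" "d * snd z + b = snd z"
    by (metis fst_diag_affine, metis snd_diag_affine)
  then show "z = (a / (1 - c), b / (1 - d))" using assms by (simp add: prod_eq_iff field_simps)
qed

text \<open>
  What the two classes of carpets have in common: \<open>k\<close> assigns columns to the maps, \<open>cc\<close> and \<open>aa\<close> give the width
  and the left end of a column. Rows need not match between different columns.
\<close>

locale column_system =
  fixes I :: "'i set" and c d a b :: "'i \<Rightarrow> real" and F :: "(real \<times> real) set"
    and k :: "'i \<Rightarrow> nat" and cc aa :: "nat \<Rightarrow> real"
  assumes I: "finite I" "I \<noteq> {}"
    and ratio: "\<And>i. i \<in> I \<Longrightarrow> 0 < c i \<and> c i < 1 \<and> 0 < d i \<and> d i < 1"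
    and inside: "\<And>i. i \<in> I \<Longrightarrow> 0 \<le> a i \<and> a i + c i \<le> 1 \<and> 0 \<le> b i \<and> b i + d i \<le> 1"
    and column: "\<And>i. i \<in> I \<Longrightarrow> c i = cc (k i) \<and> a i = aa (k i)"
    and columns_apart: "\<And>i j. i \<in> I \<Longrightarrow> j \<in> I \<Longrightarrow> k i \<noteq> k j \<Longrightarrow>
      a i + c i \<le> a j \<or> a j + c j \<le> a i"
    and column_apart: "\<And>i j. i \<in> I \<Longrightarrow> j \<in> I \<Longrightarrow> k i = k j \<Longrightarrow> i \<noteq> j \<Longrightarrow>
      b i + d i \<le> b j \<or> b j + d j \<le> b i"
    and attractor: "is_attractor I (\<lambda>i. diag_affine (c i) (d i) (a i) (b i)) F"
begin

abbreviation S :: "'i \<Rightarrow> real \<times> real \<Rightarrow> real \<times> real" where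
  "S i \<equiv> diag_affine (c i) (d i) (a i) (b i)"

abbreviation K :: "nat set" where "K \<equiv> k ` I"

definition col :: "nat \<Rightarrow> 'i set" where "col m = {i\<in>I. k i = m}"

lemma finite_col: "finite (col m)" using I by (simp add: col_def)

lemma F: "compact F" "F \<noteq> {}" "F = (\<Union>i\<in>I. S i ` F)" "closed F" "bounded F"
  using attractor compact_imp_closed compact_imp_bounded unfolding is_attractor_def by blast+

lemma S_mem: "i \<in> I \<Longrightarrow> z \<in> F \<Longrightarrow> S i z \<in> F"
  using F(3) by blast

text \<open>
  In the projection, all maps of a column become the same contraction.
\<close>

sublocale base: interval_system K cc aa "fst ` F"
proof
  show "finite K" "K \<noteq> {}" using I by auto
  show "compact (fst ` F)" using F(1) by (intro compact_continuous_image continuous_intros)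
  show "fst ` F \<noteq> {}" using F(2) by simp
  have "fst ` F = fst ` (\<Union>i\<in>I. S i ` F)" using F(3) by simp
  also have "\<dots> = (\<Union>i\<in>I. (\<lambda>x. c i * x + a i) ` fst ` F)" by (simp add: image_UN image_image)
  also have "\<dots> = (\<Union>i\<in>I. (\<lambda>x. cc (k i) * x + aa (k i)) ` fst ` F)" using column by simp
  finally show "fst ` F = (\<Union>m\<in>K. (\<lambda>x. cc m * x + aa m) ` fst ` F)" by simp
  fix m assume "m \<in> K"
  then obtain i where i: "i \<in> I" "m = k i" by blast
  then show "0 < cc m \<and> cc m < 1" "0 \<le> aa m \<and> aa m + cc m \<le> 1"
    using ratio[OF i(1)] inside[OF i(1)] column[OF i(1)] by auto
  fix m' assume "m' \<in> K" "m \<noteq> m'"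
  then obtain j where j: "j \<in> I" "m' = k j" by blast
  then show "aa m + cc m \<le> aa m' \<or> aa m' + cc m' \<le> aa m"
    using columns_apart[OF i(1) j(1)] column[OF i(1)] column[OF j(1)] i j \<open>m \<noteq> m'\<close> by auto
qed

lemma in_unit_square:
  assumes "z \<in> F" shows "0 \<le> fst z" "fst z \<le> 1" "0 \<le> snd z" "snd z \<le> 1"
proof -
  have "snd ` F \<subseteq> {0..1}"
  proof (rule self_similar_in_unit)
    show "compact (snd ` F)" using F(1) by (intro compact_continuous_image continuous_intros)
    show "snd ` F \<noteq> {}" using F(2) by simp
    have "snd ` F = snd ` (\<Union>i\<in>I. S i ` F)" by (rule arg_cong[OF F(3)])
    also have "\<dots> = (\<Union>i\<in>I. (\<lambda>x. d i * x + b i) ` snd ` F)" by (simp add: image_UN image_image)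
    finally show "snd ` F \<subseteq> (\<Union>i\<in>I. (\<lambda>x. d i * x + b i) ` snd ` F)" by (rule equalityD1)
  qed (use ratio inside in auto)
  then show "0 \<le> snd z" "snd z \<le> 1" "0 \<le> fst z" "fst z \<le> 1" using assms base.in_unit by force+
qed

text \<open>
  Together with \<open>yfix\<close>, the coordinates of the fixed point of \<open>S i\<close>.
\<close>

definition xfix :: "'i \<Rightarrow> real" where "xfix i = a i / (1 - c i)"

definition yfix :: "'i \<Rightarrow> real" where "yfix i = b i / (1 - d i)"

lemma xfix: "i \<in> I \<Longrightarrow> c i * xfix i + a i = xfix i"
  and yfix: "i \<in> I \<Longrightarrow> d i * yfix i + b i = yfix i"
  using ratio[of i] by (simp_all add: xfix_def yfix_def field_simps)

lemma xfix_column: "i \<in> I \<Longrightarrow> j \<in> I \<Longrightarrow> k j = k i \<Longrightarrow> xfix j = xfix i"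
  using column by (simp add: xfix_def)

text \<open>
  The abscissa of the fixed point lies strictly inside its column, except when the column touches a side of the unit
  square. On a side that is touched, no other column is in reach. So a slice through a fixed point meets a single column.
\<close>

lemma column_of_fixed_point:
  assumes "i \<in> I" "j \<in> I" "0 \<le> x" "x \<le> 1" "c j * x + a j = xfix i"
  shows "k j = k i"
proof (rule ccontr)
  assume "k j \<noteq> k i"
  have ci: "0 < c i" "c i < 1" "0 < c j" using ratio assms by auto
  have "c j * x \<le> c j * 1" "0 \<le> c j * x" using ci assms by (auto intro: mult_left_mono)
  then have x: "a j \<le> xfix i" "xfix i \<le> a j + c j" using assms by auto
  have fx: "xfix i * (1 - c i) = a i" using ci by (simp add: xfix_def)
  show False
  proof (cases "a j + c j \<le> a i")
    case True
    then have "a i > 0" using inside[OF assms(2)] ci by linarith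
    then have "xfix i > 0" using ci by (simp add: xfix_def)
    then have "xfix i * c i > 0" using ci by simp
    then have "xfix i > a i" using fx by (simp add: algebra_simps)
    then show False using x True by linarith
  next
    case False
    then have le: "a i + c i \<le> a j" using columns_apart[OF assms(2,1) \<open>k j \<noteq> k i\<close>] by auto
    then have "a i < 1 - c i" using inside[OF assms(2)] ci by linarith
    then have "xfix i < 1" using ci by (simp add: xfix_def)
    then have "xfix i * c i < 1 * c i" using ci by (intro mult_strict_right_mono) auto
    then have "xfix i < a i + c i" using fx by (simp add: algebra_simps)
    then show False using x le by linarith
  qed
qed

lemma iterate_mem:
  assumes "i \<in> I" "z \<in> F"
  shows "(c i ^ n * (fst z - xfix i) + xfix i, d i ^ n * (snd z - yfix i) + yfix i) \<in> F"
proof (induction n)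
  case (Suc n)
  have eq: "S i (c i ^ n * (fst z - xfix i) + xfix i, d i ^ n * (snd z - yfix i) + yfix i) =
    (c i ^ Suc n * (fst z - xfix i) + (c i * xfix i + a i), d i ^ Suc n * (snd z - yfix i) + (d i * yfix i + b i))"
    by (simp add: algebra_simps)
  show ?case using S_mem[OF assms(1) Suc] unfolding eq xfix[OF assms(1)] yfix[OF assms(1)] .
qed (use assms in simp)

lemma fixed_point_mem:
  assumes "i \<in> I" shows "(xfix i, yfix i) \<in> F"
proof -
  obtain z where z: "z \<in> F" using F(2) by blast
  have "(\<lambda>n. (c i ^ n * (fst z - xfix i) + xfix i, d i ^ n * (snd z - yfix i) + yfix i))
      \<longlonglongrightarrow> (0 * (fst z - xfix i) + xfix i, 0 * (snd z - yfix i) + yfix i)"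
    using ratio[OF assms] by (intro tendsto_intros LIMSEQ_power_zero) auto
  then show ?thesis using Lim_in_closed_set[OF F(4)] iterate_mem[OF assms z]
    by (metis (no_types, lifting) add_0 eventuallyI mult_zero_left sequentially_bot)
qed

lemma slice1_eq: "i \<in> I \<Longrightarrow> slice1 (S i) F = {z\<in>F. fst z = xfix i}"
  using fixed_point_diag_affine[of "c i" "d i"] ratio[of i]
  by (auto simp: slice1_def xfix_def)

definition fiber :: "'i \<Rightarrow> real set" where "fiber i = snd ` slice1 (S i) F"

lemma mem_fiber: "i \<in> I \<Longrightarrow> y \<in> fiber i \<longleftrightarrow> (xfix i, y) \<in> F"
  by (force simp: fiber_def slice1_eq image_iff)

text \<open>
  By \<open>column_of_fixed_point\<close> only the maps of the column of \<open>i\<close> contribute to the slice, and they all map its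
  vertical line to itself because they share the abscissa of the fixed point.
\<close>

lemma fiber_system:
  assumes i: "i \<in> I"
  shows "interval_system (col (k i)) d b (fiber i)"
proof
  show "finite (col (k i))" by (rule finite_col)
  show "col (k i) \<noteq> {}" using i by (auto simp: col_def)
  have "closed {z::real\<times>real. fst z = xfix i}"
    by (intro closed_Collect_eq continuous_intros)
  then have "compact (F \<inter> {z. fst z = xfix i})" using F(1) by (intro compact_Int_closed)
  moreover have "F \<inter> {z. fst z = xfix i} = slice1 (S i) F" using slice1_eq[OF i] by blast
  ultimately show "compact (fiber i)" unfolding fiber_def
    by (intro compact_continuous_image continuous_intros) simp
  show "fiber i \<noteq> {}" using fixed_point_mem[OF i] mem_fiber[OF i] by blast
  show "fiber i = (\<Union>j\<in>col (k i). (\<lambda>y. d j * y + b j) ` fiber i)"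
  proof (intro set_eqI iffI)
    fix y assume "y \<in> fiber i"
    then have "(xfix i, y) \<in> F" using mem_fiber[OF i] by simp
    then have "(xfix i, y) \<in> (\<Union>j\<in>I. S j ` F)" using F(3) by simp
    then obtain j z where jz: "j \<in> I" "z \<in> F" "(xfix i, y) = S j z" by blast
    then have eq: "c j * fst z + a j = xfix i" "y = d j * snd z + b j"
      by (metis fst_conv fst_diag_affine, metis snd_conv snd_diag_affine)
    have "k j = k i" using column_of_fixed_point[OF i jz(1) _ _ eq(1)] in_unit_square[OF jz(2)] by simp
    then have "c j * fst z + a j = c j * xfix i + a j"
      using eq xfix[OF i] column i jz(1) by simp
    then have "fst z = xfix i" using ratio[OF jz(1)] by simp
    then have "(xfix i, snd z) \<in> F" using jz(2) by (metis prod.collapse)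
    then show "y \<in> (\<Union>j\<in>col (k i). (\<lambda>y. d j * y + b j) ` fiber i)"
      using eq(2) \<open>k j = k i\<close> jz(1) mem_fiber[OF i] by (auto simp: col_def)
  next
    fix y assume "y \<in> (\<Union>j\<in>col (k i). (\<lambda>y. d j * y + b j) ` fiber i)"
    then obtain j v where j: "j \<in> I" "k j = k i" and v: "v \<in> fiber i" "y = d j * v + b j"
      by (auto simp: col_def)
    have "S j (xfix i, v) \<in> F" using S_mem j(1) v(1) mem_fiber[OF i] by blast
    moreover have "S j (xfix i, v) = (xfix i, y)"
      using v(2) xfix[OF j(1)] xfix_column[OF i j] by simp
    ultimately show "y \<in> fiber i" using mem_fiber[OF i] by simp
  qed
qed (use ratio inside column_apart in \<open>auto simp: col_def\<close>)

text \<open>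
  The slice is \<open>fiber i\<close> placed on a vertical line in the plane; covers of either give covers of the
  other with comparable diameters.
\<close>

lemma slice_box_dim:
  assumes i: "i \<in> I" and t: "t \<ge> 0" "(\<Sum>j\<in>col (k i). d j powr t) = 1"
  shows "has_box_dim (slice1 (S i) F) t"
proof -
  interpret fiber: interval_system "col (k i)" d b "fiber i" by (rule fiber_system[OF i])
  have bd: "bounded (slice1 (S i) F)" using F(5) slice1_eq[OF i] bounded_subset by blast
  obtain C where C: "C > 0" "\<And>W p r. r > 0 \<Longrightarrow> W \<ge> 1 * r \<Longrightarrow>
      covering_number r ((\<lambda>x. W * x + p) ` fiber i) \<le> C * (W / r) powr t"
    using fiber.covering_upper[OF t, of 1] by auto
  obtain C' where C': "C' > 0" "\<And>r. 0 < r \<Longrightarrow> r < 1 \<Longrightarrow> (1 / r) powr t / C' \<le> covering_number r (fiber i)"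
    using fiber.covering_lower[OF t] by blast
  show ?thesis
  proof (rule has_box_dimI)
    show "C * 4 powr t > 0" "C' > 0" using C C' by auto
    fix r :: real assume r: "0 < r" "r < 1"
    have "covering_number r (fiber i) \<le> covering_number r (slice1 (S i) F)"
      unfolding fiber_def by (rule covering_number_snd_le[OF bd r(1)])
    then show "(1 / r) powr t / C' \<le> covering_number r (slice1 (S i) F)"
      using C'(2)[OF r] by linarith
    have "covering_number r (slice1 (S i) F) = covering_number r (prod.swap ` slice1 (S i) F)"
      using covering_number_swap[OF bd r(1)] by simp
    also have "\<dots> \<le> covering_number (r/4) (fst ` prod.swap ` slice1 (S i) F)"
      using r by (intro covering_number_thin[where h=0 and q="xfix i"] bounded_swap bd)
        (auto simp: slice1_eq[OF i])
    also have "fst ` prod.swap ` slice1 (S i) F = (\<lambda>x. 1 * x + 0) ` fiber i"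
      by (simp add: image_image fiber_def)
    finally have "real (covering_number r (slice1 (S i) F))
        \<le> real (covering_number (r/4) ((\<lambda>x. 1 * x + 0) ` fiber i))" by linarith
    also have "\<dots> \<le> C * (1 / (r / 4)) powr t" by (rule C(2)) (use r in auto)
    also have "1 / (r / 4) = 4 * (1 / r)" by simp
    finally show "covering_number r (slice1 (S i) F) \<le> C * 4 powr t * (1 / r) powr t"
      by (simp only: powr_mult mult.assoc)
  qed
qed

end

section \<open>The lower bound for the Assouad dimension\<close>

text \<open>
  The Assouad dimension is the infimum of these exponents.
\<close>

definition assouad_exponent :: "'a::euclidean_space set \<Rightarrow> real \<Rightarrow> bool" where
  "assouad_exponent F \<alpha> \<longleftrightarrow> (\<exists>C \<rho>. C > 0 \<and> \<rho> > 0 \<and>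
     (\<forall>r R. 0 < r \<and> r < R \<and> R \<le> \<rho> \<longrightarrow>
       (\<forall>x\<in>F. real (covering_number r (cball x R \<inter> F)) \<le> C * (R / r) powr \<alpha>)))"

lemma assouad_dim_eqI:
  assumes "assouad_exponent F \<alpha>" "\<And>\<beta>. assouad_exponent F \<beta> \<Longrightarrow> \<alpha> \<le> \<beta>"
  shows "assouad_dim F = \<alpha>"
proof -
  have "assouad_dim F = Inf {\<alpha>. assouad_exponent F \<alpha>}"
    unfolding assouad_dim_def assouad_exponent_def ..
  also have "\<dots> = \<alpha>" using assms by (intro cInf_eq_minimum) auto
  finally show ?thesis .
qed

lemma exponent_le_of_powr_le:
  fixes \<alpha> \<beta> A B :: real
  assumes "A > 0" "\<epsilon>\<^sub>0 > 0" and le: "\<And>\<epsilon>. 0 < \<epsilon> \<Longrightarrow> \<epsilon> < \<epsilon>\<^sub>0 \<Longrightarrow> A * (1 / \<epsilon>) powr \<beta> \<le> B * (1 / \<epsilon>) powr \<alpha>"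
  shows "\<beta> \<le> \<alpha>"
proof (rule ccontr)
  assume "\<not> \<beta> \<le> \<alpha>"
  define \<gamma> where "\<gamma> = \<beta> - \<alpha>"
  have \<gamma>: "\<gamma> > 0" using \<open>\<not> \<beta> \<le> \<alpha>\<close> by (simp add: \<gamma>_def)
  define M where "M = \<bar>B / A\<bar> + 1"
  define x where "x = max (1 / \<epsilon>\<^sub>0 + 1) (M powr (1 / \<gamma>))"
  have x: "x > 1 / \<epsilon>\<^sub>0" "x \<ge> M powr (1 / \<gamma>)" by (auto simp: x_def)
  have "x > 0" using x(1) \<open>\<epsilon>\<^sub>0 > 0\<close> by (smt (verit) divide_pos_pos)
  have "A * (1 / (1 / x)) powr \<beta> \<le> B * (1 / (1 / x)) powr \<alpha>"
    using x(1) \<open>x > 0\<close> \<open>\<epsilon>\<^sub>0 > 0\<close> by (intro le) (auto simp: field_simps)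
  then have "A * (x powr \<gamma> * x powr \<alpha>) \<le> B * x powr \<alpha>"
    using \<open>x > 0\<close> by (simp add: \<gamma>_def flip: powr_add)
  then have "(A * x powr \<gamma>) * x powr \<alpha> \<le> B * x powr \<alpha>" by (simp add: mult.assoc)
  then have "A * x powr \<gamma> \<le> B" using \<open>x > 0\<close> by simp
  then have "x powr \<gamma> \<le> B / A" using \<open>A > 0\<close> by (simp add: field_simps)
  moreover have "(M powr (1 / \<gamma>)) powr \<gamma> \<le> x powr \<gamma>"
    using x(2) \<gamma> by (intro powr_mono2) auto
  moreover have "(M powr (1 / \<gamma>)) powr \<gamma> = M" using \<gamma> by (simp add: powr_powr M_def)
  ultimately show False unfolding M_def using abs_ge_self[of "B / A"] by linarith
qed

context column_system
begin

text \<open>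
  Follow the first \<open>n\<close> symbols of an address of \<open>y\<close> within the slice. The composed map contracts heights to within
  \<open>\<delta>\<^sup>n\<close> of \<open>y\<close>, while its horizontal part depends only on \<open>n\<close> and not on the chosen address. This is why
  points with equal abscissae can be found near different points of the slice.
\<close>

lemma column_word:
  assumes i: "i \<in> I" and \<delta>: "\<forall>j\<in>I. d j \<le> \<delta>" and y: "y \<in> fiber i"
  shows "\<exists>h q. (\<forall>z\<in>F. (c i ^ n * (fst z - xfix i) + xfix i, h * snd z + q) \<in> F)
    \<and> (\<forall>u. 0 \<le> u \<and> u \<le> 1 \<longrightarrow> \<bar>h * u + q - y\<bar> \<le> \<delta> ^ n)"
  using y
proof (induction n arbitrary: y)
  case 0
  have "(xfix i, y) \<in> F" using 0 mem_fiber[OF i] by simp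
  then have "0 \<le> y" "y \<le> 1" using in_unit_square[of "(xfix i, y)"] by auto
  then show ?case by (intro exI[of _ 1] exI[of _ 0]) (auto simp: abs_le_iff)
next
  case (Suc n)
  interpret fiber: interval_system "col (k i)" d b "fiber i" by (rule fiber_system[OF i])
  obtain j v where j: "j \<in> I" "k j = k i" and v: "v \<in> fiber i" "y = d j * v + b j"
    using subsetD[OF equalityD1[OF fiber.self_similar] Suc.prems] by (auto simp: col_def)
  obtain h q where h: "\<And>z. z \<in> F \<Longrightarrow> (c i ^ n * (fst z - xfix i) + xfix i, h * snd z + q) \<in> F"
    and q: "\<And>u. 0 \<le> u \<Longrightarrow> u \<le> 1 \<Longrightarrow> \<bar>h * u + q - v\<bar> \<le> \<delta> ^ n"
    using Suc.IH[OF v(1)] by blast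
  have dj: "0 < d j" "d j \<le> \<delta>" using ratio j(1) \<delta> by auto
  have "(c i ^ Suc n * (fst z - xfix i) + xfix i, (d j * h) * snd z + (d j * q + b j)) \<in> F" if z: "z \<in> F" for z
  proof -
    have cj: "c j = c i" "a j = a i" using column j i by auto
    have "S j (c i ^ n * (fst z - xfix i) + xfix i, h * snd z + q) =
        (c i ^ Suc n * (fst z - xfix i) + (c i * xfix i + a i), (d j * h) * snd z + (d j * q + b j))"
      unfolding diag_affine_Pair cj by (simp add: algebra_simps)
    then show ?thesis using S_mem[OF j(1) h[OF z]] unfolding xfix[OF i] by metis
  qed
  moreover have "\<bar>(d j * h) * u + (d j * q + b j) - y\<bar> \<le> \<delta> ^ Suc n" if "0 \<le> u" "u \<le> 1" for u
  proof -
    have "(d j * h) * u + (d j * q + b j) - y = d j * (h * u + q - v)"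
      unfolding v(2) by (simp add: algebra_simps)
    then have "\<bar>(d j * h) * u + (d j * q + b j) - y\<bar> = d j * \<bar>h * u + q - v\<bar>"
      using dj by (simp add: abs_mult)
    also have "\<dots> \<le> \<delta> * \<delta> ^ n" using dj q[OF that] by (intro mult_mono) auto
    finally show ?thesis by simp
  qed
  ultimately show ?case by blast
qed

text \<open>
  The heart of the lower bound. Inside the flat rectangle \<open>S i0 ^ m\<close> (unit square), of height \<open>h = d i0 ^ m\<close>, take
  the strip of the \<open>n\<close>-fold repeated column of \<open>i\<close>, where \<open>n\<close> is chosen such that the width \<open>V\<close> of the strip is comparable
  with \<open>h\<close>. A pair \<open>(x, y)\<close> yields the point that is reached by a word near \<open>y\<close> from a point
  of \<open>F\<close> with abscissa \<open>x\<close>. Different \<open>x\<close> are separated by the factor \<open>V > c i * h\<close>, different \<open>y\<close> by the factor \<open>h\<close>: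
  the words move a height by less than \<open>\<epsilon>\<close>, which the separation \<open>3 * \<epsilon>\<close> of \<open>Y\<close> absorbs.
\<close>

lemma flat_product_points:
  assumes i0: "i0 \<in> I" "d i0 < c i0" and i: "i \<in> I" and \<rho>: "\<rho> > 0" and \<epsilon>: "\<epsilon> > 0"
    and X: "X \<subseteq> fst ` F" "X \<noteq> {}" "pairwise (\<lambda>x y. dist x y > \<epsilon>) X"
    and Y: "Y \<subseteq> fiber i" "Y \<noteq> {}" "pairwise (\<lambda>x y. dist x y > 3 * \<epsilon>) Y"
  obtains h P z where "0 < h" "2 * h \<le> \<rho>" "P \<subseteq> F" "z \<in> F" "P \<subseteq> cball z (2 * h)"
    "pairwise (\<lambda>p q. dist p q > c i * \<epsilon> * h) P" "card P = card X * card Y"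
proof -
  obtain \<kappa> \<delta> :: real where \<delta>: "0 < \<delta>" "\<delta> < 1" "\<forall>j\<in>I. d j \<le> \<delta>"
    using uniform_bounds[of I d] I ratio by metis
  obtain n0 where n0: "\<delta> ^ n0 < \<epsilon>" using real_arch_pow_inv[OF \<epsilon> \<delta>(2)] by blast
  have ci: "0 < c i" "c i < 1" and c0: "0 < c i0" "c i0 < 1" and d0: "0 < d i0" "d i0 < 1"
    using ratio i i0 by auto
  define w where "w = d i0 / c i0"
  have w: "0 < w" "w < 1" using i0 c0 d0 by (auto simp: w_def)
  \<comment> \<open>The rectangle has to be so flat that at least \<open>n0\<close> columns fit before its strip becomes a square.\<close>
  obtain m where m: "w ^ m < c i ^ n0" "2 * d i0 ^ m \<le> \<rho>"
  proof -
    have lim: "(\<lambda>m. w ^ m) \<longlonglongrightarrow> 0" "(\<lambda>m. d i0 ^ m) \<longlonglongrightarrow> 0"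
      using w d0 by (auto intro: LIMSEQ_power_zero)
    have "eventually (\<lambda>m. w ^ m < c i ^ n0) sequentially" "eventually (\<lambda>m. d i0 ^ m < \<rho> / 2) sequentially"
      using order_tendstoD(2)[OF lim(1), of "c i ^ n0"] order_tendstoD(2)[OF lim(2), of "\<rho> / 2"] ci \<rho> by simp_all
    then have "eventually (\<lambda>m. w ^ m < c i ^ n0 \<and> d i0 ^ m < \<rho> / 2) sequentially" by (rule eventually_conj)
    then obtain m where "w ^ m < c i ^ n0 \<and> d i0 ^ m < \<rho> / 2" by (auto simp: eventually_sequentially)
    then show ?thesis using that[of m] by simp
  qed
  \<comment> \<open>The first \<open>n\<close> for which the strip, of width \<open>c i0 ^ m * c i ^ n\<close>, is no wider than it is high.\<close>
  define n where "n = (LEAST n. c i ^ n \<le> w ^ m)"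
  have "\<exists>n. c i ^ n \<le> w ^ m" using real_arch_pow_inv[of "w ^ m" "c i"] w ci by (auto intro: less_imp_le)
  then have n: "c i ^ n \<le> w ^ m" unfolding n_def by (rule LeastI_ex)
  have "n0 \<le> n"
  proof (rule ccontr)
    assume "\<not> n0 \<le> n"
    then have "c i ^ n0 \<le> c i ^ n" using ci by (intro power_decreasing) auto
    then show False using n m by simp
  qed
  have "n \<noteq> 0"
  proof
    assume "n = 0"
    then have "1 \<le> w ^ m" using n by simp
    moreover have "c i ^ n0 \<le> 1" using ci by (intro power_le_one) auto
    ultimately show False using m by simp
  qed
  then obtain n' where n': "n = Suc n'" using not0_implies_Suc by blast
  then have "\<not> c i ^ n' \<le> w ^ m" using not_less_Least[of n' "\<lambda>n. c i ^ n \<le> w ^ m"] unfolding n_def by simp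
  then have "c i * w ^ m < c i * c i ^ n'" using ci by simp
  then have n2: "c i * w ^ m < c i ^ n" by (simp add: n')
  define h where "h = d i0 ^ m"
  have h: "h > 0" using d0 by (simp add: h_def)
  have hw: "h = c i0 ^ m * w ^ m" using c0 by (simp add: h_def w_def power_divide)
  define V where "V = c i0 ^ m * c i ^ n"
  have V: "c i * h < V" "V \<le> h"
    unfolding V_def hw using c0 n n2 by (simp_all add: mult.left_commute[of "c i"])
  have "\<forall>x\<in>X. \<exists>z. z \<in> F \<and> fst z = x" using X(1) by blast
  from bchoice[OF this] obtain g where g: "\<And>x. x \<in> X \<Longrightarrow> g x \<in> F \<and> fst (g x) = x" by blast
  have "\<forall>y\<in>Y. \<exists>hq. (\<forall>z\<in>F. (c i ^ n * (fst z - xfix i) + xfix i, fst hq * snd z + snd hq) \<in> F)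
    \<and> (\<forall>u. 0 \<le> u \<and> u \<le> 1 \<longrightarrow> \<bar>fst hq * u + snd hq - y\<bar> \<le> \<delta> ^ n)"
  proof
    fix y assume "y \<in> Y"
    then have "y \<in> fiber i" using Y(1) by blast
    from column_word[OF i \<delta>(3) this, of n] obtain h q where
      "(\<forall>z\<in>F. (c i ^ n * (fst z - xfix i) + xfix i, h * snd z + q) \<in> F)
        \<and> (\<forall>u. 0 \<le> u \<and> u \<le> 1 \<longrightarrow> \<bar>h * u + q - y\<bar> \<le> \<delta> ^ n)" by (elim exE)
    then show "\<exists>hq. (\<forall>z\<in>F. (c i ^ n * (fst z - xfix i) + xfix i, fst hq * snd z + snd hq) \<in> F)
        \<and> (\<forall>u. 0 \<le> u \<and> u \<le> 1 \<longrightarrow> \<bar>fst hq * u + snd hq - y\<bar> \<le> \<delta> ^ n)"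
      by (intro exI[of _ "(h, q)"]) simp
  qed
  from bchoice[OF this] obtain T where T: "\<And>y z. y \<in> Y \<Longrightarrow> z \<in> F \<Longrightarrow>
        (c i ^ n * (fst z - xfix i) + xfix i, fst (T y) * snd z + snd (T y)) \<in> F"
      "\<And>y u. y \<in> Y \<Longrightarrow> 0 \<le> u \<Longrightarrow> u \<le> 1 \<Longrightarrow> \<bar>fst (T y) * u + snd (T y) - y\<bar> \<le> \<delta> ^ n"
    by blast
  define u where "u x y = fst (T y) * snd (g x) + snd (T y)" for x y
  define v where "v x = c i ^ n * (x - xfix i) + xfix i" for x
  have vu: "(v x, u x y) \<in> F" if "x \<in> X" "y \<in> Y" for x y
    using T(1)[OF that(2), of "g x"] g[OF that(1)] by (simp add: u_def v_def)
  have "\<delta> ^ n \<le> \<delta> ^ n0" using \<delta> \<open>n0 \<le> n\<close> by (intro power_decreasing) auto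
  then have n\<epsilon>: "\<delta> ^ n < \<epsilon>" using n0 by linarith
  have uy: "\<bar>u x y - y\<bar> < \<epsilon>" if "x \<in> X" "y \<in> Y" for x y
  proof -
    have "g x \<in> F" using g[OF that(1)] by blast
    then have "\<bar>u x y - y\<bar> \<le> \<delta> ^ n"
      unfolding u_def by (intro T(2) that in_unit_square)
    then show ?thesis using n\<epsilon> by linarith
  qed
  define f where "f = (\<lambda>(x, y). (c i0 ^ m * (v x - xfix i0) + xfix i0, h * (u x y - yfix i0) + yfix i0))"
  have Vpos: "V > 0" using V(1) mult_pos_pos[OF ci(1) h] by linarith
  have f1: "fst (f (x, y)) - fst (f (x', y')) = V * (x - x')" for x y x' y'
    by (simp add: f_def v_def V_def algebra_simps)
  have f2: "snd (f (x, y)) - snd (f (x', y')) = h * (u x y - u x' y')" for x y x' y'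
    by (simp add: f_def algebra_simps)
  have sep: "dist (f p) (f q) > c i * \<epsilon> * h" if pq: "p \<in> X \<times> Y" "q \<in> X \<times> Y" "p \<noteq> q" for p q
  proof -
    obtain x y x' y' where eq: "p = (x, y)" "q = (x', y')" and xy: "x \<in> X" "y \<in> Y" "x' \<in> X" "y' \<in> Y"
      using pq by auto
    show ?thesis
    proof (cases "x = x'")
      case False
      then have "\<epsilon> < \<bar>x - x'\<bar>" using X(3) xy by (simp add: pairwise_def dist_real_def)
      then have "(c i * h) * \<epsilon> < V * \<bar>x - x'\<bar>" using V Vpos ci h \<epsilon> by (intro mult_strict_mono) auto
      also have "\<dots> = \<bar>fst (f p) - fst (f q)\<bar>"
        using Vpos unfolding eq f1 by (simp add: abs_mult)
      also have "\<dots> \<le> dist (f p) (f q)" using dist_fst_le[of "f p" "f q"] by (simp add: dist_real_def)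
      finally show ?thesis by (simp add: mult_ac)
    next
      case True
      then have "y \<noteq> y'" using pq eq by simp
      then have "3 * \<epsilon> < \<bar>y - y'\<bar>" using Y(3) xy by (simp add: pairwise_def dist_real_def)
      then have "\<epsilon> < \<bar>u x y - u x' y'\<bar>" using uy[OF xy(1,2)] uy[OF xy(3,4)] by linarith
      then have "h * \<epsilon> < h * \<bar>u x y - u x' y'\<bar>" using h by simp
      also have "\<dots> = \<bar>snd (f p) - snd (f q)\<bar>" using h unfolding eq f2 by (simp add: abs_mult)
      also have "\<dots> \<le> dist (f p) (f q)" using dist_snd_le[of "f p" "f q"] by (simp add: dist_real_def)
      finally have "h * \<epsilon> < dist (f p) (f q)" .
      moreover have "c i * (h * \<epsilon>) \<le> 1 * (h * \<epsilon>)" using ci h \<epsilon> by (intro mult_right_mono) auto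
      ultimately show ?thesis by (simp add: mult_ac)
    qed
  qed
  have "inj_on f (X \<times> Y)"
  proof (rule inj_onI, rule ccontr)
    fix p q assume "p \<in> X \<times> Y" "q \<in> X \<times> Y" "f p = f q" "p \<noteq> q"
    then have "0 > c i * \<epsilon> * h" using sep[of p q] by simp
    then show False using ci \<epsilon> h by (simp add: mult_less_0_iff)
  qed
  then have card: "card (f ` (X \<times> Y)) = card X * card Y"
    by (simp add: card_image card_cartesian_product)
  have fF: "f p \<in> F" if p: "p \<in> X \<times> Y" for p
  proof -
    obtain x y where "p = (x, y)" "x \<in> X" "y \<in> Y" using p by auto
    then show ?thesis using iterate_mem[OF i0(1) vu[of x y], of m] by (simp add: f_def h_def)
  qed
  obtain x0 y0 where xy0: "x0 \<in> X" "y0 \<in> Y" using X Y by blast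
  have near: "dist (f (x0, y0)) (f p) \<le> 2 * h" if p: "p \<in> X \<times> Y" for p
  proof -
    obtain x y where eq: "p = (x, y)" and xy: "x \<in> X" "y \<in> Y" using p by auto
    have "x0 \<in> {0..1}" "x \<in> {0..1}" using base.in_unit X(1) xy(1) xy0(1) by blast+
    then have "\<bar>x0 - x\<bar> \<le> 1" by auto
    then have vx: "V * \<bar>x0 - x\<bar> \<le> h * 1" using V h by (intro mult_mono) auto
    have "\<bar>u x0 y0 - u x y\<bar> \<le> 1"
      using in_unit_square[OF vu[OF xy]] in_unit_square[OF vu[OF xy0]] by simp
    then have "h * \<bar>u x0 y0 - u x y\<bar> \<le> h * 1" using h by (intro mult_left_mono) auto
    moreover note vx
    moreover have "dist (f (x0, y0)) (f p) \<le> \<bar>V * (x0 - x)\<bar> + \<bar>h * (u x0 y0 - u x y)\<bar>"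
      using dist_le_abs_sum[of "f (x0, y0)" "f p"] unfolding eq f1 f2 .
    ultimately show ?thesis unfolding abs_mult abs_of_pos[OF h] abs_of_pos[OF Vpos] by linarith
  qed
  show ?thesis
  proof (rule that[of h "f ` (X \<times> Y)" "f (x0, y0)"])
    show "pairwise (\<lambda>p q. dist p q > c i * \<epsilon> * h) (f ` (X \<times> Y))"
      unfolding pairwise_def
    proof (intro ballI impI)
      fix v w assume "v \<in> f ` (X \<times> Y)" "w \<in> f ` (X \<times> Y)" "v \<noteq> w"
      then obtain p q where "p \<in> X \<times> Y" "q \<in> X \<times> Y" "v = f p" "w = f q" by blast
      then show "dist v w > c i * \<epsilon> * h" using sep[of p q] \<open>v \<noteq> w\<close> by blast
    qed
    show "0 < h" "2 * h \<le> \<rho>" using h m by (auto simp: h_def)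
    show "f ` (X \<times> Y) \<subseteq> F" using fF by blast
    show "f (x0, y0) \<in> F" using fF xy0 by blast
    show "f ` (X \<times> Y) \<subseteq> cball (f (x0, y0)) (2 * h)" using near by auto
  qed (rule card)
qed

text \<open>
  Apply \<open>flat_product_points\<close> to maximal separated sets. At the ratio \<open>R / r\<close> of order \<open>1 / \<epsilon>\<close>
  there are at least about \<open>(1/\<epsilon>)\<^bsup>s+t\<^esup>\<close> separated points, at arbitrarily small \<open>R\<close>; then let \<open>\<epsilon>\<close> tend to 0.
\<close>

theorem assouad_exponent_ge:
  assumes i0: "i0 \<in> I" "d i0 < c i0" and i: "i \<in> I"
    and s: "s \<ge> 0" "(\<Sum>m\<in>K. cc m powr s) = 1"
    and t: "t \<ge> 0" "(\<Sum>j\<in>col (k i). d j powr t) = 1"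
    and \<alpha>: "assouad_exponent F \<alpha>"
  shows "s + t \<le> \<alpha>"
proof -
  interpret fiber: interval_system "col (k i)" d b "fiber i" by (rule fiber_system[OF i])
  have ci: "0 < c i" "c i < 1" using ratio i by auto
  obtain C1 where C1: "C1 > 0" "\<And>r. 0 < r \<Longrightarrow> r < 1 \<Longrightarrow> (1 / r) powr s / C1 \<le> covering_number r (fst ` F)"
    using base.covering_lower[OF s] by blast
  obtain C2 where C2: "C2 > 0" "\<And>r. 0 < r \<Longrightarrow> r < 1 \<Longrightarrow> (1 / r) powr t / C2 \<le> covering_number r (fiber i)"
    using fiber.covering_lower[OF t] by blast
  obtain C \<rho> where C: "C > 0" "\<rho> > 0" and cov: "\<And>r R x. 0 < r \<Longrightarrow> r < R \<Longrightarrow> R \<le> \<rho> \<Longrightarrow> x \<in> F \<Longrightarrow>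
      real (covering_number r (cball x R \<inter> F)) \<le> C * (R / r) powr \<alpha>"
    using \<alpha> unfolding assouad_exponent_def by blast
  define A where "A = ((1/4) powr s / C1) * ((1/12) powr t / C2)"
  show ?thesis
  proof (rule exponent_le_of_powr_le)
    show "A > 0" using C1 C2 by (simp add: A_def)
    \<comment> \<open>The largest scale used below is \<open>4 * (3 * \<epsilon>)\<close>, which has to stay below 1.\<close>
    show "(1/12::real) > 0" by simp
    fix \<epsilon> :: real assume \<epsilon>: "0 < \<epsilon>" "\<epsilon> < 1/12"
    have "bounded (fst ` F)" "bounded (fiber i)"
      using base.E fiber.E compact_imp_bounded by blast+
    obtain X where X: "X \<subseteq> fst ` F" "finite X" "pairwise (\<lambda>x y. dist x y > \<epsilon>) X"
        "covering_number (4 * \<epsilon>) (fst ` F) \<le> card X"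
      using separated_subset_exists[OF \<open>bounded (fst ` F)\<close> \<epsilon>(1)] by blast
    obtain Y where Y: "Y \<subseteq> fiber i" "finite Y" "pairwise (\<lambda>x y. dist x y > 3 * \<epsilon>) Y"
        "covering_number (4 * (3 * \<epsilon>)) (fiber i) \<le> card Y"
      using separated_subset_exists[OF \<open>bounded (fiber i)\<close>, of "3 * \<epsilon>"] \<epsilon>(1) by auto
    have cX: "(1 / (4 * \<epsilon>)) powr s / C1 \<le> card X"
      using C1(2)[of "4 * \<epsilon>"] X(4) \<epsilon> by simp
    have cY: "(1 / (12 * \<epsilon>)) powr t / C2 \<le> card Y"
      using C2(2)[of "12 * \<epsilon>"] Y(4) \<epsilon> by simp
    have "0 < (1 / (4 * \<epsilon>)) powr s / C1" "0 < (1 / (12 * \<epsilon>)) powr t / C2"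
      using \<epsilon> C1 C2 by auto
    then have ne: "X \<noteq> {}" "Y \<noteq> {}" using cX cY by auto
    obtain h P z where h: "0 < h" "2 * h \<le> \<rho>" and P: "P \<subseteq> F" "z \<in> F" "P \<subseteq> cball z (2 * h)"
        "pairwise (\<lambda>p q. dist p q > c i * \<epsilon> * h) P" "card P = card X * card Y"
      using flat_product_points[OF i0 i C(2) \<epsilon>(1) X(1) ne(1) X(3) Y(1) ne(2) Y(3)] by blast
    have r: "0 < c i * \<epsilon> * h" using ci \<epsilon> h by simp
    have "c i * \<epsilon> < 1 * 2" using ci \<epsilon> by (intro mult_strict_mono) auto
    then have r2: "c i * \<epsilon> * h < 2 * h" using h by simp
    have bd: "bounded (cball z (2 * h) \<inter> F)" by (simp add: bounded_Int)
    have "card P \<le> covering_number (c i * \<epsilon> * h) (cball z (2 * h) \<inter> F)"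
      using card_separated_le_covering_number[OF bd r _ P(4)] P by blast
    also have "real \<dots> \<le> C * (2 * h / (c i * \<epsilon> * h)) powr \<alpha>"
      by (rule cov[OF r r2 h(2) P(2)])
    also have "2 * h / (c i * \<epsilon> * h) = (2 / c i) * (1 / \<epsilon>)" using h by simp
    also have "((2 / c i) * (1 / \<epsilon>)) powr \<alpha> = (2 / c i) powr \<alpha> * (1 / \<epsilon>) powr \<alpha>" by (rule powr_mult)
    finally have up: "real (card P) \<le> C * (2 / c i) powr \<alpha> * (1 / \<epsilon>) powr \<alpha>" by simp
    have "A * (1 / \<epsilon>) powr (s + t) = ((1 / (4 * \<epsilon>)) powr s / C1) * ((1 / (12 * \<epsilon>)) powr t / C2)"
      using \<epsilon> by (simp add: A_def powr_add powr_mult powr_divide)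
    also have "\<dots> \<le> real (card X) * real (card Y)"
      using cX cY C1 C2 by (intro mult_mono) auto
    finally show "A * (1 / \<epsilon>) powr (s + t) \<le> C * (2 / c i) powr \<alpha> * (1 / \<epsilon>) powr \<alpha>"
      using up P(5) by simp
  qed
qed

end


section \<open>Strips\<close>

context column_system
begin

text \<open>
  The strip of a word of columns is the part of the attractor whose addresses run through these columns. Its
  projection is the copy of the projection of \<open>F\<close> with width \<open>strip_width\<close> and left end \<open>strip_left\<close>.
\<close>

primrec strip :: "nat list \<Rightarrow> (real \<times> real) set" where
  "strip [] = F"
| "strip (m # ms) = (\<Union>j\<in>col m. S j ` strip ms)"

primrec strip_width :: "nat list \<Rightarrow> real" where
  "strip_width [] = 1"
| "strip_width (m # ms) = cc m * strip_width ms"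

primrec strip_left :: "nat list \<Rightarrow> real" where
  "strip_left [] = 0"
| "strip_left (m # ms) = cc m * strip_left ms + aa m"

lemma strip_width_pos: "set ms \<subseteq> K \<Longrightarrow> 0 < strip_width ms"
  using base.ratio by (induction ms) auto

lemma strip_subset: "strip ms \<subseteq> F"
proof (induction ms)
  case (Cons m ms)
  then show ?case using S_mem by (fastforce simp: col_def)
qed simp

lemma fst_strip: "set ms \<subseteq> K \<Longrightarrow> fst ` strip ms = (\<lambda>x. strip_width ms * x + strip_left ms) ` fst ` F"
proof (induction ms)
  case (Cons m ms)
  then have m: "m \<in> K" and IH: "fst ` strip ms = (\<lambda>x. strip_width ms * x + strip_left ms) ` fst ` F" by auto
  have "fst ` S j ` strip ms = (\<lambda>x. cc m * x + aa m) ` fst ` strip ms" if "j \<in> col m" for j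
    using that column by (auto simp: col_def image_image)
  moreover have "col m \<noteq> {}" using m by (auto simp: col_def)
  ultimately have "fst ` strip (m # ms) = (\<lambda>x. cc m * x + aa m) ` fst ` strip ms"
    by (simp add: image_UN)
  also have "\<dots> = (\<lambda>x. strip_width (m # ms) * x + strip_left (m # ms)) ` fst ` F"
    unfolding IH by (simp add: image_image algebra_simps)
  finally show ?case .
qed simp

lemma F_columns: "F = (\<Union>m\<in>K. \<Union>j\<in>col m. S j ` F)"
proof -
  have "(\<Union>m\<in>K. \<Union>j\<in>col m. S j ` F) = (\<Union>i\<in>I. S i ` F)" by (auto simp: col_def)
  then show ?thesis using F(3) by simp
qed

lemma strip_split: "strip ms = (\<Union>m\<in>K. strip (ms @ [m]))"
proof (induction ms)
  case Nil
  show ?case using F_columns by simp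
next
  case (Cons m' ms)
  have "strip (m' # ms) = (\<Union>j\<in>col m'. S j ` (\<Union>m\<in>K. strip (ms @ [m])))"
    using Cons by simp
  also have "\<dots> = (\<Union>m\<in>K. \<Union>j\<in>col m'. S j ` strip (ms @ [m]))" by blast
  finally show ?case by simp
qed

lemma strip_width_snoc [simp]: "strip_width (ms @ [m]) = strip_width ms * cc m"
  by (induction ms) auto

lemma strip_left_snoc [simp]: "strip_left (ms @ [m]) = strip_width ms * aa m + strip_left ms"
  by (induction ms) (auto simp: algebra_simps)

lemma bounded_strip: "bounded (diag_affine W h p q ` strip ms)"
proof -
  have "compact (diag_affine W h p q ` F)"
    unfolding diag_affine_def split_beta by (intro compact_continuous_image continuous_intros F)
  then show ?thesis using strip_subset compact_imp_bounded bounded_subset image_mono by metis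
qed

lemma strip_in_rectangle:
  assumes "W > 0" "h > 0" "set ms \<subseteq> K"
  shows "diag_affine W h p q ` strip ms \<subseteq>
    {W * strip_left ms + p..W * strip_left ms + p + W * strip_width ms} \<times> {q..q + h}"
proof
  fix z assume "z \<in> diag_affine W h p q ` strip ms"
  then obtain v where v: "v \<in> strip ms" "z = diag_affine W h p q v" by blast
  then have "fst v \<in> (\<lambda>x. strip_width ms * x + strip_left ms) ` fst ` F" using fst_strip assms by blast
  then obtain x where "x \<in> fst ` F" and xv: "fst v = strip_width ms * x + strip_left ms" by blast
  then have "x \<in> {0..1}" using base.in_unit by blast
  with xv have x: "0 \<le> x" "x \<le> 1" "fst v = strip_width ms * x + strip_left ms" by auto
  have "0 \<le> snd v" "snd v \<le> 1" using v(1) strip_subset in_unit_square by blast+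
  moreover have "0 \<le> W * strip_width ms * x" "W * strip_width ms * x \<le> W * strip_width ms * 1"
    using x assms strip_width_pos[OF assms(3)] by (auto intro!: mult_left_mono)
  moreover have "h * snd v \<le> h * 1" "0 \<le> h * snd v"
    using calculation assms by (auto intro!: mult_left_mono)
  ultimately show "z \<in> {W * strip_left ms + p..W * strip_left ms + p + W * strip_width ms} \<times> {q..q + h}"
    unfolding v(2) mem_Times_iff fst_diag_affine snd_diag_affine x(3) by (simp add: algebra_simps)
qed

lemma snd_affine_strip:
  assumes "W > 0" "h > 0" "set ms \<subseteq> K"
  shows "snd ` diag_affine W h p q ` strip ms \<subseteq> {q..q + h}"
  using strip_in_rectangle[OF assms, of p q] by fastforce

text \<open>
  A flat rectangle is cut into approximate squares: refine the columns until the width is at most \<open>h / \<kappa>\<close>. One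
  more subdivision multiplies the width by at least \<open>\<kappa>\<close>, so it never drops below \<open>h\<close>.
\<close>

lemma strip_tiling:
  assumes "W > 0" "h > 0" and \<kappa>\<delta>: "\<kappa> > 0" "\<forall>m\<in>K. \<kappa> \<le> cc m \<and> cc m \<le> \<delta>"
    and good: "\<And>ms. set ms \<subseteq> K \<Longrightarrow> h \<le> W * strip_width ms \<Longrightarrow> \<kappa> * (W * strip_width ms) \<le> h \<Longrightarrow>
      good (diag_affine W h p q ` strip ms)
        ({W * strip_left ms + p<..<W * strip_left ms + p + W * strip_width ms} \<times> {q<..<q + h})"
    and ms: "set ms \<subseteq> K" "h \<le> W * strip_width ms" "\<kappa> * (W * strip_width ms) * \<delta> ^ n \<le> h"
  shows "\<exists>T. tiling T (diag_affine W h p q ` strip ms)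
    ({W * strip_left ms + p<..<W * strip_left ms + p + W * strip_width ms} \<times> {q<..<q + h}) good"
proof -
  have single: "\<exists>T. tiling T (diag_affine W h p q ` strip ms)
      ({W * strip_left ms + p<..<W * strip_left ms + p + W * strip_width ms} \<times> {q<..<q + h}) good"
    if "set ms \<subseteq> K" "h \<le> W * strip_width ms" "\<kappa> * (W * strip_width ms) \<le> h" for ms
    by (rule exI, rule tiling_single[where good=good, OF _ order_refl order_refl])
      (use good[OF that] that assms(1,2) in auto)
  show ?thesis
    using ms
  proof (induction n arbitrary: ms)
    case 0
    then show ?case by (intro single) auto
  next
    case (Suc n)
    have w: "0 < W * strip_width ms" using strip_width_pos[OF Suc.prems(1)] assms by simp
    show ?case
    proof (cases "\<kappa> * (W * strip_width ms) \<le> h")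
      case True
      then show ?thesis using Suc.prems by (intro single) auto
    next
      case False
      let ?box = "\<lambda>ms. {W * strip_left ms + p<..<W * strip_left ms + p + W * strip_width ms} \<times> {q<..<q + h}"
      have "\<forall>m\<in>K. \<exists>T. tiling T (diag_affine W h p q ` strip (ms @ [m])) (?box (ms @ [m])) good"
      proof
        fix m assume m: "m \<in> K"
        show "\<exists>T. tiling T (diag_affine W h p q ` strip (ms @ [m])) (?box (ms @ [m])) good"
        proof (rule Suc.IH)
          show "set (ms @ [m]) \<subseteq> K" using m Suc.prems by simp
          have "(W * strip_width ms) * \<kappa> \<le> (W * strip_width ms) * cc m"
            using m \<kappa>\<delta> w by (intro mult_left_mono) auto
          then show "h \<le> W * strip_width (ms @ [m])" using False by (simp add: mult_ac)
          have "\<kappa> * (W * strip_width ms) * \<delta> ^ n * cc m \<le> \<kappa> * (W * strip_width ms) * \<delta> ^ n * \<delta>"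
          proof (rule mult_left_mono)
            have "\<kappa> \<le> cc m \<and> cc m \<le> \<delta>" using m \<kappa>\<delta>(2) by blast
            then show "cc m \<le> \<delta>" "0 \<le> \<kappa> * (W * strip_width ms) * \<delta> ^ n" using \<kappa>\<delta>(1) w by auto
          qed
          then show "\<kappa> * (W * strip_width (ms @ [m])) * \<delta> ^ n \<le> h"
            using Suc.prems(3) by (simp add: mult_ac)
        qed
      qed
      from bchoice[OF this] obtain T where
        T: "\<And>m. m \<in> K \<Longrightarrow> tiling (T m) (diag_affine W h p q ` strip (ms @ [m])) (?box (ms @ [m])) good"
        by blast
      define e where "e = W * strip_width ms"
      have e: "e > 0" using w by (simp add: e_def)
      have left: "W * strip_left (ms @ [m]) = W * strip_left ms + e * aa m"
        and width: "W * strip_width (ms @ [m]) = e * cc m" for m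
        by (simp_all add: e_def algebra_simps)
      have sub: "?box (ms @ [m]) \<subseteq> ?box ms" if m: "m \<in> K" for m
      proof -
        have "0 \<le> e * aa m" using base.inside[OF m] e by simp
        moreover have "e * (aa m + cc m) \<le> e * 1"
          by (rule mult_left_mono) (use base.inside[OF m] e in auto)
        then have "e * aa m + e * cc m \<le> e" by (simp add: distrib_left)
        ultimately show ?thesis unfolding left width e_def[symmetric] by auto
      qed
      have dis: "disjoint_family_on (\<lambda>m. ?box (ms @ [m])) K"
        unfolding disjoint_family_on_def
      proof (intro ballI impI)
        fix m m' assume "m \<in> K" "m' \<in> K" "m \<noteq> m'"
        then have "aa m + cc m \<le> aa m' \<or> aa m' + cc m' \<le> aa m" by (rule base.apart)
        then have "e * (aa m + cc m) \<le> e * aa m' \<or> e * (aa m' + cc m') \<le> e * aa m"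
          using e by simp
        then have "e * aa m + e * cc m \<le> e * aa m' \<or> e * aa m' + e * cc m' \<le> e * aa m"
          by (simp add: distrib_left)
        then show "?box (ms @ [m]) \<inter> ?box (ms @ [m']) = {}" unfolding left width by auto
      qed
      have "diag_affine W h p q ` strip ms = (\<Union>m\<in>K. diag_affine W h p q ` strip (ms @ [m]))"
        by (subst strip_split) blast
      then show ?thesis using tiling_UN(1)[OF base.K(1) T sub dis] by auto
  qed
qed
qed

section \<open>Covering strips by a potential\<close>

text \<open>
  Here \<open>\<Phi> W h\<close> is a bound for the covering number at scale \<open>r\<close> of a copy of width \<open>W\<close> and height \<open>h\<close>, and \<open>G\<close>
  restricts the shapes that occur. While columns are prescribed, the width of the strip stays fixed and only the heights
  shrink (\<open>strip\<close>); once the word is exhausted both sides shrink (\<open>free\<close>). If \<open>\<Phi>\<close> does not increase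
  under either subdivision, it suffices to bound the covering numbers of the pieces for which a side has dropped below
  \<open>r/4\<close> (\<open>stop\<close>), and the sides of those are still at least \<open>\<kappa> * r / 4\<close>. The number \<open>n\<close> bounds the remaining
  subdivisions.
\<close>

lemma strip_covering:
  fixes \<Phi> :: "real \<Rightarrow> real \<Rightarrow> real" and G :: "real \<Rightarrow> real \<Rightarrow> bool"
  assumes r: "r > 0" and \<kappa>\<delta>: "\<kappa> > 0" "\<forall>i\<in>I. \<kappa> \<le> c i \<and> \<kappa> \<le> d i \<and> d i \<le> \<delta>"
    and stop: "\<And>W h p q ms. W > 0 \<Longrightarrow> set ms \<subseteq> K \<Longrightarrow> G (W * strip_width ms) h \<Longrightarrow>
      \<kappa> * r / 4 \<le> W * strip_width ms \<Longrightarrow> \<kappa> * r / 4 \<le> h \<Longrightarrow> W * strip_width ms \<le> r / 4 \<or> h \<le> r / 4 \<Longrightarrow>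
      covering_number r (diag_affine W h p q ` strip ms) \<le> \<Phi> (W * strip_width ms) h"
    and free: "\<And>W h. W > 0 \<Longrightarrow> h > 0 \<Longrightarrow> G W h \<Longrightarrow>
      (\<forall>j\<in>I. G (W * c j) (h * d j)) \<and> (\<Sum>j\<in>I. \<Phi> (W * c j) (h * d j)) \<le> \<Phi> W h"
    and strip: "\<And>W h m. W > 0 \<Longrightarrow> h > 0 \<Longrightarrow> G W h \<Longrightarrow> m \<in> K \<Longrightarrow>
      (\<forall>j\<in>col m. G W (h * d j)) \<and> (\<Sum>j\<in>col m. \<Phi> W (h * d j)) \<le> \<Phi> W h"
    and W: "W > 0" "set ms \<subseteq> K" "G (W * strip_width ms) h"
      "\<kappa> * r / 4 \<le> W * strip_width ms" "\<kappa> * r / 4 \<le> h" "h * \<delta> ^ n \<le> r / 4"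
  shows "covering_number r (diag_affine W h p q ` strip ms) \<le> \<Phi> (W * strip_width ms) h"
  using W
proof (induction n arbitrary: W h p q ms)
  case 0
  show ?case using 0 by (intro stop) auto
next
  case (Suc n)
  have h0: "h > 0" using Suc.prems(5) mult_pos_pos[OF \<kappa>\<delta>(1) r] by linarith
  show ?case
  proof (cases "W * strip_width ms \<le> r / 4 \<or> h \<le> r / 4")
    case True
    then show ?thesis using Suc.prems by (intro stop) auto
  next
    case False
    have comp: "diag_affine W h p q ` S j ` X = diag_affine (W * c j) (h * d j) (W * a j + p) (h * b j + q) ` X" for j X
      by (simp add: image_image diag_affine_compose)
    have small: "\<kappa> * r / 4 \<le> h * d j \<and> h * d j * \<delta> ^ n \<le> r / 4" if "j \<in> I" for j
    proof
      have "(r / 4) * \<kappa> \<le> h * d j" using False r \<kappa>\<delta> that by (intro mult_mono) auto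
      then show "\<kappa> * r / 4 \<le> h * d j" by (simp add: mult_ac)
      have "0 < d j" "d j \<le> \<delta>" using ratio that \<kappa>\<delta> by auto
      then have "h * \<delta> ^ n * d j \<le> h * \<delta> ^ n * \<delta>" using h0 by (intro mult_left_mono) auto
      then show "h * d j * \<delta> ^ n \<le> r / 4" using Suc.prems(6) by (simp add: mult_ac)
    qed
    show ?thesis
    proof (cases ms)
      case Nil
      have eq: "diag_affine W h p q ` strip ms =
          (\<Union>j\<in>I. diag_affine (W * c j) (h * d j) (W * a j + p) (h * b j + q) ` strip [])"
      proof -
        have "diag_affine W h p q ` F = diag_affine W h p q ` (\<Union>j\<in>I. S j ` F)"
          by (rule arg_cong[OF F(3)])
        also have "\<dots> = (\<Union>j\<in>I. diag_affine W h p q ` S j ` F)" by blast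
        finally show ?thesis unfolding comp Nil strip.simps .
      qed
      have W1: "W * strip_width ms = W" using Nil by simp
      note pr = Suc.prems[unfolded W1] False[unfolded W1]
      have "real (covering_number r (diag_affine W h p q ` strip ms)) \<le>
          real (\<Sum>j\<in>I. covering_number r (diag_affine (W * c j) (h * d j) (W * a j + p) (h * b j + q) ` strip []))"
        unfolding eq by (intro of_nat_mono covering_number_UN I r bounded_strip)
      also have "\<dots> \<le> (\<Sum>j\<in>I. \<Phi> (W * c j) (h * d j))"
        unfolding of_nat_sum
      proof (rule sum_mono)
        fix j assume j: "j \<in> I"
        have "covering_number r (diag_affine (W * c j) (h * d j) (W * a j + p) (h * b j + q) ` strip [])
            \<le> \<Phi> (W * c j * strip_width []) (h * d j)"
        proof (rule Suc.IH)
          show "W * c j > 0" using j ratio pr by simp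
          show "G (W * c j * strip_width []) (h * d j)" using free[OF pr(1) h0 pr(3)] j by simp
          have "(r / 4) * \<kappa> \<le> W * c j" using pr r \<kappa>\<delta> j by (intro mult_mono) auto
          then show "\<kappa> * r / 4 \<le> W * c j * strip_width []" by (simp add: mult_ac)
        qed (use small j in auto)
        then show "real (covering_number r (diag_affine (W * c j) (h * d j) (W * a j + p) (h * b j + q) ` strip []))
            \<le> \<Phi> (W * c j) (h * d j)" by simp
      qed
      also have "\<dots> \<le> \<Phi> W h" using free[OF pr(1) h0 pr(3)] by simp
      finally show ?thesis unfolding W1 .
    next
      case (Cons m ms')
      have m: "m \<in> K" "set ms' \<subseteq> K" using Suc.prems(2) Cons by auto
      have eq: "diag_affine W h p q ` strip ms =
          (\<Union>j\<in>col m. diag_affine (W * c j) (h * d j) (W * a j + p) (h * b j + q) ` strip ms')"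
        unfolding comp[symmetric] Cons strip.simps by blast
      have Wj: "W * c j * strip_width ms' = W * strip_width ms" if "j \<in> col m" for j
        using that column[of j] Cons by (simp add: col_def)
      have w: "0 < W * strip_width ms" using strip_width_pos[OF Suc.prems(2)] Suc.prems(1) by simp
      have "real (covering_number r (diag_affine W h p q ` strip ms)) \<le>
          real (\<Sum>j\<in>col m. covering_number r (diag_affine (W * c j) (h * d j) (W * a j + p) (h * b j + q) ` strip ms'))"
        unfolding eq by (intro of_nat_mono covering_number_UN finite_col r bounded_strip)
      also have "\<dots> \<le> (\<Sum>j\<in>col m. \<Phi> (W * strip_width ms) (h * d j))"
        unfolding of_nat_sum
      proof (rule sum_mono)
        fix j assume j: "j \<in> col m"
        then have jI: "j \<in> I" by (simp add: col_def)
        show "real (covering_number r (diag_affine (W * c j) (h * d j) (W * a j + p) (h * b j + q) ` strip ms'))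
            \<le> \<Phi> (W * strip_width ms) (h * d j)"
          unfolding Wj[OF j, symmetric]
        proof (rule Suc.IH)
          show "W * c j > 0" using jI ratio Suc.prems(1) by simp
          show "G (W * c j * strip_width ms') (h * d j)"
            unfolding Wj[OF j] using strip[OF w h0 Suc.prems(3) m(1)] j by simp
          show "\<kappa> * r / 4 \<le> W * c j * strip_width ms'" unfolding Wj[OF j] by (rule Suc.prems)
        qed (use small jI m in auto)
      qed
      also have "\<dots> \<le> \<Phi> (W * strip_width ms) h" using strip[OF w h0 Suc.prems(3) m(1)] by simp
      finally show ?thesis .
    qed
  qed
qed

text \<open>
  Pieces of height about \<open>r\<close> cost as much as their projections. The factor \<open>(h / r)\<^sup>e\<close> is then bounded below, so it
  may be inserted to match a potential.
\<close>

lemma flat_covering: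
  assumes s: "s \<ge> 0" "(\<Sum>m\<in>K. cc m powr s) = 1" and e: "e \<ge> 0" and \<kappa>: "\<kappa> > 0"
  obtains M where "M > 0" "\<And>r w h p q Z. r > 0 \<Longrightarrow> \<kappa> * r / 4 \<le> w \<Longrightarrow> \<kappa> * r / 4 \<le> h \<Longrightarrow> h \<le> r / 4 \<Longrightarrow>
      bounded Z \<Longrightarrow> fst ` Z \<subseteq> (\<lambda>x. w * x + p) ` fst ` F \<Longrightarrow> snd ` Z \<subseteq> {q..q + h} \<Longrightarrow>
      covering_number r Z \<le> M * ((w / r) powr s * (h / r) powr e)"
proof -
  obtain C where C: "C > 0" "\<And>W p r. r > 0 \<Longrightarrow> W \<ge> \<kappa> * r \<Longrightarrow>
      covering_number r ((\<lambda>x. W * x + p) ` fst ` F) \<le> C * (W / r) powr s"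
    using base.covering_upper[OF s \<kappa>] by blast
  define M where "M = C * 4 powr s * (4 / \<kappa>) powr e"
  have "M > 0" using C \<kappa> by (simp add: M_def)
  moreover have "covering_number r Z \<le> M * ((w / r) powr s * (h / r) powr e)"
    if r: "r > 0" and w: "\<kappa> * r / 4 \<le> w" and h: "\<kappa> * r / 4 \<le> h" "h \<le> r / 4"
      and Z: "bounded Z" "fst ` Z \<subseteq> (\<lambda>x. w * x + p) ` fst ` F" "snd ` Z \<subseteq> {q..q + h}" for r w h p q Z
  proof -
    have "compact ((\<lambda>x. w * x + p) ` fst ` F)"
      by (intro compact_continuous_image continuous_intros base.E)
    then have bd: "bounded ((\<lambda>x. w * x + p) ` fst ` F)" by (rule compact_imp_bounded)
    have "covering_number r Z \<le> covering_number (r / 4) (fst ` Z)"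
      by (rule covering_number_thin[OF Z(1) r Z(3) h(2)])
    also have "\<dots> \<le> covering_number (r / 4) ((\<lambda>x. w * x + p) ` fst ` F)"
      using r by (intro covering_number_mono Z bd) auto
    finally have "real (covering_number r Z) \<le> real (covering_number (r / 4) ((\<lambda>x. w * x + p) ` fst ` F))"
      by simp
    also have "\<dots> \<le> C * (w / (r / 4)) powr s"
      by (rule C(2)) (use r w in auto)
    also have "w / (r / 4) = 4 * (w / r)" by simp
    also have "C * (4 * (w / r)) powr s = C * 4 powr s * (w / r) powr s * 1"
      unfolding powr_mult by simp
    also have "\<dots> \<le> C * 4 powr s * (w / r) powr s * (4 / \<kappa> * (h / r)) powr e"
      using h r \<kappa> C e by (intro mult_left_mono ge_one_powr_ge_zero) (auto simp: field_simps)
    also have "\<dots> = M * ((w / r) powr s * (h / r) powr e)"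
      unfolding powr_mult[of "4 / \<kappa>"] M_def by simp
    finally show ?thesis .
  qed
  ultimately show ?thesis by (rule that)
qed

lemma fst_affine_strip:
  assumes "set ms \<subseteq> K"
  shows "fst ` diag_affine W h p q ` strip ms
    = (\<lambda>x. (W * strip_width ms) * x + (W * strip_left ms + p)) ` fst ` F"
proof -
  have "fst ` diag_affine W h p q ` strip ms = (\<lambda>x. W * x + p) ` fst ` strip ms"
    by (simp add: image_image)
  then show ?thesis unfolding fst_strip[OF assms] by (simp add: image_image algebra_simps)
qed

text \<open>
  Group the maps by columns and use the Moran equation of the projection.
\<close>

lemma column_weight_le_1:
  assumes s: "(\<Sum>m\<in>K. cc m powr s) = 1" and t: "\<And>m. m \<in> K \<Longrightarrow> (\<Sum>j\<in>col m. d j powr t) \<le> 1"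
  shows "(\<Sum>j\<in>I. c j powr s * d j powr t) \<le> 1"
proof -
  have "(\<Sum>j\<in>I. c j powr s * d j powr t) = (\<Sum>m\<in>K. \<Sum>j\<in>col m. c j powr s * d j powr t)"
    unfolding col_def by (rule sum.group[symmetric]) (use I in auto)
  also have "\<dots> = (\<Sum>m\<in>K. cc m powr s * (\<Sum>j\<in>col m. d j powr t))"
    unfolding sum_distrib_left using column by (intro sum.cong) (auto simp: col_def)
  also have "\<dots> \<le> (\<Sum>m\<in>K. cc m powr s * 1)"
    using t by (intro sum_mono mult_left_mono) auto
  finally show ?thesis using s by simp
qed

text \<open>
  The estimate wanted for approximate squares of side \<open>R\<close>, stated for all strips with height between \<open>\<kappa> * R\<close> and \<open>R\<close> and
  with width between the height \<open>h\<close> and \<open>h / \<kappa>\<close>.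
\<close>

definition strip_regular :: "real \<Rightarrow> real \<Rightarrow> bool" where
  "strip_regular \<kappa> \<alpha> \<longleftrightarrow> (\<exists>M>0. \<forall>r R W h p q ms. 0 < r \<longrightarrow> r < R \<longrightarrow> W > 0 \<longrightarrow> set ms \<subseteq> K \<longrightarrow>
    \<kappa> * R \<le> h \<longrightarrow> h \<le> R \<longrightarrow> h \<le> W * strip_width ms \<longrightarrow> \<kappa> * (W * strip_width ms) \<le> h \<longrightarrow>
    covering_number r (diag_affine W h p q ` strip ms) \<le> M * (R / r) powr \<alpha>)"

lemma scaled_potential_sum:
  fixes W h r :: real
  shows "(\<Sum>j\<in>J. (W * f j / r) powr s * (h * g j / r) powr t)
    = (W / r) powr s * (h / r) powr t * (\<Sum>j\<in>J. f j powr s * g j powr t)"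
proof -
  have "(W * f j / r) powr s * (h * g j / r) powr t
      = (W / r) powr s * (h / r) powr t * (f j powr s * g j powr t)" for j
    using powr_mult[of "W / r" "f j" s] powr_mult[of "h / r" "g j" t] by simp
  then show ?thesis by (simp add: sum_distrib_left)
qed

lemma potential_le:
  fixes W h r R :: real
  assumes "0 < \<kappa>" "\<kappa> \<le> 1" "0 < r" "r < R" "0 < h" "0 < W" "h \<le> R" "\<kappa> * W \<le> h" "s \<ge> 0" "t \<ge> 0"
  shows "(W / r) powr s * (h / r) powr t \<le> (1 / \<kappa>) powr (s + t) * (R / r) powr (s + t)"
proof -
  have "\<kappa> * h \<le> 1 * R" by (rule mult_mono) (use assms in auto)
  moreover have "\<kappa> * W \<le> R" using assms by linarith
  ultimately have "W / r \<le> 1 / \<kappa> * (R / r)" "h / r \<le> 1 / \<kappa> * (R / r)" using assms by (auto simp: field_simps)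
  then have "(W / r) powr s * (h / r) powr t \<le> (1 / \<kappa> * (R / r)) powr s * (1 / \<kappa> * (R / r)) powr t"
    using assms by (intro mult_mono powr_mono2) auto
  also have "\<dots> = (1 / \<kappa>) powr (s + t) * (R / r) powr (s + t)"
    unfolding powr_add[symmetric] by (rule powr_mult)
  finally show ?thesis .
qed

text \<open>
  The potential is \<open>(W/r)\<^sup>s (h/r)\<^sup>t\<close>. Since \<open>d i \<le> c i\<close>, pieces stay at least as wide as high, so the
  subdivision always ends with a flat piece.
\<close>

lemma strip_regular_horizontal:
  assumes hor: "\<And>i. i \<in> I \<Longrightarrow> d i \<le> c i" and s: "s \<ge> 0" "(\<Sum>m\<in>K. cc m powr s) = 1"
    and t: "t \<ge> 0" "\<And>m. m \<in> K \<Longrightarrow> (\<Sum>j\<in>col m. d j powr t) \<le> 1"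
    and \<kappa>: "0 < \<kappa>" "\<kappa> \<le> 1" "\<forall>i\<in>I. \<kappa> \<le> c i \<and> \<kappa> \<le> d i"
  shows "strip_regular \<kappa> (s + t)"
proof -
  obtain M where M: "M > 0" and flat: "\<And>r w h p q Z. r > 0 \<Longrightarrow> \<kappa> * r / 4 \<le> w \<Longrightarrow> \<kappa> * r / 4 \<le> h \<Longrightarrow> h \<le> r / 4 \<Longrightarrow>
      bounded Z \<Longrightarrow> fst ` Z \<subseteq> (\<lambda>x. w * x + p) ` fst ` F \<Longrightarrow> snd ` Z \<subseteq> {q..q + h} \<Longrightarrow>
      covering_number r Z \<le> M * ((w / r) powr s * (h / r) powr t)"
    using flat_covering[OF s t(1) \<kappa>(1)] by blast
  obtain \<kappa>' \<delta> :: real where \<delta>: "0 < \<delta>" "\<delta> < 1" "\<forall>j\<in>I. d j \<le> \<delta>"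
    using uniform_bounds[of I d] I ratio by metis
  have "covering_number r (diag_affine W h p q ` strip ms) \<le> (M * (1 / \<kappa>) powr (s + t)) * (R / r) powr (s + t)"
    if r: "0 < r" "r < R" and W: "W > 0" "set ms \<subseteq> K" and h: "\<kappa> * R \<le> h" "h \<le> R" "h \<le> W * strip_width ms"
      "\<kappa> * (W * strip_width ms) \<le> h" for r R W h p q ms
  proof -
    have "\<kappa> * r \<le> \<kappa> * R" "0 < \<kappa> * r" using r \<kappa> by simp_all
    then have \<kappa>h: "\<kappa> * r / 4 \<le> h" "0 < h" using h by linarith+
    obtain n where n: "h * \<delta> ^ n \<le> r / 4" using power_mult_le_of_lt_1[OF \<delta>(1,2), of "r / 4" h] r \<kappa>h by auto
    define \<Phi> where "\<Phi> W h = M * ((W / r) powr s * (h / r) powr t)" for W h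
    have "real (covering_number r (diag_affine W h p q ` strip ms)) \<le> \<Phi> (W * strip_width ms) h"
    proof (rule strip_covering[where G="\<lambda>W h. h \<le> W" and \<kappa>=\<kappa> and \<delta>=\<delta>])
      fix W h p q ms
      assume "W > 0" "set ms \<subseteq> K" "h \<le> W * strip_width ms" "\<kappa> * r / 4 \<le> W * strip_width ms"
        "\<kappa> * r / 4 \<le> h" "W * strip_width ms \<le> r / 4 \<or> h \<le> r / 4"
      moreover from this have "h > 0" using \<open>0 < \<kappa> * r\<close> by linarith
      ultimately show "covering_number r (diag_affine W h p q ` strip ms) \<le> \<Phi> (W * strip_width ms) h"
        unfolding \<Phi>_def
        by (intro flat[OF r(1) _ _ _ bounded_strip equalityD1[OF fst_affine_strip] snd_affine_strip]) auto
    next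
      fix W h :: real assume Wh: "W > 0" "h > 0" "h \<le> W"
      have "(\<Sum>j\<in>I. \<Phi> (W * c j) (h * d j)) = \<Phi> W h * (\<Sum>j\<in>I. c j powr s * d j powr t)"
        unfolding \<Phi>_def by (simp add: scaled_potential_sum flip: sum_distrib_left)
      also have "\<dots> \<le> \<Phi> W h * 1"
        unfolding \<Phi>_def by (intro mult_left_mono column_weight_le_1 s t) (use M in auto)
      finally have "(\<Sum>j\<in>I. \<Phi> (W * c j) (h * d j)) \<le> \<Phi> W h" by simp
      moreover have "h * d j \<le> W * c j" if "j \<in> I" for j
        by (rule mult_mono) (use Wh hor[OF that] ratio[OF that] in auto)
      ultimately show "(\<forall>j\<in>I. h * d j \<le> W * c j) \<and> (\<Sum>j\<in>I. \<Phi> (W * c j) (h * d j)) \<le> \<Phi> W h"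
        by blast
    next
      fix W h m assume Wh: "(W::real) > 0" "h > 0" "h \<le> W" and m: "m \<in> K"
      have "(\<Sum>j\<in>col m. \<Phi> W (h * d j)) = \<Phi> W h * (\<Sum>j\<in>col m. d j powr t)"
        using scaled_potential_sum[of W "\<lambda>_. 1" r s h d t "col m"]
        unfolding \<Phi>_def by (simp flip: sum_distrib_left)
      also have "\<dots> \<le> \<Phi> W h * 1"
        unfolding \<Phi>_def by (intro mult_left_mono t m) (use M in auto)
      finally have "(\<Sum>j\<in>col m. \<Phi> W (h * d j)) \<le> \<Phi> W h" by simp
      moreover have "h * d j \<le> W" if "j \<in> col m" for j
      proof -
        have "d j \<le> 1" using ratio[of j] that by (auto simp: col_def)
        then have "h * d j \<le> h * 1" using Wh by (intro mult_left_mono) auto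
        then show ?thesis using Wh by linarith
      qed
      ultimately show "(\<forall>j\<in>col m. h * d j \<le> W) \<and> (\<Sum>j\<in>col m. \<Phi> W (h * d j)) \<le> \<Phi> W h" by blast
    qed (use \<kappa> \<delta> r W h \<kappa>h n in auto)
    also have "\<dots> \<le> M * ((1 / \<kappa>) powr (s + t) * (R / r) powr (s + t))"
      unfolding \<Phi>_def using M \<kappa> r h \<kappa>h W strip_width_pos[OF W(2)] s t
      by (intro mult_left_mono potential_le) auto
    finally show ?thesis by simp
  qed
  moreover have "M * (1 / \<kappa>) powr (s + t) > 0" using M \<kappa> by simp
  ultimately show ?thesis unfolding strip_regular_def by blast
qed

end


section \<open>Approximate squares\<close>

text \<open>
  The cell \<open>Q\<close> is a rectangle with both sides comparable with \<open>R\<close>, and its piece obeys the Assouad bound relative to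
  the scale \<open>R\<close>.
\<close>

definition approx_square ::
    "real \<Rightarrow> real \<Rightarrow> real \<Rightarrow> real \<Rightarrow> (real \<times> real) set \<Rightarrow> (real \<times> real) set \<Rightarrow> bool" where
  "approx_square \<kappa> M \<alpha> R P Q \<longleftrightarrow>
     (\<exists>x y w h. P \<subseteq> {x..x + w} \<times> {y..y + h} \<and> Q = {x<..<x + w} \<times> {y<..<y + h}
        \<and> \<kappa> * R \<le> w \<and> \<kappa> * w \<le> R \<and> \<kappa> * R \<le> h \<and> \<kappa> * h \<le> R)
     \<and> (\<forall>r. 0 < r \<longrightarrow> r < R \<longrightarrow> covering_number r P \<le> M * (R / r) powr \<alpha>)"

lemma rectangle_eq_box: "{x<..<x'} \<times> {y<..<y'} = box (x, y) (x' :: real, y' :: real)"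
  by (auto simp: mem_box Basis_prod_def ball_Un)

lemma rectangle_eq_cbox: "{x..x'} \<times> {y..y'} = cbox (x, y) (x' :: real, y' :: real)"
  by (simp add: cbox_Pair_eq)

lemma measure_rectangle:
  assumes "0 \<le> w" "0 \<le> h"
  shows "measure lebesgue ({x<..<x + w} \<times> {y<..<y + h :: real}) = w * (h :: real)"
    and "measure lebesgue ({x..x + w} \<times> {y..y + h}) = w * h"
    and "{x<..<x + w} \<times> {y<..<y + h} \<in> lmeasurable"
    and "{x..x + w} \<times> {y..y + h} \<in> lmeasurable"
proof -
  have c: "measure lborel (cbox (x, y) (x + w, y + h)) = w * h"
    using assms by (simp add: content_Pair)
  then show "measure lebesgue ({x..x + w} \<times> {y..y + h}) = w * h"
    by (simp add: rectangle_eq_cbox)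
  have "measure lborel (box (x, y) (x + w, y + h)) = measure lborel (cbox (x, y) (x + w, y + h))"
    by (simp only: measure_lborel_box_eq measure_lborel_cbox_eq)
  then show "measure lebesgue ({x<..<x + w} \<times> {y<..<y + h}) = w * h"
    using c by (simp add: rectangle_eq_box)
  show "{x<..<x + w} \<times> {y<..<y + h} \<in> lmeasurable" "{x..x + w} \<times> {y..y + h} \<in> lmeasurable"
    unfolding rectangle_eq_box rectangle_eq_cbox by auto
qed

lemma approx_square_swap:
  assumes "approx_square \<kappa> M \<alpha> R P Q" "bounded P"
  shows "approx_square \<kappa> M \<alpha> R (prod.swap ` P) (prod.swap ` Q)"
proof -
  obtain x y w h where "P \<subseteq> {x..x + w} \<times> {y..y + h}" "Q = {x<..<x + w} \<times> {y<..<y + h}"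
      and wh: "\<kappa> * R \<le> w" "\<kappa> * w \<le> R" "\<kappa> * R \<le> h" "\<kappa> * h \<le> R"
    using assms(1) unfolding approx_square_def by blast
  then have "prod.swap ` P \<subseteq> {y..y + h} \<times> {x..x + w}" "prod.swap ` Q = {y<..<y + h} \<times> {x<..<x + w}"
    by (auto simp: product_swap)
  then have "\<exists>x y w h. prod.swap ` P \<subseteq> {x..x + w} \<times> {y..y + h} \<and> prod.swap ` Q = {x<..<x + w} \<times> {y<..<y + h}
        \<and> \<kappa> * R \<le> w \<and> \<kappa> * w \<le> R \<and> \<kappa> * R \<le> h \<and> \<kappa> * h \<le> R"
    using wh by blast
  then show ?thesis
    using assms unfolding approx_square_def by (simp add: covering_number_swap)
qed

lemma approx_square_bounded: "approx_square \<kappa> M \<alpha> R P Q \<Longrightarrow> bounded P"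
  unfolding approx_square_def rectangle_eq_cbox using bounded_cbox bounded_subset by blast

lemma approx_square_mono:
  assumes "approx_square \<kappa> M \<alpha> R P Q" "M \<le> M'"
  shows "approx_square \<kappa> M' \<alpha> R P Q"
proof -
  have "covering_number r P \<le> M' * (R / r) powr \<alpha>" if "0 < r" "r < R" for r
  proof -
    have "real (covering_number r P) \<le> M * (R / r) powr \<alpha>" using assms(1) that by (simp add: approx_square_def)
    also have "\<dots> \<le> M' * (R / r) powr \<alpha>" using assms(2) by (intro mult_right_mono) auto
    finally show ?thesis .
  qed
  then show ?thesis using assms(1) unfolding approx_square_def by blast
qed

lemma tiling_mono:
  assumes "tiling T E B good" "\<And>P Q. good P Q \<Longrightarrow> good' P Q"
  shows "tiling T E B good'"
  using assms unfolding tiling_def by simp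

text \<open>
  A ball of radius \<open>R\<close> meets only boundedly many approximate squares of side about \<open>R\<close>: their cells are disjoint, have area at least
  \<open>(\<kappa> R)\<^sup>2\<close> and lie in a square of side \<open>2 (1 + 1/\<kappa>) R\<close>.
\<close>

lemma assouad_exponent_of_tilings:
  assumes \<kappa>: "\<kappa> > 0" and M: "M > 0"
    and tilings: "\<And>R. 0 < R \<Longrightarrow> R \<le> 1 \<Longrightarrow> \<exists>T B. tiling T F B (approx_square \<kappa> M \<alpha> R)"
  shows "assouad_exponent F \<alpha>"
proof -
  define L where "L = 1 + 1 / \<kappa>"
  have L: "L > 0" using \<kappa> by (simp add: L_def add_pos_pos)
  define C where "C = (2 * L) * (2 * L) / (\<kappa> * \<kappa>)"
  have C: "C > 0" using L \<kappa> by (simp add: C_def)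
  have "real (covering_number r (cball z R \<inter> F)) \<le> (C * M) * (R / r) powr \<alpha>"
    if r: "0 < r" "r < R" "R \<le> 1" for r R z
  proof -
    have R: "0 < R" using r by simp
    obtain T B where T: "tiling T F B (approx_square \<kappa> M \<alpha> R)" using tilings[OF R r(3)] by blast
    define T' where "T' = {t\<in>T. fst t \<inter> cball z R \<noteq> {}}"
    have fin: "finite T'" using T by (simp add: tiling_def T'_def)
    have sq: "approx_square \<kappa> M \<alpha> R (fst t) (snd t)" if "t \<in> T'" for t
      using tilingD(3)[OF T] that by (simp add: T'_def)
    have "F \<subseteq> (\<Union>t\<in>T. fst t)" using T by (simp add: tiling_def)
    then have "cball z R \<inter> F \<subseteq> (\<Union>t\<in>T'. fst t)" unfolding T'_def by blast
    moreover have "bounded (\<Union>t\<in>T'. fst t)" using fin sq approx_square_bounded by blast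
    ultimately have "covering_number r (cball z R \<inter> F) \<le> covering_number r (\<Union>t\<in>T'. fst t)"
      using r by (intro covering_number_mono) auto
    also have "\<dots> \<le> (\<Sum>t\<in>T'. covering_number r (fst t))"
      by (rule covering_number_UN[OF fin approx_square_bounded[OF sq] r(1)])
    finally have "real (covering_number r (cball z R \<inter> F)) \<le> (\<Sum>t\<in>T'. real (covering_number r (fst t)))"
      by (simp flip: of_nat_sum)
    also have "\<dots> \<le> (\<Sum>t\<in>T'. M * (R / r) powr \<alpha>)"
      using sq r by (intro sum_mono) (simp add: approx_square_def)
    finally have 1: "real (covering_number r (cball z R \<inter> F)) \<le> card T' * (M * (R / r) powr \<alpha>)" by simp
    \<comment> \<open>A cell meeting the ball extends at most one further side length \<open>R / \<kappa>\<close> beyond it.\<close>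
    have LR: "R + R / \<kappa> = L * R" using \<kappa> by (simp add: L_def field_simps)
    let ?Z = "{fst z - L * R..(fst z - L * R) + 2 * (L * R)} \<times> {snd z - L * R..(snd z - L * R) + 2 * (L * R)}"
    have "real (card T') * ((\<kappa> * R) * (\<kappa> * R)) \<le> measure lebesgue ?Z"
    proof (rule card_le_of_disjoint_measure[where Q=snd])
      show "finite T'" by (rule fin)
      show "disjoint_family_on snd T'"
        using T unfolding tiling_def disjoint_family_on_def T'_def by blast
      show "?Z \<in> lmeasurable" using L R by (intro measure_rectangle(4)) auto
      fix t assume t: "t \<in> T'"
      obtain x y w h where xy: "fst t \<subseteq> {x..x + w} \<times> {y..y + h}" "snd t = {x<..<x + w} \<times> {y<..<y + h}"
          and wh: "\<kappa> * R \<le> w" "\<kappa> * w \<le> R" "\<kappa> * R \<le> h" "\<kappa> * h \<le> R"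
        using sq[OF t] unfolding approx_square_def by blast
      have pos: "0 < \<kappa> * R" using \<kappa> R by simp
      have wh0: "0 \<le> w" "0 \<le> h" using wh pos by linarith+
      show "snd t \<in> lmeasurable" unfolding xy(2) by (rule measure_rectangle(3)[OF wh0])
      show "(\<kappa> * R) * (\<kappa> * R) \<le> measure lebesgue (snd t)"
        unfolding xy(2) measure_rectangle(1)[OF wh0] using wh pos by (intro mult_mono) auto
      obtain v where v: "v \<in> fst t" "dist z v \<le> R" using t by (auto simp: T'_def)
      have "\<bar>fst z - fst v\<bar> \<le> R" "\<bar>snd z - snd v\<bar> \<le> R"
        using v(2) dist_fst_le[of z v] dist_snd_le[of z v] by (auto simp: dist_real_def)
      moreover have "w \<le> R / \<kappa>" "h \<le> R / \<kappa>" using wh \<kappa> by (auto simp: field_simps)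
      moreover have "x \<le> fst v" "fst v \<le> x + w" "y \<le> snd v" "snd v \<le> y + h"
        using v(1) xy(1) by (auto simp: mem_Times_iff)
      ultimately have "fst z - L * R \<le> x" "x + w \<le> fst z + L * R" "snd z - L * R \<le> y" "y + h \<le> snd z + L * R"
        unfolding LR[symmetric] by linarith+
      then show "snd t \<subseteq> ?Z" unfolding xy(2) by (intro Sigma_mono) auto
    qed
    also have "\<dots> = (2 * (L * R)) * (2 * (L * R))" using L R by (intro measure_rectangle(2)) auto
    finally have "real (card T') \<le> C"
      using \<kappa> R by (simp add: C_def field_simps)
    then have "card T' * (M * (R / r) powr \<alpha>) \<le> C * (M * (R / r) powr \<alpha>)"
      using M by (intro mult_right_mono) auto
    with 1 show ?thesis by (simp add: mult.assoc)
  qed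
  then show ?thesis unfolding assouad_exponent_def
    using C M by (intro exI[of _ "C * M"] exI[of _ 1]) auto
qed

context column_system
begin

text \<open>
  Apply the maps until one side is at most \<open>R\<close>; both sides are then still at least \<open>\<kappa> * R\<close>. The rectangles obtained
  are flat or tall, and are handed over to \<open>leaf\<close>.
\<close>

lemma free_tiling:
  fixes G :: "real \<Rightarrow> real \<Rightarrow> bool"
  assumes R: "R > 0" and \<kappa>\<delta>: "\<kappa> > 0" "\<forall>i\<in>I. \<kappa> \<le> c i \<and> \<kappa> \<le> d i \<and> d i \<le> \<delta>"
    and G: "\<And>W h i. W > 0 \<Longrightarrow> h > 0 \<Longrightarrow> G W h \<Longrightarrow> i \<in> I \<Longrightarrow> G (W * c i) (h * d i)"
    and leaf: "\<And>W h p q. W > 0 \<Longrightarrow> h > 0 \<Longrightarrow> G W h \<Longrightarrow> \<kappa> * R \<le> W \<Longrightarrow> \<kappa> * R \<le> h \<Longrightarrow> W \<le> R \<or> h \<le> R \<Longrightarrow>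
      \<exists>T. tiling T (diag_affine W h p q ` F) ({p<..<p + W} \<times> {q<..<q + h}) good"
    and W: "W > 0" "h > 0" "G W h" "\<kappa> * R \<le> W" "\<kappa> * R \<le> h" "h * \<delta> ^ n \<le> R"
  shows "\<exists>T. tiling T (diag_affine W h p q ` F) ({p<..<p + W} \<times> {q<..<q + h}) good"
  using W
proof (induction n arbitrary: W h p q)
  case 0
  then show ?case by (intro leaf) auto
next
  case (Suc n)
  show ?case
  proof (cases "W \<le> R \<or> h \<le> R")
    case True
    then show ?thesis using Suc.prems by (intro leaf) auto
  next
    case False
    let ?E = "\<lambda>j. diag_affine (W * c j) (h * d j) (W * a j + p) (h * b j + q) ` F"
    let ?B = "\<lambda>j. {W * a j + p<..<W * a j + p + W * c j} \<times> {h * b j + q<..<h * b j + q + h * d j}"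
    have "\<forall>j\<in>I. \<exists>T. tiling T (?E j) (?B j) good"
    proof
      fix j assume j: "j \<in> I"
      have rj: "0 < c j" "0 < d j" "\<kappa> \<le> c j" "\<kappa> \<le> d j" "d j \<le> \<delta>" using ratio[OF j] \<kappa>\<delta> j by auto
      show "\<exists>T. tiling T (?E j) (?B j) good"
      proof (rule Suc.IH)
        show "W * c j > 0" "h * d j > 0" using rj Suc.prems by auto
        show "G (W * c j) (h * d j)" by (intro G Suc.prems j)
        have "R * \<kappa> \<le> W * c j" "R * \<kappa> \<le> h * d j" using False rj R \<kappa>\<delta>(1) by (intro mult_mono; simp)+
        then show "\<kappa> * R \<le> W * c j" "\<kappa> * R \<le> h * d j" by (simp_all add: mult.commute)
        have "(h * \<delta> ^ n) * d j \<le> (h * \<delta> ^ n) * \<delta>"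
          using rj Suc.prems by (intro mult_left_mono) auto
        then show "h * d j * \<delta> ^ n \<le> R" using Suc.prems(6) by (simp add: mult_ac)
      qed
    qed
    from bchoice[OF this] obtain T where T: "\<And>j. j \<in> I \<Longrightarrow> tiling (T j) (?E j) (?B j) good" by blast
    have sub: "?B j \<subseteq> {p<..<p + W} \<times> {q<..<q + h}" if j: "j \<in> I" for j
    proof -
      have "0 \<le> W * a j" "0 \<le> h * b j" using inside[OF j] Suc.prems by auto
      moreover have "W * (a j + c j) \<le> W * 1" "h * (b j + d j) \<le> h * 1"
        using inside[OF j] Suc.prems(1,2) by (intro mult_left_mono; simp)+
      then have "W * a j + W * c j \<le> W" "h * b j + h * d j \<le> h" by (simp_all add: distrib_left)
      ultimately show ?thesis by (intro Sigma_mono) auto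
    qed
    have dis: "disjoint_family_on ?B I"
      unfolding disjoint_family_on_def
    proof (intro ballI impI)
      fix i j assume ij: "i \<in> I" "j \<in> I" "i \<noteq> j"
      show "?B i \<inter> ?B j = {}"
      proof (cases "k i = k j")
        case True
        from column_apart[OF ij(1,2) True ij(3)] have "h * (b i + d i) \<le> h * b j \<or> h * (b j + d j) \<le> h * b i"
          using Suc.prems(2) by simp
        then have "h * b i + h * d i \<le> h * b j \<or> h * b j + h * d j \<le> h * b i" by (simp add: distrib_left)
        then show ?thesis by auto
      next
        case False
        from columns_apart[OF ij(1,2) False] have "W * (a i + c i) \<le> W * a j \<or> W * (a j + c j) \<le> W * a i"
          using Suc.prems(1) by simp
        then have "W * a i + W * c i \<le> W * a j \<or> W * a j + W * c j \<le> W * a i" by (simp add: distrib_left)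
        then show ?thesis by auto
      qed
    qed
    have "diag_affine W h p q ` F = diag_affine W h p q ` (\<Union>j\<in>I. S j ` F)"
      by (rule arg_cong[OF F(3)])
    also have "\<dots> = (\<Union>j\<in>I. diag_affine W h p q ` S j ` F)" by blast
    also have "\<dots> = (\<Union>j\<in>I. ?E j)" by (simp add: image_image diag_affine_compose)
    finally have eq: "diag_affine W h p q ` F = (\<Union>j\<in>I. ?E j)" .
    show ?thesis unfolding eq using tiling_UN(1)[OF I(1) T sub dis] by blast
  qed
qed

text \<open>
  Combines \<open>strip_tiling\<close> with the covering estimate \<open>strip_regular\<close> for the strips that it produces.
\<close>

lemma flat_rectangle_tiling:
  assumes reg: "strip_regular \<kappa> \<alpha>" and \<kappa>: "0 < \<kappa>" "\<kappa> \<le> 1" "\<forall>i\<in>I. \<kappa> \<le> c i"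
  shows "\<exists>M>0. \<forall>R W h p q. 0 < R \<longrightarrow> 0 < W \<longrightarrow> \<kappa> * R \<le> h \<longrightarrow> h \<le> R \<longrightarrow> h \<le> W \<longrightarrow>
    (\<exists>T. tiling T (diag_affine W h p q ` F) ({p<..<p + W} \<times> {q<..<q + h}) (approx_square \<kappa> M \<alpha> R))"
proof -
  from reg obtain M where M: "M > 0" and cov: "\<forall>r R W h p q ms. 0 < r \<longrightarrow> r < R \<longrightarrow> W > 0 \<longrightarrow> set ms \<subseteq> K \<longrightarrow>
    \<kappa> * R \<le> h \<longrightarrow> h \<le> R \<longrightarrow> h \<le> W * strip_width ms \<longrightarrow> \<kappa> * (W * strip_width ms) \<le> h \<longrightarrow>
    covering_number r (diag_affine W h p q ` strip ms) \<le> M * (R / r) powr \<alpha>"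
    unfolding strip_regular_def by (elim exE conjE)
  have "\<exists>\<delta>. 0 < \<delta> \<and> \<delta> < 1 \<and> (\<forall>m\<in>K. cc m \<le> \<delta>)"
    by (rule base.ratio_bounds) blast
  then obtain \<delta> where \<delta>: "0 < \<delta>" "\<delta> < 1" "\<forall>m\<in>K. cc m \<le> \<delta>" by blast
  have \<kappa>\<delta>: "\<forall>m\<in>K. \<kappa> \<le> cc m \<and> cc m \<le> \<delta>" using \<kappa>(3) \<delta>(3) column by auto
  have "\<exists>T. tiling T (diag_affine W h p q ` F) ({p<..<p + W} \<times> {q<..<q + h}) (approx_square \<kappa> M \<alpha> R)"
    if R: "0 < R" and W: "0 < W" and h: "\<kappa> * R \<le> h" "h \<le> R" "h \<le> W" for R W h p q
  proof -
    have h0: "0 < h" using h(1) mult_pos_pos[OF \<kappa>(1) R] by linarith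
    obtain n where n: "\<kappa> * (W * strip_width []) * \<delta> ^ n \<le> h"
      using power_mult_le_of_lt_1[OF \<delta>(1,2) h0, of "\<kappa> * (W * strip_width [])"] \<kappa> W by auto
    have "\<exists>T. tiling T (diag_affine W h p q ` strip [])
        ({W * strip_left [] + p<..<W * strip_left [] + p + W * strip_width []} \<times> {q<..<q + h}) (approx_square \<kappa> M \<alpha> R)"
    proof (rule strip_tiling[OF W h0 \<kappa>(1) \<kappa>\<delta> _ _ _ n])
      fix ms assume ms: "set ms \<subseteq> K" "h \<le> W * strip_width ms" "\<kappa> * (W * strip_width ms) \<le> h"
      have "\<kappa> * h \<le> 1 * R" by (rule mult_mono) (use \<kappa> h h0 in auto)
      then have 1: "\<kappa> * R \<le> W * strip_width ms" "\<kappa> * (W * strip_width ms) \<le> R" "\<kappa> * R \<le> h" "\<kappa> * h \<le> R"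
        using h ms by linarith+
      have "covering_number r (diag_affine W h p q ` strip ms) \<le> M * (R / r) powr \<alpha>"
        if "0 < r" "r < R" for r
        by (rule cov[rule_format, OF that W ms(1) h(1,2) ms(2,3)])
      then show "approx_square \<kappa> M \<alpha> R (diag_affine W h p q ` strip ms)
          ({W * strip_left ms + p<..<W * strip_left ms + p + W * strip_width ms} \<times> {q<..<q + h})"
        unfolding approx_square_def using strip_in_rectangle[OF W h0 ms(1)] 1 by blast
    qed (use h in auto)
    then show ?thesis by simp
  qed
  then show ?thesis using M by blast
qed

lemma common_bounds:
  obtains \<kappa> \<delta> where "0 < \<kappa>" "\<kappa> \<le> 1" "0 < \<delta>" "\<delta> < 1" "\<forall>i\<in>I. \<kappa> \<le> c i \<and> \<kappa> \<le> d i \<and> d i \<le> \<delta>"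
proof -
  obtain \<kappa>1 \<delta>1 :: real where 1: "0 < \<kappa>1" "\<kappa>1 < 1" "\<forall>i\<in>I. \<kappa>1 \<le> c i"
    using uniform_bounds[of I c] I ratio by metis
  obtain \<kappa>2 \<delta>2 :: real where 2: "0 < \<kappa>2" "\<kappa>2 < 1" "0 < \<delta>2" "\<delta>2 < 1" "\<forall>i\<in>I. \<kappa>2 \<le> d i \<and> d i \<le> \<delta>2"
    using uniform_bounds[of I d] I ratio by metis
  show ?thesis by (rule that[of "min \<kappa>1 \<kappa>2" \<delta>2]) (use 1 2 in \<open>auto simp: min_le_iff_disj\<close>)
qed

theorem assouad_exponent_horizontal:
  assumes hor: "\<And>i. i \<in> I \<Longrightarrow> d i \<le> c i" and s: "s \<ge> 0" "(\<Sum>m\<in>K. cc m powr s) = 1"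
    and t: "t \<ge> 0" "\<And>m. m \<in> K \<Longrightarrow> (\<Sum>j\<in>col m. d j powr t) \<le> 1"
  shows "assouad_exponent F (s + t)"
proof -
  obtain \<kappa> \<delta> where \<kappa>\<delta>: "0 < \<kappa>" "\<kappa> \<le> 1" "0 < \<delta>" "\<delta> < 1" "\<forall>i\<in>I. \<kappa> \<le> c i \<and> \<kappa> \<le> d i \<and> d i \<le> \<delta>"
    by (rule common_bounds)
  have "strip_regular \<kappa> (s + t)"
    by (rule strip_regular_horizontal[OF hor s t \<kappa>\<delta>(1,2)]) (use \<kappa>\<delta>(5) in auto)
  then obtain M where M: "M > 0" and flat: "\<And>R W h p q. 0 < R \<Longrightarrow> 0 < W \<Longrightarrow> \<kappa> * R \<le> h \<Longrightarrow> h \<le> R \<Longrightarrow> h \<le> W \<Longrightarrow>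
    (\<exists>T. tiling T (diag_affine W h p q ` F) ({p<..<p + W} \<times> {q<..<q + h}) (approx_square \<kappa> M (s + t) R))"
    using flat_rectangle_tiling[of \<kappa> "s + t", OF _ \<kappa>\<delta>(1,2)] \<kappa>\<delta>(5) by blast
  show ?thesis
  proof (rule assouad_exponent_of_tilings[OF \<kappa>\<delta>(1) M])
    fix R :: real assume R: "0 < R" "R \<le> 1"
    obtain n where n: "1 * \<delta> ^ n \<le> R" using power_mult_le_of_lt_1[OF \<kappa>\<delta>(3,4) R(1), of 1] by auto
    have \<kappa>R: "\<kappa> * R \<le> 1" using \<kappa>\<delta> R by (simp add: mult_le_one)
    have "\<exists>T. tiling T (diag_affine 1 1 0 0 ` F) ({0<..<0 + 1} \<times> {0<..<0 + 1}) (approx_square \<kappa> M (s + t) R)"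
    proof (rule free_tiling[where G="\<lambda>W h. h \<le> W", OF R(1) \<kappa>\<delta>(1,5) _ _ _ _ _ \<kappa>R \<kappa>R n])
      fix W h :: real and i assume "W > 0" "h > 0" "h \<le> W" "i \<in> I"
      then show "h * d i \<le> W * c i" using ratio hor by (intro mult_mono) (auto intro: less_imp_le)
    next
      fix W h p q :: real assume "W > 0" "h > 0" "h \<le> W" "\<kappa> * R \<le> W" "\<kappa> * R \<le> h" "W \<le> R \<or> h \<le> R"
      then show "\<exists>T. tiling T (diag_affine W h p q ` F) ({p<..<p + W} \<times> {q<..<q + h}) (approx_square \<kappa> M (s + t) R)"
        by (intro flat R) auto
    qed auto
    moreover have "diag_affine 1 1 0 0 ` F = F" by (simp add: diag_affine_def)
    ultimately show "\<exists>T B. tiling T F B (approx_square \<kappa> M (s + t) R)" by auto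
  qed
qed

end

section \<open>Grids\<close>

lemma swap_swap_image [simp]: "prod.swap ` prod.swap ` X = X"
  by (simp add: image_image)

text \<open>
  A carpet on a grid is organised in columns in two ways, the second one after exchanging the coordinates. Every result on
  columns is therefore available for rows as well.
\<close>

locale grid_system = column_system +
  fixes l :: "'a \<Rightarrow> nat" and dd bb :: "nat \<Rightarrow> real"
  assumes rows: "column_system I d c b a (prod.swap ` F) l dd bb"
begin

sublocale rows: column_system I d c b a "prod.swap ` F" l dd bb
  by (rule rows)

lemma grid_swap: "grid_system I d c b a (prod.swap ` F) l dd bb k cc aa"
  by (simp add: grid_system_def grid_system_axioms_def rows column_system_axioms)

text \<open>
  Different rectangles of a column lie in different rows, so their heights are among the row heights, each occurring
  at most once.
\<close>

lemma column_weight_rows_le_1: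
  assumes s: "(\<Sum>m\<in>l ` I. dd m powr s) = 1" and m: "m \<in> K"
  shows "(\<Sum>j\<in>col m. d j powr s) \<le> 1"
proof -
  have inj: "inj_on l (col m)"
  proof (rule inj_onI, rule ccontr)
    fix i j assume ij: "i \<in> col m" "j \<in> col m" "l i = l j" "i \<noteq> j"
    then have I': "i \<in> I" "j \<in> I" "k i = k j" by (auto simp: col_def)
    have "d i = d j" "b i = b j" using rows.column I' ij(3) by auto
    then show False using column_apart[OF I' ij(4)] ratio[OF I'(1)] by auto
  qed
  have "(\<Sum>j\<in>col m. d j powr s) = (\<Sum>j\<in>col m. dd (l j) powr s)"
    using rows.column by (intro sum.cong) (auto simp: col_def)
  also have "\<dots> = (\<Sum>n\<in>l ` col m. dd n powr s)" by (simp add: sum.reindex[OF inj])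
  also have "\<dots> \<le> (\<Sum>n\<in>l ` I. dd n powr s)"
    by (rule sum_mono2) (use I in \<open>auto simp: col_def\<close>)
  finally show ?thesis using s by simp
qed

text \<open>
  The potential is the sum of \<open>f1 W h = (W/r)\<^bsup>s1\<^esup> (h/r)\<^bsup>e1\<^esup>\<close> and \<open>f2 W h = (h/r)\<^bsup>s2\<^esup> (W/r)\<^bsup>e2\<^esup>\<close>. Under free
  subdivision each term is handled by \<open>column_weight_le_1\<close>, for columns and for rows respectively. In a prescribed column the width is
  constant, and \<open>f1\<close> needs the exponent \<open>e1\<close> of the slices while \<open>f2\<close> needs \<open>column_weight_rows_le_1\<close>.
  A final flat piece is paid for by \<open>f1\<close>, a final tall piece by \<open>f2\<close>.
\<close>

lemma strip_regular_grid:
  assumes s1: "s1 \<ge> 0" "(\<Sum>m\<in>K. cc m powr s1) = 1" and s2: "s2 \<ge> 0" "(\<Sum>m\<in>l ` I. dd m powr s2) = 1"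
    and e1: "e1 \<ge> 0" "\<And>m. m \<in> K \<Longrightarrow> (\<Sum>j\<in>col m. d j powr e1) \<le> 1"
    and e2: "e2 \<ge> 0" "\<And>m. m \<in> l ` I \<Longrightarrow> (\<Sum>j\<in>rows.col m. c j powr e2) \<le> 1"
    and \<alpha>: "s1 + e1 = \<alpha>" "s2 + e2 = \<alpha>"
    and \<kappa>: "0 < \<kappa>" "\<kappa> \<le> 1" "\<forall>i\<in>I. \<kappa> \<le> c i \<and> \<kappa> \<le> d i"
  shows "strip_regular \<kappa> \<alpha>"
proof -
  obtain M1 where M1: "M1 > 0" and flat1: "\<And>r w h p q Z. r > 0 \<Longrightarrow> \<kappa> * r / 4 \<le> w \<Longrightarrow> \<kappa> * r / 4 \<le> h \<Longrightarrow> h \<le> r / 4 \<Longrightarrow>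
      bounded Z \<Longrightarrow> fst ` Z \<subseteq> (\<lambda>x. w * x + p) ` fst ` F \<Longrightarrow> snd ` Z \<subseteq> {q..q + h} \<Longrightarrow>
      covering_number r Z \<le> M1 * ((w / r) powr s1 * (h / r) powr e1)"
    using flat_covering[OF s1 e1(1) \<kappa>(1)] by blast
  obtain M2 where M2: "M2 > 0" and flat2: "\<And>r w h p q Z. r > 0 \<Longrightarrow> \<kappa> * r / 4 \<le> w \<Longrightarrow> \<kappa> * r / 4 \<le> h \<Longrightarrow> h \<le> r / 4 \<Longrightarrow>
      bounded Z \<Longrightarrow> fst ` Z \<subseteq> (\<lambda>x. w * x + p) ` fst ` prod.swap ` F \<Longrightarrow> snd ` Z \<subseteq> {q..q + h} \<Longrightarrow>
      covering_number r Z \<le> M2 * ((w / r) powr s2 * (h / r) powr e2)"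
    using rows.flat_covering[OF s2 e2(1) \<kappa>(1)] by blast
  define M where "M = M1 + M2"
  have M: "M > 0" "M1 \<le> M" "M2 \<le> M" using M1 M2 by (auto simp: M_def)
  obtain \<kappa>' \<delta> :: real where \<delta>: "0 < \<delta>" "\<delta> < 1" "\<forall>j\<in>I. d j \<le> \<delta>"
    using uniform_bounds[of I d] I ratio by metis
  have "covering_number r (diag_affine W h p q ` strip ms) \<le> (M * (2 * (1 / \<kappa>) powr \<alpha>)) * (R / r) powr \<alpha>"
    if r: "0 < r" "r < R" and W: "W > 0" "set ms \<subseteq> K" and h: "\<kappa> * R \<le> h" "h \<le> R" "h \<le> W * strip_width ms"
      "\<kappa> * (W * strip_width ms) \<le> h" for r R W h p q ms
  proof -
    have \<kappa>r: "\<kappa> * r \<le> \<kappa> * R" "0 < \<kappa> * r" using r \<kappa> by simp_all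
    then have \<kappa>h: "\<kappa> * r / 4 \<le> h" "0 < h" using h by linarith+
    obtain n where n: "h * \<delta> ^ n \<le> r / 4" using power_mult_le_of_lt_1[OF \<delta>(1,2), of "r / 4" h] r \<kappa>h by auto
    define f1 where "f1 W h = (W / r) powr s1 * (h / r) powr e1" for W h
    define f2 where "f2 W h = (h / r) powr s2 * (W / r) powr e2" for W h
    define \<Phi> where "\<Phi> W h = M * (f1 W h + f2 W h)" for W h
    have nonneg: "f1 W h \<ge> 0" "f2 W h \<ge> 0" for W h by (auto simp: f1_def f2_def)
    have "real (covering_number r (diag_affine W h p q ` strip ms)) \<le> \<Phi> (W * strip_width ms) h"
    proof (rule strip_covering[where G="\<lambda>_ _. True" and \<kappa>=\<kappa> and \<delta>=\<delta>])
      fix W h p q ms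
      assume W: "W > 0" "set ms \<subseteq> K" and w: "\<kappa> * r / 4 \<le> W * strip_width ms"
        and h: "\<kappa> * r / 4 \<le> h" and small: "W * strip_width ms \<le> r / 4 \<or> h \<le> r / 4"
      have h0: "h > 0" using h \<kappa>r(2) by linarith
      let ?w = "W * strip_width ms"
      let ?Z = "diag_affine W h p q ` strip ms"
      from small show "real (covering_number r ?Z) \<le> \<Phi> ?w h"
      proof
        assume h4: "h \<le> r / 4"
        have "real (covering_number r ?Z) \<le> M1 * f1 ?w h"
          unfolding f1_def
          by (rule flat1[OF r(1) w h h4 bounded_strip equalityD1[OF fst_affine_strip[OF W(2)]] snd_affine_strip[OF W(1) h0 W(2)]])
        also have "\<dots> \<le> M * (f1 ?w h + f2 ?w h)"
          using M M1 nonneg by (intro mult_mono) auto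
        finally show ?thesis unfolding \<Phi>_def .
      next
        assume w4: "?w \<le> r / 4"
        have "snd ` ?Z = (\<lambda>y. h * y + q) ` snd ` strip ms" by (simp add: image_image)
        also have "\<dots> \<subseteq> (\<lambda>y. h * y + q) ` snd ` F" by (intro image_mono strip_subset)
        finally have 1: "fst ` prod.swap ` ?Z \<subseteq> (\<lambda>y. h * y + q) ` fst ` prod.swap ` F"
          by (simp add: image_image)
        have "fst ` ?Z \<subseteq> {W * strip_left ms + p..W * strip_left ms + p + ?w}"
          using strip_in_rectangle[OF W(1) h0 W(2), of p q] by fastforce
        then have 2: "snd ` prod.swap ` ?Z \<subseteq> {W * strip_left ms + p..W * strip_left ms + p + ?w}"
          by (simp add: image_image)
        have "covering_number r ?Z = covering_number r (prod.swap ` ?Z)"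
          by (rule covering_number_swap[OF bounded_strip r(1), symmetric])
        then have "real (covering_number r ?Z) = real (covering_number r (prod.swap ` ?Z))" by simp
        also have "\<dots> \<le> M2 * f2 ?w h"
          unfolding f2_def by (rule flat2[OF r(1) h w w4 bounded_swap[OF bounded_strip] 1 2])
        also have "\<dots> \<le> M * (f1 ?w h + f2 ?w h)"
          using M M2 nonneg by (intro mult_mono) auto
        finally show ?thesis unfolding \<Phi>_def .
      qed
    next
      fix W h :: real
      have "(\<Sum>j\<in>I. f1 (W * c j) (h * d j)) = f1 W h * (\<Sum>j\<in>I. c j powr s1 * d j powr e1)"
        unfolding f1_def by (rule scaled_potential_sum)
      also have "\<dots> \<le> f1 W h * 1"
        by (intro mult_left_mono column_weight_le_1 s1 e1 nonneg)
      finally have 1: "(\<Sum>j\<in>I. f1 (W * c j) (h * d j)) \<le> f1 W h" by simp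
      have "(\<Sum>j\<in>I. f2 (W * c j) (h * d j)) = f2 W h * (\<Sum>j\<in>I. d j powr s2 * c j powr e2)"
        unfolding f2_def by (rule scaled_potential_sum)
      also have "\<dots> \<le> f2 W h * 1"
        by (intro mult_left_mono rows.column_weight_le_1 s2 e2 nonneg)
      finally have 2: "(\<Sum>j\<in>I. f2 (W * c j) (h * d j)) \<le> f2 W h" by simp
      have "(\<Sum>j\<in>I. \<Phi> (W * c j) (h * d j)) \<le> \<Phi> W h"
        unfolding \<Phi>_def sum_distrib_left[symmetric] sum.distrib
        using 1 2 M by (intro mult_left_mono add_mono) auto
      then show "(\<forall>j\<in>I. True) \<and> (\<Sum>j\<in>I. \<Phi> (W * c j) (h * d j)) \<le> \<Phi> W h" by simp
    next
      fix W h :: real and m assume m: "m \<in> K"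
      have "(\<Sum>j\<in>col m. f1 W (h * d j)) = f1 W h * (\<Sum>j\<in>col m. d j powr e1)"
        using scaled_potential_sum[of W "\<lambda>_. 1" r s1 h d e1 "col m"] unfolding f1_def by simp
      also have "\<dots> \<le> f1 W h * 1" by (intro mult_left_mono e1 m nonneg)
      finally have 1: "(\<Sum>j\<in>col m. f1 W (h * d j)) \<le> f1 W h" by simp
      have "(\<Sum>j\<in>col m. f2 W (h * d j)) = f2 W h * (\<Sum>j\<in>col m. d j powr s2)"
        using scaled_potential_sum[of h d r s2 W "\<lambda>_. 1" e2 "col m"] unfolding f2_def by simp
      also have "\<dots> \<le> f2 W h * 1" by (intro mult_left_mono column_weight_rows_le_1 s2 m nonneg)
      finally have 2: "(\<Sum>j\<in>col m. f2 W (h * d j)) \<le> f2 W h" by simp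
      have "(\<Sum>j\<in>col m. \<Phi> W (h * d j)) \<le> \<Phi> W h"
        unfolding \<Phi>_def sum_distrib_left[symmetric] sum.distrib
        using 1 2 M by (intro mult_left_mono add_mono) auto
      then show "(\<forall>j\<in>col m. True) \<and> (\<Sum>j\<in>col m. \<Phi> W (h * d j)) \<le> \<Phi> W h" by simp
    qed (use \<kappa> \<delta> r W h \<kappa>h n in auto)
    also have "\<dots> \<le> M * ((1 / \<kappa>) powr \<alpha> * (R / r) powr \<alpha> + (1 / \<kappa>) powr \<alpha> * (R / r) powr \<alpha>)"
    proof -
      have w0: "0 < W * strip_width ms" using W strip_width_pos by simp
      have "f1 (W * strip_width ms) h \<le> (1 / \<kappa>) powr \<alpha> * (R / r) powr \<alpha>"
        unfolding f1_def \<alpha>(1)[symmetric]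
        using \<kappa> r h \<kappa>h w0 s1 e1 by (intro potential_le) auto
      moreover have "f2 (W * strip_width ms) h \<le> (1 / \<kappa>) powr \<alpha> * (R / r) powr \<alpha>"
        using potential_le[of \<kappa> r R h "W * strip_width ms" e2 s2] \<kappa> r h \<kappa>h w0 s2 e2 \<alpha>(2)
        unfolding f2_def by (simp add: mult.commute add.commute)
      ultimately show ?thesis unfolding \<Phi>_def using M by (intro mult_left_mono add_mono) auto
    qed
    finally show ?thesis by (simp add: algebra_simps)
  qed
  moreover have "M * (2 * (1 / \<kappa>) powr \<alpha>) > 0" using M \<kappa> by simp
  ultimately show ?thesis unfolding strip_regular_def by blast
qed

text \<open>
  Flat rectangles are cut by columns into approximate squares; tall ones are cut by rows, which is the same statement
  with the coordinates exchanged.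
\<close>

theorem assouad_exponent_grid:
  assumes s1: "s1 \<ge> 0" "(\<Sum>m\<in>K. cc m powr s1) = 1" and s2: "s2 \<ge> 0" "(\<Sum>m\<in>l ` I. dd m powr s2) = 1"
    and e1: "e1 \<ge> 0" "\<And>m. m \<in> K \<Longrightarrow> (\<Sum>j\<in>col m. d j powr e1) \<le> 1"
    and e2: "e2 \<ge> 0" "\<And>m. m \<in> l ` I \<Longrightarrow> (\<Sum>j\<in>rows.col m. c j powr e2) \<le> 1"
    and \<alpha>: "s1 + e1 = \<alpha>" "s2 + e2 = \<alpha>"
  shows "assouad_exponent F \<alpha>"
proof -
  obtain \<kappa> \<delta> where \<kappa>\<delta>: "0 < \<kappa>" "\<kappa> \<le> 1" "0 < \<delta>" "\<delta> < 1" "\<forall>i\<in>I. \<kappa> \<le> c i \<and> \<kappa> \<le> d i \<and> d i \<le> \<delta>"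
    by (rule common_bounds)
  have \<kappa>1: "\<forall>i\<in>I. \<kappa> \<le> c i \<and> \<kappa> \<le> d i" and \<kappa>2: "\<forall>i\<in>I. \<kappa> \<le> d i \<and> \<kappa> \<le> c i" using \<kappa>\<delta>(5) by auto
  have "strip_regular \<kappa> \<alpha>"
    by (rule strip_regular_grid[OF s1 s2 e1 e2 \<alpha> \<kappa>\<delta>(1,2) \<kappa>1])
  then obtain M1 where M1: "M1 > 0" and flat1: "\<And>R W h p q. 0 < R \<Longrightarrow> 0 < W \<Longrightarrow> \<kappa> * R \<le> h \<Longrightarrow> h \<le> R \<Longrightarrow> h \<le> W \<Longrightarrow>
    (\<exists>T. tiling T (diag_affine W h p q ` F) ({p<..<p + W} \<times> {q<..<q + h}) (approx_square \<kappa> M1 \<alpha> R))"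
    using flat_rectangle_tiling[of \<kappa> \<alpha>, OF _ \<kappa>\<delta>(1,2)] \<kappa>\<delta>(5) by blast
  have "rows.strip_regular \<kappa> \<alpha>"
    by (rule grid_system.strip_regular_grid[OF grid_swap s2 s1 e2 e1 \<alpha>(2,1) \<kappa>\<delta>(1,2) \<kappa>2])
  then obtain M2 where M2: "M2 > 0" and flat2: "\<And>R W h p q. 0 < R \<Longrightarrow> 0 < W \<Longrightarrow> \<kappa> * R \<le> h \<Longrightarrow> h \<le> R \<Longrightarrow> h \<le> W \<Longrightarrow>
    (\<exists>T. tiling T (diag_affine W h p q ` prod.swap ` F) ({p<..<p + W} \<times> {q<..<q + h}) (approx_square \<kappa> M2 \<alpha> R))"
    using rows.flat_rectangle_tiling[of \<kappa> \<alpha>, OF _ \<kappa>\<delta>(1,2)] \<kappa>\<delta>(5) by blast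
  define M where "M = M1 + M2"
  have M: "M > 0" "M1 \<le> M" "M2 \<le> M" using M1 M2 by (auto simp: M_def)
  show ?thesis
  proof (rule assouad_exponent_of_tilings[OF \<kappa>\<delta>(1) M(1)])
    fix R :: real assume R: "0 < R" "R \<le> 1"
    obtain n where n: "1 * \<delta> ^ n \<le> R" using power_mult_le_of_lt_1[OF \<kappa>\<delta>(3,4) R(1), of 1] by auto
    have \<kappa>R: "\<kappa> * R \<le> 1" using \<kappa>\<delta> R by (simp add: mult_le_one)
    have "\<exists>T. tiling T (diag_affine 1 1 0 0 ` F) ({0<..<0 + 1} \<times> {0<..<0 + 1}) (approx_square \<kappa> M \<alpha> R)"
    proof (rule free_tiling[where G="\<lambda>_ _. True", OF R(1) \<kappa>\<delta>(1,5) _ _ _ _ _ \<kappa>R \<kappa>R n])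
      fix W h p q :: real assume W: "W > 0" "h > 0" "\<kappa> * R \<le> W" "\<kappa> * R \<le> h" "W \<le> R \<or> h \<le> R"
      show "\<exists>T. tiling T (diag_affine W h p q ` F) ({p<..<p + W} \<times> {q<..<q + h}) (approx_square \<kappa> M \<alpha> R)"
      proof (cases "h \<le> W")
        case True
        then obtain T where "tiling T (diag_affine W h p q ` F) ({p<..<p + W} \<times> {q<..<q + h}) (approx_square \<kappa> M1 \<alpha> R)"
          using flat1[of R W h p q] R W by auto
        then have "tiling T (diag_affine W h p q ` F) ({p<..<p + W} \<times> {q<..<q + h}) (approx_square \<kappa> M \<alpha> R)"
          by (rule tiling_mono) (rule approx_square_mono[OF _ M(2)])
        then show ?thesis by blast
      next
        case False
        then obtain T where "tiling T (diag_affine h W q p ` prod.swap ` F) ({q<..<q + h} \<times> {p<..<p + W}) (approx_square \<kappa> M2 \<alpha> R)"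
          using flat2[of R h W q p] R W by auto
        then have "tiling T (diag_affine h W q p ` prod.swap ` F) ({q<..<q + h} \<times> {p<..<p + W})
            (\<lambda>P Q. approx_square \<kappa> M \<alpha> R (prod.swap ` P) (prod.swap ` Q))"
          by (rule tiling_mono) (rule approx_square_swap[OF approx_square_mono[OF _ M(3)] approx_square_bounded])
        from tiling_image[OF this inj_swap]
        have "\<exists>T. tiling T (prod.swap ` diag_affine h W q p ` prod.swap ` F) (prod.swap ` ({q<..<q + h} \<times> {p<..<p + W}))
            (approx_square \<kappa> M \<alpha> R)" by blast
        moreover have "prod.swap ` diag_affine h W q p ` prod.swap ` F = diag_affine W h p q ` F"
          by (simp add: image_image diag_affine_def split_beta prod.swap_def)
        ultimately show ?thesis by (simp add: product_swap)
      qed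
    qed auto
    moreover have "diag_affine 1 1 0 0 ` F = F" by (simp add: diag_affine_def)
    ultimately show "\<exists>T B. tiling T F B (approx_square \<kappa> M \<alpha> R)" by auto
  qed
qed

end


section \<open>The dimension formulae\<close>

context column_system
begin

lemma dimension_data:
  obtains s t where "s \<ge> 0" "(\<Sum>m\<in>K. cc m powr s) = 1" "has_box_dim (fst ` F) s"
    "\<forall>i\<in>I. t i \<ge> 0 \<and> (\<Sum>j\<in>col (k i). d j powr t i) = 1 \<and> has_box_dim (slice1 (S i) F) (t i)"
proof -
  obtain s where s: "s \<ge> 0" "(\<Sum>m\<in>K. cc m powr s) = 1"
    using moran_exponent_exists[OF base.K, of cc] base.ratio by metis
  have "\<forall>i\<in>I. \<exists>t. t \<ge> 0 \<and> (\<Sum>j\<in>col (k i). d j powr t) = 1 \<and> has_box_dim (slice1 (S i) F) t"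
  proof
    fix i assume i: "i \<in> I"
    have "col (k i) \<noteq> {}" using i by (auto simp: col_def)
    moreover have "\<And>j. j \<in> col (k i) \<Longrightarrow> 0 < d j \<and> d j < 1" using ratio by (simp add: col_def)
    ultimately obtain t where "t \<ge> 0" "(\<Sum>j\<in>col (k i). d j powr t) = 1"
      using moran_exponent_exists[OF finite_col, of "k i" d] by metis
    then show "\<exists>t. t \<ge> 0 \<and> (\<Sum>j\<in>col (k i). d j powr t) = 1 \<and> has_box_dim (slice1 (S i) F) t"
      using slice_box_dim[OF i] by blast
  qed
  from bchoice[OF this] obtain t where
    "\<forall>i\<in>I. t i \<ge> 0 \<and> (\<Sum>j\<in>col (k i). d j powr t i) = 1 \<and> has_box_dim (slice1 (S i) F) (t i)" ..
  then show ?thesis using that[OF s base.box_dim[OF s]] by blast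
qed

lemma column_sum_le_1:
  assumes t: "\<forall>i\<in>I. (\<Sum>j\<in>col (k i). d j powr t i) = 1" and u: "\<And>i. i \<in> I \<Longrightarrow> t i \<le> u" and m: "m \<in> K"
  shows "(\<Sum>j\<in>col m. d j powr u) \<le> 1"
proof -
  obtain i where i: "i \<in> I" "m = k i" using m by blast
  have "(\<Sum>j\<in>col m. d j powr u) \<le> (\<Sum>j\<in>col m. d j powr t i)"
    using ratio u[OF i(1)] by (intro sum_mono powr_mono') (auto simp: col_def less_imp_le)
  then show ?thesis using t i by simp
qed

text \<open>
  The upper bound uses the largest slice dimension \<open>u\<close>, for which every column sum is at most 1. The lower bound
  needs just one map that is strictly wider than high.
\<close>

theorem horizontal_dimension:
  assumes hor: "\<And>i. i \<in> I \<Longrightarrow> d i \<le> c i" and strict: "\<exists>i\<in>I. c i \<noteq> d i"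
  shows "box_dim_exists (fst ` F) \<and> (\<forall>i\<in>I. box_dim_exists (slice1 (S i) F))
    \<and> assouad_dim F = box_dim (fst ` F) + (MAX i\<in>I. box_dim (slice1 (S i) F))"
proof -
  obtain s t where s: "s \<ge> 0" "(\<Sum>m\<in>K. cc m powr s) = 1" and bs: "has_box_dim (fst ` F) s"
    and t: "\<forall>i\<in>I. t i \<ge> 0 \<and> (\<Sum>j\<in>col (k i). d j powr t i) = 1 \<and> has_box_dim (slice1 (S i) F) (t i)"
    by (rule dimension_data)
  obtain i0 where i0: "i0 \<in> I" "d i0 < c i0" using strict hor by (metis order_le_less)
  define u where "u = (MAX i\<in>I. box_dim (slice1 (S i) F))"
  have dim: "box_dim (slice1 (S i) F) = t i" if "i \<in> I" for i using t that box_dim_eqI by blast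
  have "u \<in> (\<lambda>i. box_dim (slice1 (S i) F)) ` I" unfolding u_def using I by (intro Max_in) auto
  then obtain i1 where i1: "i1 \<in> I" "u = t i1" using dim by auto
  have le: "t i \<le> u" if "i \<in> I" for i
    unfolding u_def dim[OF that, symmetric] using I that by (intro Max_ge) auto
  have "assouad_dim F = s + u"
  proof (rule assouad_dim_eqI)
    show "assouad_exponent F (s + u)"
    proof (rule assouad_exponent_horizontal[OF hor s])
      show "u \<ge> 0" using i1 t by simp
      show "(\<Sum>j\<in>col m. d j powr u) \<le> 1" if "m \<in> K" for m
        by (rule column_sum_le_1[OF _ le that]) (use t in auto)
    qed
    fix \<beta> assume "assouad_exponent F \<beta>"
    then show "s + u \<le> \<beta>"
      unfolding i1(2) using t i1(1) by (intro assouad_exponent_ge[OF i0 i1(1) s]) auto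
  qed
  then show ?thesis
    using bs t box_dim_eqI[OF bs] unfolding u_def box_dim_exists_def by blast
qed

end

lemma has_box_dim_swap:
  fixes Z :: "(real \<times> real) set"
  assumes "has_box_dim Z s" "bounded Z"
  shows "has_box_dim (prod.swap ` Z) s"
proof -
  have "eventually (\<lambda>r. ln (real (covering_number r (prod.swap ` Z))) / - ln r
      = ln (real (covering_number r Z)) / - ln r) (at_right 0)"
    unfolding eventually_at_right_field
    by (intro exI[of _ 1]) (auto simp: covering_number_swap[OF assms(2)])
  then show ?thesis
    unfolding has_box_dim_def by (rule tendsto_cong[THEN iffD2]) (rule assms(1)[unfolded has_box_dim_def])
qed

lemma assouad_exponent_swap:
  fixes F :: "(real \<times> real) set"
  assumes "assouad_exponent (prod.swap ` F) \<alpha>"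
  shows "assouad_exponent F \<alpha>"
proof -
  from assms obtain C \<rho> where C: "C > 0" "\<rho> > 0"
    and cov: "\<forall>r R. 0 < r \<and> r < R \<and> R \<le> \<rho> \<longrightarrow> (\<forall>x\<in>prod.swap ` F.
      real (covering_number r (cball x R \<inter> prod.swap ` F)) \<le> C * (R / r) powr \<alpha>)"
    unfolding assouad_exponent_def by (elim exE conjE)
  have "real (covering_number r (cball x R \<inter> F)) \<le> C * (R / r) powr \<alpha>"
    if "0 < r" "r < R" "R \<le> \<rho>" "x \<in> F" for r R x
  proof -
    have "prod.swap ` (cball x R \<inter> F) = cball (prod.swap x) R \<inter> prod.swap ` F"
    proof (intro equalityI subsetI)
      fix v assume "v \<in> cball (prod.swap x) R \<inter> prod.swap ` F"
      then obtain w where "w \<in> F" "v = prod.swap w" "dist (prod.swap x) (prod.swap w) \<le> R" by auto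
      then show "v \<in> prod.swap ` (cball x R \<inter> F)" by (simp add: dist_swap)
    next
      fix v assume "v \<in> prod.swap ` (cball x R \<inter> F)"
      then obtain w where "w \<in> F" "v = prod.swap w" "dist x w \<le> R" by auto
      then show "v \<in> cball (prod.swap x) R \<inter> prod.swap ` F" by (simp add: dist_swap)
    qed
    moreover have "bounded (cball x R \<inter> F)" by (simp add: bounded_Int)
    ultimately have "covering_number r (cball x R \<inter> F) = covering_number r (cball (prod.swap x) R \<inter> prod.swap ` F)"
      using covering_number_swap[of "cball x R \<inter> F" r] that by simp
    moreover have "prod.swap x \<in> prod.swap ` F" using that(4) by (rule imageI)
    ultimately show ?thesis using cov[rule_format, of r R "prod.swap x"] that by simp
  qed
  then show ?thesis unfolding assouad_exponent_def using C by (intro exI[of _ C] exI[of _ \<rho>]) simp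
qed

lemma assouad_dim_swap: "assouad_dim (prod.swap ` F) = assouad_dim F" for F :: "(real \<times> real) set"
proof -
  have "assouad_exponent (prod.swap ` F) \<alpha> \<longleftrightarrow> assouad_exponent F \<alpha>" for \<alpha>
    using assouad_exponent_swap[of F \<alpha>] assouad_exponent_swap[of "prod.swap ` F" \<alpha>] by auto
  then show ?thesis unfolding assouad_dim_def assouad_exponent_def[symmetric] by simp
qed

context grid_system
begin

lemma fst_swap_F: "fst ` prod.swap ` F = snd ` F"
  by (simp add: image_image)

lemma slice2_eq:
  assumes "i \<in> I"
  shows "slice2 (S i) F = prod.swap ` slice1 (rows.S i) (prod.swap ` F)"
proof -
  have "fst (fixed_point (rows.S i)) = snd (fixed_point (S i))"
    using fixed_point_diag_affine[of "c i" "d i" "a i" "b i"]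
      fixed_point_diag_affine[of "d i" "c i" "b i" "a i"] ratio[OF assms] by simp
  moreover have "F \<inter> {p. snd p = v} = prod.swap ` (prod.swap ` F \<inter> {p. fst p = v})" for v
  proof (intro equalityI subsetI)
    fix z assume "z \<in> F \<inter> {p. snd p = v}"
    then show "z \<in> prod.swap ` (prod.swap ` F \<inter> {p. fst p = v})"
      by (intro image_eqI[of _ _ "prod.swap z"]) auto
  qed auto
  ultimately show ?thesis unfolding slice1_def slice2_def by simp
qed

lemma slice2_box_dim:
  assumes "i \<in> I" "has_box_dim (slice1 (rows.S i) (prod.swap ` F)) s"
  shows "has_box_dim (slice2 (S i) F) s"
proof -
  have "bounded (slice1 (rows.S i) (prod.swap ` F))"
    using rows.F(5) unfolding slice1_def by (simp add: bounded_Int)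
  then show ?thesis unfolding slice2_eq[OF assms(1)] by (rule has_box_dim_swap[OF assms(2)])
qed

theorem vertical_dimension:
  assumes ver: "\<And>i. i \<in> I \<Longrightarrow> c i \<le> d i" and strict: "\<exists>i\<in>I. c i \<noteq> d i"
  shows "box_dim_exists (snd ` F) \<and> (\<forall>i\<in>I. box_dim_exists (slice2 (S i) F))
    \<and> assouad_dim F = box_dim (snd ` F) + (MAX i\<in>I. box_dim (slice2 (S i) F))"
proof -
  have "\<exists>i\<in>I. d i \<noteq> c i" using strict by metis
  note rows.horizontal_dimension[OF ver this]
  then have *: "box_dim_exists (snd ` F)" "\<forall>i\<in>I. box_dim_exists (slice1 (rows.S i) (prod.swap ` F))"
    "assouad_dim F = box_dim (snd ` F) + (MAX i\<in>I. box_dim (slice1 (rows.S i) (prod.swap ` F)))"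
    unfolding fst_swap_F assouad_dim_swap by blast+
  have dim: "box_dim_exists (slice2 (S i) F) \<and> box_dim (slice2 (S i) F) = box_dim (slice1 (rows.S i) (prod.swap ` F))"
    if i: "i \<in> I" for i
  proof -
    obtain s where s: "has_box_dim (slice1 (rows.S i) (prod.swap ` F)) s"
      using *(2) i unfolding box_dim_exists_def by blast
    show ?thesis using slice2_box_dim[OF i s] box_dim_eqI[OF s] box_dim_eqI box_dim_exists_def by metis
  qed
  then have "(\<lambda>i. box_dim (slice2 (S i) F)) ` I = (\<lambda>i. box_dim (slice1 (rows.S i) (prod.swap ` F))) ` I"
    by (intro image_cong) auto
  then show ?thesis using * dim by simp
qed

text \<open>
  With \<open>\<alpha>\<close> the claimed maximum, the exponents \<open>\<alpha> - s1\<close> and \<open>\<alpha> - s2\<close> dominate all dimensions of vertical and of horizontal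
  slices, which is what the upper bound requires. A wide map gives the lower bound for the horizontal
  projection, a tall map the one for the vertical projection.
\<close>

theorem mixed_dimension:
  assumes wide: "i1 \<in> I" "d i1 < c i1" and tall: "i2 \<in> I" "c i2 < d i2"
  shows "box_dim_exists (fst ` F) \<and> (\<forall>i\<in>I. box_dim_exists (slice1 (S i) F))
    \<and> box_dim_exists (snd ` F) \<and> (\<forall>i\<in>I. box_dim_exists (slice2 (S i) F))
    \<and> assouad_dim F = (MAX i\<in>I. max (box_dim (fst ` F) + box_dim (slice1 (S i) F))
                                    (box_dim (snd ` F) + box_dim (slice2 (S i) F)))"
proof -
  obtain s1 t1 where s1: "s1 \<ge> 0" "(\<Sum>m\<in>K. cc m powr s1) = 1" and bs1: "has_box_dim (fst ` F) s1"
    and t1: "\<forall>i\<in>I. t1 i \<ge> 0 \<and> (\<Sum>j\<in>col (k i). d j powr t1 i) = 1 \<and> has_box_dim (slice1 (S i) F) (t1 i)"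
    by (rule dimension_data)
  obtain s2 t2 where s2: "s2 \<ge> 0" "(\<Sum>m\<in>l ` I. dd m powr s2) = 1" and "has_box_dim (fst ` prod.swap ` F) s2"
    and t2: "\<forall>i\<in>I. t2 i \<ge> 0 \<and> (\<Sum>j\<in>rows.col (l i). c j powr t2 i) = 1
      \<and> has_box_dim (slice1 (rows.S i) (prod.swap ` F)) (t2 i)"
    by (rule rows.dimension_data)
  then have bs2: "has_box_dim (snd ` F) s2" unfolding fst_swap_F by simp
  have bt2: "has_box_dim (slice2 (S i) F) (t2 i)" if "i \<in> I" for i
    using slice2_box_dim that t2 by blast
  have dim1: "box_dim (slice1 (S i) F) = t1 i" if "i \<in> I" for i using t1 that box_dim_eqI by blast
  have dim2: "box_dim (slice2 (S i) F) = t2 i" if "i \<in> I" for i using bt2 that box_dim_eqI by blast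
  define \<alpha> where "\<alpha> = (MAX i\<in>I. max (box_dim (fst ` F) + box_dim (slice1 (S i) F))
                                    (box_dim (snd ` F) + box_dim (slice2 (S i) F)))"
  have value_at: "max (box_dim (fst ` F) + box_dim (slice1 (S i) F)) (box_dim (snd ` F) + box_dim (slice2 (S i) F))
      = max (s1 + t1 i) (s2 + t2 i)" if "i \<in> I" for i
    using dim1[OF that] dim2[OF that] box_dim_eqI[OF bs1] box_dim_eqI[OF bs2] by simp
  have "(\<lambda>i. max (box_dim (fst ` F) + box_dim (slice1 (S i) F)) (box_dim (snd ` F) + box_dim (slice2 (S i) F))) ` I
      = (\<lambda>i. max (s1 + t1 i) (s2 + t2 i)) ` I"
    by (rule image_cong[OF refl value_at])
  then have \<alpha>_Max: "\<alpha> = Max ((\<lambda>i. max (s1 + t1 i) (s2 + t2 i)) ` I)" unfolding \<alpha>_def by simp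
  have "\<alpha> \<in> (\<lambda>i. max (s1 + t1 i) (s2 + t2 i)) ` I" unfolding \<alpha>_Max using I by (intro Max_in) auto
  then obtain i where i: "i \<in> I" "\<alpha> = max (s1 + t1 i) (s2 + t2 i)" by blast
  have "max (s1 + t1 j) (s2 + t2 j) \<le> \<alpha>" if "j \<in> I" for j
    unfolding \<alpha>_Max using I that by (intro Max_ge) auto
  then have le: "t1 j \<le> \<alpha> - s1" "t2 j \<le> \<alpha> - s2" if "j \<in> I" for j using that by force+
  have "assouad_dim F = \<alpha>"
  proof (rule assouad_dim_eqI)
    show "assouad_exponent F \<alpha>"
    proof (rule assouad_exponent_grid[OF s1 s2, of "\<alpha> - s1" "\<alpha> - s2"])
      show "\<alpha> - s1 \<ge> 0" "\<alpha> - s2 \<ge> 0" using le[OF i(1)] t1 t2 i(1) by force+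
      show "(\<Sum>j\<in>col m. d j powr (\<alpha> - s1)) \<le> 1" if "m \<in> K" for m
        by (rule column_sum_le_1[OF _ le(1) that]) (use t1 in auto)
      show "(\<Sum>j\<in>rows.col m. c j powr (\<alpha> - s2)) \<le> 1" if "m \<in> l ` I" for m
        by (rule rows.column_sum_le_1[OF _ le(2) that]) (use t2 in auto)
    qed auto
    fix \<beta> assume \<beta>: "assouad_exponent F \<beta>"
    then have "assouad_exponent (prod.swap ` F) \<beta>" using assouad_exponent_swap[of "prod.swap ` F" \<beta>] by simp
    then have "s2 + t2 i \<le> \<beta>"
      using t2 i(1) by (intro rows.assouad_exponent_ge[OF tall i(1) s2]) auto
    moreover have "s1 + t1 i \<le> \<beta>"
      using t1 i(1) by (intro assouad_exponent_ge[OF wide i(1) s1 _ _ \<beta>]) auto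
    ultimately show "\<alpha> \<le> \<beta>" using i(2) by simp
  qed
  then show ?thesis
    using bs1 bs2 t1 bt2 unfolding \<alpha>_def box_dim_exists_def by blast
qed

end

section \<open>The two classes of carpets\<close>

lemma subdivision_mono:
  assumes "subdivision n t" "i \<le> j" "j \<le> n" shows "t i \<le> t j"
  using assms(2,3)
proof (induction j rule: dec_induct)
  case (step j)
  then have "t j < t (Suc j)" using assms(1) by (simp add: subdivision_def)
  then show ?case using step by simp
qed simp

lemma subdivision_interval:
  assumes "subdivision n t" "i < n"
  shows "0 < t (Suc i) - t i" "0 \<le> t i" "t i + (t (Suc i) - t i) \<le> 1"
  using assms subdivision_mono[OF assms(1), of 0 i] subdivision_mono[OF assms(1), of "Suc i" n]
  by (auto simp: subdivision_def)

lemma subdivision_interval_short: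
  assumes "subdivision n t" "i < n" "n \<ge> 2"
  shows "t (Suc i) - t i < 1"
proof (cases "i = 0")
  case True
  have "t 1 < t (Suc 1)" "t (Suc 1) \<le> t n"
    using assms subdivision_mono[OF assms(1), of "Suc 1" n] by (auto simp: subdivision_def)
  then show ?thesis using True assms(1) by (simp add: subdivision_def)
next
  case False
  have "t 0 < t (Suc 0)" "t (Suc 0) \<le> t i" "t (Suc i) \<le> t n"
    using assms False subdivision_mono[OF assms(1), of "Suc 0" i] subdivision_mono[OF assms(1), of "Suc i" n]
    by (auto simp: subdivision_def)
  then show ?thesis using assms(1) by (simp add: subdivision_def)
qed

lemma subdivision_apart:
  assumes "subdivision n t" "i < n" "j < n" "i \<noteq> j"
  shows "t i + (t (Suc i) - t i) \<le> t j \<or> t j + (t (Suc j) - t j) \<le> t i"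
  using assms subdivision_mono[OF assms(1), of "Suc i" j] subdivision_mono[OF assms(1), of "Suc j" i]
  by (cases "i < j") auto

lemma lalley_gatzouras_column_system:
  assumes "extended_lalley_gatzouras I c d a b" "finite I" "I \<noteq> {}"
    and F: "is_attractor I (\<lambda>i. diag_affine (c i) (d i) (a i) (b i)) F"
  obtains k cc aa where "column_system I c d a b F k cc aa"
proof -
  from assms(1) obtain n x m y k l where n: "n \<ge> 2" and x: "subdivision n x"
    and y': "\<forall>j<n. subdivision (m j) (y j)"
    and inj: "inj_on (\<lambda>i. (k i, l i)) I"
    and sel': "\<forall>i\<in>I. k i < n \<and> l i < m (k i)
             \<and> a i = x (k i) \<and> c i = x (Suc (k i)) - x (k i)
             \<and> b i = y (k i) (l i) \<and> d i = y (k i) (Suc (l i)) - y (k i) (l i)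
             \<and> c i \<ge> d i"
    unfolding extended_lalley_gatzouras_def by (elim exE conjE)
  note y = y'[rule_format] and sel = bspec[OF sel']
  have "column_system I c d a b F k (\<lambda>j. x (Suc j) - x j) x"
  proof
    fix i assume i: "i \<in> I"
    note si = sel[OF i]
    note xi = subdivision_interval[OF x, of "k i"] subdivision_interval_short[OF x _ n, of "k i"]
    \<comment> \<open>A column can consist of one rectangle of height 1; for a selected one, \<open>d i < 1\<close> follows from \<open>d i \<le> c i < 1\<close>.\<close>
    note yi = subdivision_interval[OF y, of "k i" "l i"]
    show "0 < c i \<and> c i < 1 \<and> 0 < d i \<and> d i < 1" using si xi yi by simp
    show "0 \<le> a i \<and> a i + c i \<le> 1 \<and> 0 \<le> b i \<and> b i + d i \<le> 1" using si xi yi by simp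
    show "c i = x (Suc (k i)) - x (k i) \<and> a i = x (k i)" using si by simp
    fix j assume j: "j \<in> I"
    note sj = sel[OF j]
    show "a i + c i \<le> a j \<or> a j + c j \<le> a i" if "k i \<noteq> k j"
      using subdivision_apart[OF x _ _ that] si sj by simp
    show "b i + d i \<le> b j \<or> b j + d j \<le> b i" if "k i = k j" "i \<noteq> j"
    proof -
      have "l i \<noteq> l j" using inj i j that by (auto simp: inj_on_def)
      then show ?thesis using subdivision_apart[OF y, of "k i" "l i" "l j"] si sj that(1) by simp
    qed
  qed (use assms F in auto)
  then show ?thesis by (rule that)
qed

lemma baranski_column_system:
  assumes "n \<ge> 2" "m \<ge> 2" and x: "subdivision n x" and y: "subdivision m y" and inj: "inj_on (\<lambda>i. (k i, l i)) I"
    and sel: "\<And>i. i \<in> I \<Longrightarrow> k i < n \<and> l i < m \<and> a i = x (k i) \<and> c i = x (Suc (k i)) - x (k i)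
             \<and> b i = y (l i) \<and> d i = y (Suc (l i)) - y (l i)"
    and I: "finite I" "I \<noteq> {}"
    and F: "is_attractor I (\<lambda>i. diag_affine (c i) (d i) (a i) (b i)) F"
  shows "column_system I c d a b F k (\<lambda>j. x (Suc j) - x j) x"
proof
  fix i assume i: "i \<in> I"
  note si = sel[OF i]
  note xi = subdivision_interval[OF x, of "k i"] subdivision_interval_short[OF x _ assms(1), of "k i"]
  note yi = subdivision_interval[OF y, of "l i"] subdivision_interval_short[OF y _ assms(2), of "l i"]
  show "0 < c i \<and> c i < 1 \<and> 0 < d i \<and> d i < 1" using si xi yi by simp
  show "0 \<le> a i \<and> a i + c i \<le> 1 \<and> 0 \<le> b i \<and> b i + d i \<le> 1" using si xi yi by simp
  show "c i = x (Suc (k i)) - x (k i) \<and> a i = x (k i)" using si by simp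
  fix j assume j: "j \<in> I"
  note sj = sel[OF j]
  show "a i + c i \<le> a j \<or> a j + c j \<le> a i" if "k i \<noteq> k j"
    using subdivision_apart[OF x _ _ that] si sj by simp
  show "b i + d i \<le> b j \<or> b j + d j \<le> b i" if "k i = k j" "i \<noteq> j"
  proof -
    have "l i \<noteq> l j" using inj i j that by (auto simp: inj_on_def)
    then show ?thesis using subdivision_apart[OF y, of "l i" "l j"] si sj by simp
  qed
qed (use I F in auto)

lemma is_attractor_swap:
  assumes "is_attractor I (\<lambda>i. diag_affine (c i) (d i) (a i) (b i)) F"
  shows "is_attractor I (\<lambda>i. diag_affine (d i) (c i) (b i) (a i)) (prod.swap ` F)"
proof -
  have F: "F \<noteq> {}" "compact F" "F = (\<Union>i\<in>I. diag_affine (c i) (d i) (a i) (b i) ` F)"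
    using assms unfolding is_attractor_def by blast+
  have "compact (prod.swap ` F)"
    using F(2) by (intro compact_continuous_image continuous_on_swap)
  moreover have "prod.swap ` F = (\<Union>i\<in>I. diag_affine (d i) (c i) (b i) (a i) ` prod.swap ` F)"
  proof -
    have "prod.swap ` F = prod.swap ` (\<Union>i\<in>I. diag_affine (c i) (d i) (a i) (b i) ` F)"
      by (rule arg_cong[OF F(3)])
    also have "\<dots> = (\<Union>i\<in>I. diag_affine (d i) (c i) (b i) (a i) ` prod.swap ` F)"
      by (simp add: image_UN image_image diag_affine_def split_beta prod.swap_def)
    finally show ?thesis .
  qed
  ultimately show ?thesis using F(1) unfolding is_attractor_def by simp
qed

lemma baranski_grid_system:
  assumes "baranski I c d a b" and I: "finite I" "I \<noteq> {}"
    and F: "is_attractor I (\<lambda>i. diag_affine (c i) (d i) (a i) (b i)) F"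
  obtains k cc aa l dd bb where "grid_system I c d a b F k cc aa l dd bb"
proof -
  from assms(1) obtain n x m y k l where nm: "n \<ge> 2" "m \<ge> 2" and x: "subdivision n x" and y: "subdivision m y"
    and inj: "inj_on (\<lambda>i. (k i, l i)) I"
    and sel': "\<forall>i\<in>I. k i < n \<and> l i < m \<and> a i = x (k i) \<and> c i = x (Suc (k i)) - x (k i)
             \<and> b i = y (l i) \<and> d i = y (Suc (l i)) - y (l i)"
    unfolding baranski_def by (elim exE conjE)
  note sel = bspec[OF sel']
  have 1: "column_system I c d a b F k (\<lambda>j. x (Suc j) - x j) x"
    by (rule baranski_column_system[OF nm x y inj sel I F])
  have inj': "inj_on (\<lambda>i. (l i, k i)) I" using inj by (auto simp: inj_on_def)
  have 2: "column_system I d c b a (prod.swap ` F) l (\<lambda>j. y (Suc j) - y j) y"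
    by (rule baranski_column_system[OF nm(2,1) y x inj' _ I is_attractor_swap[OF F]]) (use sel in auto)
  have "grid_system I c d a b F k (\<lambda>j. x (Suc j) - x j) x l (\<lambda>j. y (Suc j) - y j) y"
    using 1 2 by (simp add: grid_system_def grid_system_axioms_def)
  then show ?thesis by (rule that)
qed

theorem theorem2p12:
  fixes I :: "'i set" and c d a b :: "'i \<Rightarrow> real" and F :: "(real \<times> real) set"
    and S :: "'i \<Rightarrow> real \<times> real \<Rightarrow> real \<times> real"
  assumes "self_affine_carpet I c d a b F"
    and "\<And>i. S i = diag_affine (c i) (d i) (a i) (b i)"
  shows
    "(horizontal_type I c d \<longrightarrow>
        box_dim_exists (fst ` F) \<and> (\<forall>i\<in>I. box_dim_exists (slice1 (S i) F))
        \<and> assouad_dim F = box_dim (fst ` F) + (MAX i\<in>I. box_dim (slice1 (S i) F)))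
     \<and> (vertical_type I c d \<longrightarrow>
        box_dim_exists (snd ` F) \<and> (\<forall>i\<in>I. box_dim_exists (slice2 (S i) F))
        \<and> assouad_dim F = box_dim (snd ` F) + (MAX i\<in>I. box_dim (slice2 (S i) F)))
     \<and> (mixed_type I c d \<longrightarrow>
        box_dim_exists (fst ` F) \<and> (\<forall>i\<in>I. box_dim_exists (slice1 (S i) F))
        \<and> box_dim_exists (snd ` F) \<and> (\<forall>i\<in>I. box_dim_exists (slice2 (S i) F))
        \<and> assouad_dim F =
            (MAX i\<in>I. max (box_dim (fst ` F) + box_dim (slice1 (S i) F))
                          (box_dim (snd ` F) + box_dim (slice2 (S i) F))))"
proof -
  have I: "finite I" "I \<noteq> {}" and cls: "extended_lalley_gatzouras I c d a b \<or> baranski I c d a b"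
    and strict: "\<exists>i\<in>I. c i \<noteq> d i" and F: "is_attractor I (\<lambda>i. diag_affine (c i) (d i) (a i) (b i)) F"
    using assms(1) unfolding self_affine_carpet_def by auto
  \<comment> \<open>Carpets that are not horizontal can only come from a grid.\<close>
  have lg: "horizontal_type I c d" if "extended_lalley_gatzouras I c d a b"
    using that unfolding extended_lalley_gatzouras_def horizontal_type_def by blast
  have grid: "baranski I c d a b" if "\<not> horizontal_type I c d"
    using that cls lg by blast
  have not_both: "\<not> horizontal_type I c d" if "vertical_type I c d"
    using that strict unfolding horizontal_type_def vertical_type_def by (metis order_antisym)
  show ?thesis
    unfolding assms(2)
  proof (intro conjI[of "_ \<longrightarrow> _"] impI)
    assume hor: "horizontal_type I c d"
    have "\<exists>k cc aa. column_system I c d a b F k cc aa"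
      using cls
    proof
      assume "extended_lalley_gatzouras I c d a b"
      then show ?thesis by (rule lalley_gatzouras_column_system[OF _ I F]) blast
    next
      assume "baranski I c d a b"
      then show ?thesis by (rule baranski_grid_system[OF _ I F]) (auto dest: grid_system.axioms(1))
    qed
    then obtain k cc aa where "column_system I c d a b F k cc aa" by blast
    then interpret column_system I c d a b F k cc aa .
    show "box_dim_exists (fst ` F) \<and> (\<forall>i\<in>I. box_dim_exists (slice1 (diag_affine (c i) (d i) (a i) (b i)) F))
        \<and> assouad_dim F = box_dim (fst ` F) + (MAX i\<in>I. box_dim (slice1 (diag_affine (c i) (d i) (a i) (b i)) F))"
      by (rule horizontal_dimension[OF _ strict]) (use hor in \<open>simp add: horizontal_type_def\<close>)
  next
    assume ver: "vertical_type I c d"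
    obtain k cc aa l dd bb where "grid_system I c d a b F k cc aa l dd bb"
      by (rule baranski_grid_system[OF grid[OF not_both[OF ver]] I F])
    then interpret grid_system I c d a b F k cc aa l dd bb .
    show "box_dim_exists (snd ` F) \<and> (\<forall>i\<in>I. box_dim_exists (slice2 (diag_affine (c i) (d i) (a i) (b i)) F))
        \<and> assouad_dim F = box_dim (snd ` F) + (MAX i\<in>I. box_dim (slice2 (diag_affine (c i) (d i) (a i) (b i)) F))"
      by (rule vertical_dimension[OF _ strict]) (use ver in \<open>simp add: vertical_type_def\<close>)
  next
    assume mixed: "mixed_type I c d"
    then obtain i1 i2 where i: "i1 \<in> I" "d i1 < c i1" "i2 \<in> I" "c i2 < d i2"
      unfolding mixed_type_def horizontal_type_def vertical_type_def by (auto simp: not_le)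
    have "\<not> horizontal_type I c d" using mixed by (simp add: mixed_type_def)
    then obtain k cc aa l dd bb where "grid_system I c d a b F k cc aa l dd bb"
      by (rule baranski_grid_system[OF grid I F])
    then interpret grid_system I c d a b F k cc aa l dd bb .
    show "box_dim_exists (fst ` F) \<and> (\<forall>i\<in>I. box_dim_exists (slice1 (diag_affine (c i) (d i) (a i) (b i)) F))
        \<and> box_dim_exists (snd ` F) \<and> (\<forall>i\<in>I. box_dim_exists (slice2 (diag_affine (c i) (d i) (a i) (b i)) F))
        \<and> assouad_dim F =
            (MAX i\<in>I. max (box_dim (fst ` F) + box_dim (slice1 (diag_affine (c i) (d i) (a i) (b i)) F))
                          (box_dim (snd ` F) + box_dim (slice2 (diag_affine (c i) (d i) (a i) (b i)) F)))"
      by (rule mixed_dimension[OF i])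
  qed
qed

end
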